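(* Let $F:\mathbb{R}\to\mathbb{R}$ be of class $C^2$ and let $X$ be a continuous semimartingale. Then $$F(X_t)=F(X_0)+\int_0^tF'(X_s)\,dX_s+\frac12\int_0^tF''(X_s)\,d[X]_s\quad\text{quasi-always},$$ where $\int_0^tF'(X_s)\,dX_s$ is the It\^o integral $(F'(X)\cdot X)_t$ and the last integral is a Lebesgue--Stieltjes integral.
   Context: Setup. Fix integers $1\le J^*\le J$; sample space $\Omega:=C[0,\infty)^J$ with elements $\omega=(S_1,\dots,S_J)$ of continuous functions $[0,\infty)\to\mathbb{R}$, the first $J^*$ being price paths of traded securities and the rest information paths; $\omega^*:=(S_1,\dots,S_{J^*})$; $\mathcal F$ is the $\sigma$-algebra generated by $\omega\mapsto\omega(t)$. A stopping time is an $\mathcal F$-measurable $\tau:\Omega\to[0,\infty]$ with $\omega|_{[0,\tau(\omega)]}=\omega'|_{[0,\tau(\omega)]}\Rightarrow\tau(\omega)=\tau(\omega')$; $h$ is $\tau$-measurable if that restriction equality implies $h(\omega)=h(\omega')$. A process is adapted if $\omega|_{[0,t]}=\omega'|_{[0,t]}\Rightarrow X_t(\omega)=X_t(\omega')$. A simple capital process is $\mathcal K_t(\omega)=c+\sum_{n\ge1}h_n(\omega)\cdot(\omega^*(\tau_{n+1}\wedge t)-\omega^*(\tau_n\wedge t))$ with $c\in\mathbb R$, stopping times $\tau_1\le\tau_2\le\cdots$, $\tau_n(\omega)\to\infty$ for all $\omega$, and bounded $\tau_n$-measurable $h_n:\Omega\to\mathbb R^{J^*}$. Nonnegative supermartingales: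 the smallest class of nonnegative processes containing all nonnegative simple capital processes and closed under pointwise $\liminf_k$ of sequences. A set $E\subseteq[0,\infty)\times\Omega$ holds quasi-always (q.a.) if some nonnegative supermartingale $X$ with $X_0=1$ has $X_t(\omega)=\infty$ for all $(t,\omega)\notin E$. With a cemetery symbol $\partial\notin\mathbb R$, a continuous process is an adapted $X:[0,\infty)\times\Omega\to\mathbb R\cup\{\partial\}$ such that $\mathrm{dom}\,X:=\{(t,\omega):X_t(\omega)\in\mathbb R\}$ holds q.a. and for each $\omega$ the set $\{t:X_t(\omega)\in\mathbb R\}$ contains $0$, is connected, and $X(\omega)$ is continuous on it. Continuous martingales: the smallest class $\mathcal C$ of continuous processes containing all simple capital processes and containing every continuous process $X$ for which there are $X^k\in\mathcal C$ with $\mathrm{dom}\,X\subseteq\mathrm{dom}\,X^k$ and $\sup_{s\in[0,t]}|X^k_s(\omega)-X_s(\omega)|\to0$ for all $(t,\omega)\in\mathrm{dom}\,X$. A finite variation continuous process is a continuous process $A$ with $A_0=0$ whose paths have finite total variation on $[0,t]$ for all $(t,\omega)\in\mathrm{dom}\,A$. A continuous semimartingale is $X=Y+A$ with $Y$ a continuous martingale, $A$ a finite variation continuous process, $\mathrm{dom}\,X=\mathrm{dom}\,Y=\mathrm{dom}\,A$ (standard decomposition, unique q.a.). A partition is a sequence of stopping times $0=T_0\le T_1\le\cdots$ such that $\lim_kT_k(\omega)>t$ holds q.a.; a sequence of partitions $T^n$ is fine for a continuous process $Z$ if for all $n,k,\omega$, $\sup Z_t(\omega)-\inf Z_t(\omega)\le2^{-n}$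 over real values with $t\in[T^n_{k-1}(\omega),T^n_k(\omega)]$. Processes $X^k$ converge ucqa to $X$ if $\lim_k\sup_{s\in[0,t]}|X^k_s-X_s|=0$ holds q.a. For a continuous process $H$ and continuous semimartingale $X$, the It\^o integral $(H\cdot X)_t=\int_0^tH_s\,dX_s$ is the ucqa limit of $\sum_{k\ge1}H_{T^n_{k-1}\wedge t}(X_{T^n_k\wedge t}-X_{T^n_{k-1}\wedge t})$ for a sequence of partitions fine for $H$ and both components of the standard decomposition of $X$. The quadratic variation $[X]$ is the ucqa limit of $\sum_{k\ge1}(X_{T^n_k\wedge t}-X_{T^n_{k-1}\wedge t})^2$ for such a sequence of partitions. *)

theory Defs
  imports "HOL-Analysis.Analysis"
begin

text \<open>Sample paths: \<open>\<omega> j t\<close> is the value of the j-th path (j < J) at time t.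
  The sample space \<open>C[0,\<infinity>)^J\<close> is represented by paths that are continuous on
  \<open>[0,\<infinity>)\<close> in each coordinate j < J, with canonical (zero) values for j \<ge> J
  and for negative times.  Coordinates j < Js are the traded securities.\<close>

type_synonym path = "nat \<Rightarrow> real \<Rightarrow> real"

definition Omega :: "nat \<Rightarrow> path set" where
  "Omega J = {\<omega>. (\<forall>j<J. continuous_on {0..} (\<omega> j))
                 \<and> (\<forall>j. J \<le> j \<longrightarrow> (\<forall>t. \<omega> j t = 0))
                 \<and> (\<forall>j t. t < 0 \<longrightarrow> \<omega> j t = 0)}"

definition FOmega :: "nat \<Rightarrow> path measure" where
  "FOmega J = sigma (Omega J)
     {{\<omega> \<in> Omega J. \<omega> j t \<in> B} | j t B. j < J \<and> 0 \<le> t \<and> B \<in> sets borel}"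

definition agree_upto :: "nat \<Rightarrow> path \<Rightarrow> path \<Rightarrow> ennreal \<Rightarrow> bool" where
  "agree_upto J \<omega> \<omega>' s \<longleftrightarrow> (\<forall>j<J. \<forall>t. 0 \<le> t \<and> ennreal t \<le> s \<longrightarrow> \<omega> j t = \<omega>' j t)"

definition stopping_time :: "nat \<Rightarrow> (path \<Rightarrow> ennreal) \<Rightarrow> bool" where
  "stopping_time J \<tau> \<longleftrightarrow> \<tau> \<in> borel_measurable (FOmega J) \<and>
     (\<forall>\<omega>\<in>Omega J. \<forall>\<omega>'\<in>Omega J. agree_upto J \<omega> \<omega>' (\<tau> \<omega>) \<longrightarrow> \<tau> \<omega> = \<tau> \<omega>')"

definition tau_measurable :: "nat \<Rightarrow> (path \<Rightarrow> ennreal) \<Rightarrow> (path \<Rightarrow> 'b) \<Rightarrow> bool" where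
  "tau_measurable J \<tau> h \<longleftrightarrow>
     (\<forall>\<omega>\<in>Omega J. \<forall>\<omega>'\<in>Omega J. agree_upto J \<omega> \<omega>' (\<tau> \<omega>) \<longrightarrow> h \<omega> = h \<omega>')"

definition stopped :: "(path \<Rightarrow> ennreal) \<Rightarrow> path \<Rightarrow> real \<Rightarrow> real" where
  "stopped \<tau> \<omega> t = (if \<tau> \<omega> \<le> ennreal t then enn2real (\<tau> \<omega>) else t)"

text \<open>Simple capital processes (indices of the stopping times start at 0;
  trading strategies \<open>h n \<omega> \<in> \<real>^Js\<close> are represented by their coordinates j < Js).\<close>
definition simple_capital :: "nat \<Rightarrow> nat \<Rightarrow> (real \<Rightarrow> path \<Rightarrow> real) set" where
  "simple_capital J Js = {K. \<exists>(c::real) (\<tau>::nat \<Rightarrow> path \<Rightarrow> ennreal) (h::nat \<Rightarrow> path \<Rightarrow> nat \<Rightarrow> real).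
      (\<forall>n. stopping_time J (\<tau> n)) \<and>
      (\<forall>n. \<forall>\<omega>\<in>Omega J. \<tau> n \<omega> \<le> \<tau> (Suc n) \<omega>) \<and>
      (\<forall>\<omega>\<in>Omega J. (\<lambda>n. \<tau> n \<omega>) \<longlonglongrightarrow> \<infinity>) \<and>
      (\<forall>n. \<exists>B. \<forall>\<omega>\<in>Omega J. \<forall>j<Js. \<bar>h n \<omega> j\<bar> \<le> B) \<and>
      (\<forall>n. tau_measurable J (\<tau> n) (h n)) \<and>
      (\<forall>t\<ge>0. \<forall>\<omega>\<in>Omega J. K t \<omega> = c + (\<Sum>n. \<Sum>j<Js. h n \<omega> j *
            (\<omega> j (stopped (\<tau> (Suc n)) \<omega> t) - \<omega> j (stopped (\<tau> n) \<omega> t))))}"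

inductive_set nn_supermartingale :: "nat \<Rightarrow> nat \<Rightarrow> (real \<Rightarrow> path \<Rightarrow> ennreal) set"
  for J Js where
  simple: "K \<in> simple_capital J Js \<Longrightarrow> (\<forall>t\<ge>0. \<forall>\<omega>\<in>Omega J. 0 \<le> K t \<omega>) \<Longrightarrow>
           (\<lambda>t \<omega>. ennreal (K t \<omega>)) \<in> nn_supermartingale J Js"
| liminf: "(\<And>k. X k \<in> nn_supermartingale J Js) \<Longrightarrow>
           (\<lambda>t \<omega>. liminf (\<lambda>k. X k t \<omega>)) \<in> nn_supermartingale J Js"

definition quasi_always :: "nat \<Rightarrow> nat \<Rightarrow> (real \<Rightarrow> path \<Rightarrow> bool) \<Rightarrow> bool" where
  "quasi_always J Js E \<longleftrightarrow> (\<exists>X \<in> nn_supermartingale J Js.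
      (\<forall>\<omega>\<in>Omega J. X 0 \<omega> = 1) \<and>
      (\<forall>t\<ge>0. \<forall>\<omega>\<in>Omega J. \<not> E t \<omega> \<longrightarrow> X t \<omega> = \<infinity>))"

text \<open>Processes with a cemetery state: \<open>None\<close> plays the role of \<open>\<partial>\<close>.\<close>
type_synonym cprocess = "real \<Rightarrow> path \<Rightarrow> real option"

definition adapted :: "nat \<Rightarrow> (real \<Rightarrow> path \<Rightarrow> 'a) \<Rightarrow> bool" where
  "adapted J X \<longleftrightarrow> (\<forall>t\<ge>0. \<forall>\<omega>\<in>Omega J. \<forall>\<omega>'\<in>Omega J.
      agree_upto J \<omega> \<omega>' (ennreal t) \<longrightarrow> X t \<omega> = X t \<omega>')"

definition cont_process :: "nat \<Rightarrow> nat \<Rightarrow> cprocess \<Rightarrow> bool" where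
  "cont_process J Js X \<longleftrightarrow> adapted J X \<and>
     quasi_always J Js (\<lambda>t \<omega>. X t \<omega> \<noteq> None) \<and>
     (\<forall>\<omega>\<in>Omega J. X 0 \<omega> \<noteq> None \<and>
        connected {t. 0 \<le> t \<and> X t \<omega> \<noteq> None} \<and>
        continuous_on {t. 0 \<le> t \<and> X t \<omega> \<noteq> None} (\<lambda>t. the (X t \<omega>)))"

inductive_set cont_martingale :: "nat \<Rightarrow> nat \<Rightarrow> cprocess set" for J Js where
  simple: "K \<in> simple_capital J Js \<Longrightarrow> (\<lambda>t \<omega>. Some (K t \<omega>)) \<in> cont_martingale J Js"
| limit: "cont_process J Js X \<Longrightarrow> (\<And>k. Xs k \<in> cont_martingale J Js) \<Longrightarrow>
          (\<forall>k. \<forall>t\<ge>0. \<forall>\<omega>\<in>Omega J. X t \<omega> \<noteq> None \<longrightarrow> Xs k t \<omega> \<noteq> None) \<Longrightarrow>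
          (\<forall>t\<ge>0. \<forall>\<omega>\<in>Omega J. X t \<omega> \<noteq> None \<longrightarrow>
             uniform_limit {0..t} (\<lambda>k s. the (Xs k s \<omega>)) (\<lambda>s. the (X s \<omega>)) sequentially) \<Longrightarrow>
          X \<in> cont_martingale J Js"

definition finite_variation_on :: "real \<Rightarrow> real \<Rightarrow> (real \<Rightarrow> real) \<Rightarrow> bool" where
  "finite_variation_on a b f \<longleftrightarrow> bdd_above
     {\<Sum>i<m. \<bar>f (d (Suc i)) - f (d i)\<bar> | (d::nat \<Rightarrow> real) m.
        d 0 = a \<and> d m = b \<and> (\<forall>i<m. d i \<le> d (Suc i))}"

definition fv_process :: "nat \<Rightarrow> nat \<Rightarrow> cprocess \<Rightarrow> bool" where
  "fv_process J Js A \<longleftrightarrow> cont_process J Js A \<and>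
     (\<forall>\<omega>\<in>Omega J. A 0 \<omega> = Some 0) \<and>
     (\<forall>t\<ge>0. \<forall>\<omega>\<in>Omega J. A t \<omega> \<noteq> None \<longrightarrow>
        finite_variation_on 0 t (\<lambda>s. the (A s \<omega>)))"

definition semimart_decomp :: "nat \<Rightarrow> nat \<Rightarrow> cprocess \<Rightarrow> cprocess \<Rightarrow> cprocess \<Rightarrow> bool" where
  "semimart_decomp J Js X Y A \<longleftrightarrow> Y \<in> cont_martingale J Js \<and> fv_process J Js A \<and>
     (\<forall>t\<ge>0. \<forall>\<omega>\<in>Omega J.
        (X t \<omega> \<noteq> None \<longleftrightarrow> Y t \<omega> \<noteq> None) \<and> (X t \<omega> \<noteq> None \<longleftrightarrow> A t \<omega> \<noteq> None) \<and>
        (X t \<omega> \<noteq> None \<longrightarrow> the (X t \<omega>) = the (Y t \<omega>) + the (A t \<omega>)))"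

definition cont_semimartingale :: "nat \<Rightarrow> nat \<Rightarrow> cprocess \<Rightarrow> bool" where
  "cont_semimartingale J Js X \<longleftrightarrow> (\<exists>Y A. semimart_decomp J Js X Y A)"

definition partition :: "nat \<Rightarrow> nat \<Rightarrow> (nat \<Rightarrow> path \<Rightarrow> ennreal) \<Rightarrow> bool" where
  "partition J Js T \<longleftrightarrow> (\<forall>k. stopping_time J (T k)) \<and>
     (\<forall>\<omega>\<in>Omega J. T 0 \<omega> = 0 \<and> (\<forall>k. T k \<omega> \<le> T (Suc k) \<omega>)) \<and>
     quasi_always J Js (\<lambda>t \<omega>. ennreal t < (SUP k. T k \<omega>))"

definition fine_for :: "nat \<Rightarrow> (nat \<Rightarrow> nat \<Rightarrow> path \<Rightarrow> ennreal) \<Rightarrow> cprocess \<Rightarrow> bool" where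
  "fine_for J T Z \<longleftrightarrow> (\<forall>n k. \<forall>\<omega>\<in>Omega J. \<forall>s s'.
      (0 \<le> s \<and> T n k \<omega> \<le> ennreal s \<and> ennreal s \<le> T n (Suc k) \<omega> \<and> Z s \<omega> \<noteq> None) \<longrightarrow>
      (0 \<le> s' \<and> T n k \<omega> \<le> ennreal s' \<and> ennreal s' \<le> T n (Suc k) \<omega> \<and> Z s' \<omega> \<noteq> None) \<longrightarrow>
      \<bar>the (Z s \<omega>) - the (Z s' \<omega>)\<bar> \<le> (1/2) ^ n)"

definition ucqa :: "nat \<Rightarrow> nat \<Rightarrow> (nat \<Rightarrow> real \<Rightarrow> path \<Rightarrow> real) \<Rightarrow> cprocess \<Rightarrow> bool" where
  "ucqa J Js Xs X \<longleftrightarrow> quasi_always J Js (\<lambda>t \<omega>.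
      (\<forall>s\<in>{0..t}. X s \<omega> \<noteq> None) \<and>
      uniform_limit {0..t} (\<lambda>k s. Xs k s \<omega>) (\<lambda>s. the (X s \<omega>)) sequentially)"

definition riemann_sum :: "cprocess \<Rightarrow> cprocess \<Rightarrow> (nat \<Rightarrow> path \<Rightarrow> ennreal) \<Rightarrow> real \<Rightarrow> path \<Rightarrow> real" where
  "riemann_sum H X T t \<omega> = (\<Sum>k. the (H (stopped (T k) \<omega> t) \<omega>) *
      (the (X (stopped (T (Suc k)) \<omega> t) \<omega>) - the (X (stopped (T k) \<omega> t) \<omega>)))"

definition qv_sum :: "cprocess \<Rightarrow> (nat \<Rightarrow> path \<Rightarrow> ennreal) \<Rightarrow> real \<Rightarrow> path \<Rightarrow> real" where
  "qv_sum X T t \<omega> = (\<Sum>k.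
      (the (X (stopped (T (Suc k)) \<omega> t) \<omega>) - the (X (stopped (T k) \<omega> t) \<omega>))^2)"

definition fine_for_semimart ::
  "nat \<Rightarrow> nat \<Rightarrow> cprocess \<Rightarrow> (nat \<Rightarrow> nat \<Rightarrow> path \<Rightarrow> ennreal) \<Rightarrow> bool" where
  "fine_for_semimart J Js X T \<longleftrightarrow> (\<forall>n. partition J Js (T n)) \<and>
     (\<exists>Y A. semimart_decomp J Js X Y A \<and> fine_for J T Y \<and> fine_for J T A)"

definition is_ito_integral :: "nat \<Rightarrow> nat \<Rightarrow> cprocess \<Rightarrow> cprocess \<Rightarrow> cprocess \<Rightarrow> bool" where
  "is_ito_integral J Js H X I \<longleftrightarrow> (\<forall>T. fine_for J T H \<and> fine_for_semimart J Js X T \<longrightarrow>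
      ucqa J Js (\<lambda>n. riemann_sum H X (T n)) I)"

definition is_quadratic_variation :: "nat \<Rightarrow> nat \<Rightarrow> cprocess \<Rightarrow> cprocess \<Rightarrow> bool" where
  "is_quadratic_variation J Js X Q \<longleftrightarrow> (\<forall>T. fine_for_semimart J Js X T \<longrightarrow>
      ucqa J Js (\<lambda>n. qv_sum X (T n)) Q)"

text \<open>Lebesgue--Stieltjes integral \<open>\<integral>_0^t f(s) dG(s)\<close> for a (continuous, nondecreasing) G on [0,t].\<close>
definition LS_integral :: "real \<Rightarrow> (real \<Rightarrow> real) \<Rightarrow> (real \<Rightarrow> real) \<Rightarrow> real" where
  "LS_integral t G f = integral\<^sup>L (interval_measure (\<lambda>s. G (max 0 (min s t))))
      (\<lambda>s. indicator {0..t} s * f s)"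

end

theory Submission
  imports Defs
begin

text \<open>Following Foellmer, the change of variables is a pathwise statement once the quadratic
  variation exists: if the sums of squared increments of a continuous path along a fine sequence of
  partitions converge locally uniformly, Taylor's formula shows that the Riemann sums converge to
  \<open>F(X\<^sub>t) - F(X\<^sub>0) - 1/2 \<integral> F''(X) d[X]\<close>. What remains is that the sums of squared increments along two
  fine sequences of partitions differ by a sequence that tends to 0 quasi-always. This difference is a
  stochastic integral of a small integrand. Its martingale part is controlled by an
  elementary maximal inequality for martingales and a Borel--Cantelli argument; the part that comes
  from the finite variation component is controlled pathwise.

  The processes involved are not measurable, so the times at which one would like to stop them are not
  stopping times. This is remedied by trading only on measurable grids of exit times of the basic paths,
  between which all capital processes in question oscillate little. The maximal inequality is stable
  under the limits that generate the continuous martingales.\<close>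

subsection \<open>Sums along increasing sequences of times\<close>

text \<open>The link between squares and integrals is b^2 - a^2 = (b - a)^2 + 2a(b - a): the sums of
  squares along two partitions differ by twice the difference of two left-point sums of X against X,
  whose integrand on the common refinement is at most 4 * 2^(-n). The maximal inequality is paid for
  at time 0: the capital needed to detect |M| > (3/4)^n for the martingale part M is of order
  (4/9)^n * L^2, where L bounds the path of the martingale component Y, and its summability yields
  convergence quasi-always. The ratio 3/4 could be any number strictly between 1/2 and 1. The level
  L depends on the path, and stopping Y at a fixed level would raise the measurability problem
  again. The inequality is therefore stated only for paths along which the process in question has
  stayed nonnegative, which is automatic where |Y| \<le> L, and the exceptional sets for all natural
  L are collected afterwards. A statement of this form survives locally uniform limits after an
  arbitrarily small shift.\<close>

definition cut :: "ennreal \<Rightarrow> real \<Rightarrow> real" where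
  "cut a t = (if a \<le> ennreal t then enn2real a else t)"

lemma stopped_cut: "stopped \<tau> \<omega> t = cut (\<tau> \<omega>) t"
  by (simp add: stopped_def cut_def)

lemma ennreal_cut: "0 \<le> t \<Longrightarrow> ennreal (cut a t) = min a (ennreal t)"
  by (auto simp: cut_def min_def ennreal_enn2real_if top_unique)

lemma cut_nonneg [simp]: "0 \<le> t \<Longrightarrow> 0 \<le> cut a t"
  by (simp add: cut_def)

lemma cut_le [simp]: "0 \<le> t \<Longrightarrow> cut a t \<le> t"
  using ennreal_cut[of t a] by (metis ennreal_le_iff min.cobounded2)

lemma cut_eq: "0 \<le> t \<Longrightarrow> ennreal t \<le> a \<Longrightarrow> cut a t = t"
  by (auto simp: cut_def dest: antisym)

lemma cut_eq': "a \<le> ennreal t \<Longrightarrow> cut a t = enn2real a"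
  by (auto simp: cut_def)

lemma cut_mono: "0 \<le> t \<Longrightarrow> a \<le> b \<Longrightarrow> cut a t \<le> cut b t"
  by (subst ennreal_le_iff[symmetric]) (auto simp: ennreal_cut min.coboundedI1)

lemma cut_0 [simp]: "cut a 0 = 0" "0 \<le> t \<Longrightarrow> cut 0 t = 0"
  by (auto simp: cut_def)

lemma cut_cut: "0 \<le> t \<Longrightarrow> cut a (cut b t) = cut (min a b) t"
  by (rule iffD1[OF ennreal_inj]) (auto simp: ennreal_cut min.assoc)

text \<open>Stated for one path and one sequence of times, so that index arguments are separated
  from the dependence on \<omega>. For increasing \<open>T\<close> the value of \<open>h k\<close>
  at an infinite \<open>T k\<close> is immaterial, since it multiplies an increment equal to
  0.\<close>

definition gsum :: "(nat \<Rightarrow> real) \<Rightarrow> (real \<Rightarrow> real) \<Rightarrow> (nat \<Rightarrow> ennreal) \<Rightarrow> real \<Rightarrow> real" where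
  "gsum h y T t = (\<Sum>k. h k * (y (cut (T (Suc k)) t) - y (cut (T k) t)))"

definition qsum :: "(real \<Rightarrow> real) \<Rightarrow> (nat \<Rightarrow> ennreal) \<Rightarrow> real \<Rightarrow> real" where
  "qsum y T t = (\<Sum>k. (y (cut (T (Suc k)) t) - y (cut (T k) t))\<^sup>2)"

text \<open>The weight may be read off at the time itself instead of the time cut at t: once
  \<open>T k\<close> exceeds t the increment vanishes, so the convention that
  \<open>enn2real\<close> of infinity is 0 does no harm. The weights then no longer depend on
  t.\<close>

lemma riemann_sum_gsum:
  "riemann_sum H X T t \<omega> =
    gsum (\<lambda>k. the (H (enn2real (T k \<omega>)) \<omega>)) (\<lambda>s. the (X s \<omega>)) (\<lambda>k. T k \<omega>) t"
  if "0 \<le> t" "mono (\<lambda>k. T k \<omega>)"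
proof -
  have "the (H (cut (T k \<omega>) t) \<omega>) * (the (X (cut (T (Suc k) \<omega>) t) \<omega>) - the (X (cut (T k \<omega>) t) \<omega>)) =
        the (H (enn2real (T k \<omega>)) \<omega>) * (the (X (cut (T (Suc k) \<omega>) t) \<omega>) - the (X (cut (T k \<omega>) t) \<omega>))" for k
  proof (cases "T k \<omega> \<le> ennreal t")
    case False
    moreover have "T k \<omega> \<le> T (Suc k) \<omega>" using that(2) by (simp add: mono_def)
    ultimately have "cut (T k \<omega>) t = t" "cut (T (Suc k) \<omega>) t = t"
      using that(1) by (auto intro!: cut_eq)
    then show ?thesis by simp
  qed (simp add: cut_eq')
  then show ?thesis by (simp only: riemann_sum_def gsum_def stopped_cut)
qed

lemma qv_sum_qsum: "qv_sum X T t \<omega> = qsum (\<lambda>s. the (X s \<omega>)) (\<lambda>k. T k \<omega>) t"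
  by (simp add: qv_sum_def qsum_def stopped_cut)

lemma gsum_fin:
  assumes "0 \<le> t" "mono T" "ennreal t \<le> T N"
  shows "gsum h y T t = (\<Sum>k<N. h k * (y (cut (T (Suc k)) t) - y (cut (T k) t)))"
  unfolding gsum_def
proof (rule suminf_finite)
  fix k assume "k \<notin> {..<N}"
  then have "T N \<le> T k" "T N \<le> T (Suc k)" using assms(2) by (auto simp: mono_def)
  then have "cut (T k) t = t" "cut (T (Suc k)) t = t"
    using assms by (auto intro!: cut_eq intro: order_trans)
  then show "h k * (y (cut (T (Suc k)) t) - y (cut (T k) t)) = 0" by simp
qed simp

lemma qsum_fin:
  assumes "0 \<le> t" "mono T" "ennreal t \<le> T N"
  shows "qsum y T t = (\<Sum>k<N. (y (cut (T (Suc k)) t) - y (cut (T k) t))\<^sup>2)"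
  unfolding qsum_def
proof (rule suminf_finite)
  fix k assume "k \<notin> {..<N}"
  then have "T N \<le> T k" "T N \<le> T (Suc k)" using assms(2) by (auto simp: mono_def)
  then have "cut (T k) t = t" "cut (T (Suc k)) t = t"
    using assms by (auto intro!: cut_eq intro: order_trans)
  then show "(y (cut (T (Suc k)) t) - y (cut (T k) t))\<^sup>2 = 0" by simp
qed simp

lemma gsum_0 [simp]: "gsum h y T 0 = 0" by (simp add: gsum_def)
lemma qsum_0 [simp]: "qsum y T 0 = 0" by (simp add: qsum_def)

lemma gsum_eq:
  assumes "0 \<le> t" "mono T" "T i \<le> ennreal t" "ennreal t \<le> T (Suc i)"
  shows "gsum h y T t = (\<Sum>k<i. h k * (y (enn2real (T (Suc k))) - y (enn2real (T k))))
           + h i * (y t - y (enn2real (T i)))"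
proof -
  have "T k \<le> ennreal t" if "k \<le> i" for k
    using assms(2,3) that by (meson monoD order_trans)
  then show ?thesis
    unfolding gsum_fin[OF assms(1,2,4)]
    using assms by (auto simp: cut_eq' cut_eq intro!: sum.cong)
qed

lemma gsum_inc:
  assumes "mono T" "T i \<le> ennreal a" "0 \<le> a" "a \<le> b" "ennreal b \<le> T (Suc i)"
  shows "gsum h y T b - gsum h y T a = h i * (y b - y a)"
proof -
  have ab: "ennreal a \<le> ennreal b" using assms by (simp add: ennreal_leI)
  then have "ennreal a \<le> T (Suc i)" using assms(5) by (rule order_trans)
  with ab have "gsum h y T a = (\<Sum>k<i. h k * (y (enn2real (T (Suc k))) - y (enn2real (T k))))
           + h i * (y a - y (enn2real (T i)))"
   "gsum h y T b = (\<Sum>k<i. h k * (y (enn2real (T (Suc k))) - y (enn2real (T k))))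
           + h i * (y b - y (enn2real (T i)))"
    using assms by (auto intro!: gsum_eq intro: order_trans)
  then show ?thesis by (simp add: algebra_simps)
qed

lemma ex_index:
  fixes T :: "nat \<Rightarrow> ennreal"
  assumes "T 0 \<le> t" "t < T N"
  shows "\<exists>i<N. T i \<le> t \<and> t < T (Suc i)"
  using assms(2)
proof (induction N)
  case 0 with assms(1) show ?case by auto
next
  case (Suc N) then show ?case by (cases "t < T N") (auto simp: less_Suc_eq not_less)
qed

lemma telescope_cut:
  fixes \<phi> :: "real \<Rightarrow> real"
  assumes "0 \<le> t" "R 0 = 0" "ennreal t \<le> R N"
  shows "(\<Sum>k<N. \<phi> (cut (R (Suc k)) t) - \<phi> (cut (R k) t)) = \<phi> t - \<phi> 0"
  using assms by (simp add: sum_lessThan_telescope[of "\<lambda>k. \<phi> (cut (R k) t)"] cut_eq)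

text \<open>Summation by parts: b^2 - a^2 = (b - a)^2 + 2a(b - a) on each step, and the squares
  telescope. Questions about sums of squares become questions about left-point sums, to which
  martingale arguments apply.\<close>

lemma qsum_gsum:
  assumes "0 \<le> t" "mono T" "T 0 = 0" "ennreal t \<le> T N"
  shows "qsum y T t = (y t)\<^sup>2 - (y 0)\<^sup>2 - 2 * gsum (\<lambda>k. y (enn2real (T k))) y T t"
proof -
  have *: "y (enn2real (T k)) * (y (cut (T (Suc k)) t) - y (cut (T k) t)) =
    y (cut (T k) t) * (y (cut (T (Suc k)) t) - y (cut (T k) t))" for k
  proof (cases "T k \<le> ennreal t")
    case False
    moreover have "T k \<le> T (Suc k)" using assms by (simp add: mono_def)
    ultimately have "cut (T k) t = t" "cut (T (Suc k)) t = t"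
      using assms by (auto intro!: cut_eq)
    then show ?thesis by simp
  qed (simp add: cut_eq')
  have "(\<Sum>k<N. (y (cut (T (Suc k)) t))\<^sup>2 - (y (cut (T k) t))\<^sup>2) = (y t)\<^sup>2 - (y 0)\<^sup>2"
    using assms telescope_cut[of t T N "\<lambda>s. (y s)\<^sup>2"] by simp
  moreover have "(\<Sum>k<N. (y (cut (T (Suc k)) t) - y (cut (T k) t))\<^sup>2) =
    (\<Sum>k<N. (y (cut (T (Suc k)) t))\<^sup>2 - (y (cut (T k) t))\<^sup>2) -
    2 * (\<Sum>k<N. y (cut (T k) t) * (y (cut (T (Suc k)) t) - y (cut (T k) t)))"
    by (simp add: sum_distrib_left flip: sum_subtractf)
       (rule sum.cong, auto simp: power2_eq_square algebra_simps)
  ultimately show ?thesis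
    unfolding qsum_fin[OF assms(1,2,4)] gsum_fin[OF assms(1,2,4)] * by simp
qed

section \<open>Common refinement of two sequences of times\<close>

text \<open>\<open>merge_idx T S k = (i, j)\<close> means that the \<open>k\<close>-th time of the common refinement comes after \<open>i\<close> steps
  of \<open>T\<close> and \<open>j\<close> steps of \<open>S\<close>.\<close>

primrec merge_idx :: "(nat \<Rightarrow> ennreal) \<Rightarrow> (nat \<Rightarrow> ennreal) \<Rightarrow> nat \<Rightarrow> nat \<times> nat" where
  "merge_idx T S 0 = (0, 0)"
| "merge_idx T S (Suc k) = (let (i, j) = merge_idx T S k in
     if T (Suc i) \<le> S (Suc j) then (Suc i, j) else (i, Suc j))"

definition merged :: "(nat \<Rightarrow> ennreal) \<Rightarrow> (nat \<Rightarrow> ennreal) \<Rightarrow> nat \<Rightarrow> ennreal" where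
  "merged T S k = max (T (fst (merge_idx T S k))) (S (snd (merge_idx T S k)))"

lemma merge_idx_sum: "fst (merge_idx T S k) + snd (merge_idx T S k) = k"
  by (induction k) (auto simp: Let_def split: prod.splits)

context
  fixes T S :: "nat \<Rightarrow> ennreal"
  assumes mono: "mono T" "mono S" and zero: "T 0 = 0" "S 0 = 0"
begin

private lemma mono_Suc: "T k \<le> T (Suc k)" "S k \<le> S (Suc k)"
  using mono by (auto simp: mono_def)

text \<open>The invariant of the merge: since the earlier of the two candidates is always taken,
  neither sequence is advanced past the next time of the other. It turns the maximum in
  \<open>merged\<close> into the minimum of \<open>merged_Suc\<close>.\<close>

lemma merge_cross:
  "T (fst (merge_idx T S k)) \<le> S (Suc (snd (merge_idx T S k)))
   \<and> S (snd (merge_idx T S k)) \<le> T (Suc (fst (merge_idx T S k)))"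
proof (induction k)
  case (Suc k)
  obtain i j where ij: "merge_idx T S k = (i, j)" by fastforce
  then have "T i \<le> S (Suc j)" "S j \<le> T (Suc i)" using Suc by auto
  moreover have "T i \<le> T (Suc i)" "S j \<le> S (Suc j)"
    "T (Suc i) \<le> T (Suc (Suc i))" "S (Suc j) \<le> S (Suc (Suc j))"
    by (rule mono_Suc)+
  ultimately show ?case using ij by (auto simp: not_le)
qed (auto simp: zero)

lemma merged_0 [simp]: "merged T S 0 = 0" by (simp add: merged_def zero)

lemma merged_Suc:
  "merged T S (Suc k) = min (T (Suc (fst (merge_idx T S k)))) (S (Suc (snd (merge_idx T S k))))"
  using merge_cross[of k] by (auto simp: merged_def Let_def max_def min_def split: prod.splits)

lemma merged_le:
  "T (fst (merge_idx T S k)) \<le> merged T S k" "S (snd (merge_idx T S k)) \<le> merged T S k"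
  "merged T S (Suc k) \<le> T (Suc (fst (merge_idx T S k)))"
  "merged T S (Suc k) \<le> S (Suc (snd (merge_idx T S k)))"
  unfolding merged_Suc by (auto simp: merged_def)

lemma mono_merged: "mono (merged T S)"
  unfolding mono_iff_le_Suc
proof
  fix k show "merged T S k \<le> merged T S (Suc k)"
    unfolding merged_Suc unfolding merged_def using merge_cross[of k] mono_Suc by auto
qed

text \<open>Pigeonhole: after a + b steps the merge has made at least a steps of \<open>T\<close> or
  at least b steps of \<open>S\<close>.\<close>

lemma merged_greater: "t < T a \<Longrightarrow> t < S b \<Longrightarrow> t < merged T S (a + b)"
proof -
  assume "t < T a" "t < S b"
  have "a \<le> fst (merge_idx T S (a+b)) \<or> b \<le> snd (merge_idx T S (a+b))"
    using merge_idx_sum[of T S "a+b"] by linarith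
  then show ?thesis
    using \<open>t < T a\<close> \<open>t < S b\<close> mono unfolding merged_def
    by (auto simp: mono_def less_max_iff_disj intro: less_le_trans)
qed

text \<open>Between consecutive merged times both indices are constant, so both sums move in
  proportion to the same increment of y; beyond t nothing moves.\<close>

lemma gsum_merged_inc:
  assumes "0 \<le> t"
  shows "gsum h y T (cut (merged T S (Suc k)) t) - gsum h y T (cut (merged T S k) t) =
      h (fst (merge_idx T S k)) * (y (cut (merged T S (Suc k)) t) - y (cut (merged T S k) t))"
    and "gsum h y S (cut (merged T S (Suc k)) t) - gsum h y S (cut (merged T S k) t) =
      h (snd (merge_idx T S k)) * (y (cut (merged T S (Suc k)) t) - y (cut (merged T S k) t))"
proof -
  have m: "merged T S k \<le> merged T S (Suc k)" using mono_merged by (simp add: mono_def)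
  show "gsum h y T (cut (merged T S (Suc k)) t) - gsum h y T (cut (merged T S k) t) =
      h (fst (merge_idx T S k)) * (y (cut (merged T S (Suc k)) t) - y (cut (merged T S k) t))"
  proof (cases "merged T S k \<le> ennreal t")
    case True
    have "merged T S k \<le> T (Suc (fst (merge_idx T S k)))"
      "merged T S k \<le> S (Suc (snd (merge_idx T S k)))"
      using m merged_le(3,4)[of k] by (auto intro: order_trans)
    with True show ?thesis using assms m merged_le[of k]
      by (intro gsum_inc mono) (auto simp: ennreal_cut cut_mono min.coboundedI1 min_absorb1 intro: order_trans)
  next
    case False
    then have "cut (merged T S k) t = t" "cut (merged T S (Suc k)) t = t"
      using assms m by (auto intro!: cut_eq)
    then show ?thesis by simp
  qed
  show "gsum h y S (cut (merged T S (Suc k)) t) - gsum h y S (cut (merged T S k) t) =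
      h (snd (merge_idx T S k)) * (y (cut (merged T S (Suc k)) t) - y (cut (merged T S k) t))"
  proof (cases "merged T S k \<le> ennreal t")
    case True
    have "merged T S k \<le> T (Suc (fst (merge_idx T S k)))"
      "merged T S k \<le> S (Suc (snd (merge_idx T S k)))"
      using m merged_le(3,4)[of k] by (auto intro: order_trans)
    with True show ?thesis using assms m merged_le[of k]
      by (intro gsum_inc mono) (auto simp: ennreal_cut cut_mono min.coboundedI1 min_absorb1 intro: order_trans)
  next
    case False
    then have "cut (merged T S k) t = t" "cut (merged T S (Suc k)) t = t"
      using assms m by (auto intro!: cut_eq)
    then show ?thesis by simp
  qed
qed

lemma gsum_merged:
  assumes t: "0 \<le> t" "ennreal t < T a" "ennreal t < S b"
  shows "gsum h y T t = gsum (\<lambda>k. h (fst (merge_idx T S k))) y (merged T S) t"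
    and "gsum h y S t = gsum (\<lambda>k. h (snd (merge_idx T S k))) y (merged T S) t"
proof -
  let ?R = "merged T S"
  have N: "ennreal t \<le> ?R (a + b)" using merged_greater t(2,3) by (simp add: less_imp_le)
  show "gsum h y T t = gsum (\<lambda>k. h (fst (merge_idx T S k))) y ?R t"
    unfolding gsum_fin[OF t(1) mono_merged N]
    using telescope_cut[OF t(1) merged_0 N, of "gsum h y T"] gsum_merged_inc(1)[OF t(1)] by simp
  show "gsum h y S t = gsum (\<lambda>k. h (snd (merge_idx T S k))) y ?R t"
    unfolding gsum_fin[OF t(1) mono_merged N]
    using telescope_cut[OF t(1) merged_0 N, of "gsum h y S"] gsum_merged_inc(2)[OF t(1)] by simp
qed

end

lemma tendsto_top_mono_ennreal:
  fixes T :: "nat \<Rightarrow> ennreal"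
  assumes "mono T"
  shows "T \<longlonglongrightarrow> \<infinity> \<longleftrightarrow> (\<forall>t\<ge>0. \<exists>N. ennreal t < T N)"
proof
  assume "T \<longlonglongrightarrow> \<infinity>"
  then show "\<forall>t\<ge>0. \<exists>N. ennreal t < T N"
    by (auto dest!: order_tendstoD(1)[of _ _ _ "ennreal _"] simp: eventually_sequentially)
       (metis (no_types, lifting) \<open>T \<longlonglongrightarrow> \<infinity>\<close> ennreal_less_top eventually_sequentially infinity_ennreal_def order_refl order_tendstoD(1))
next
  assume *: "\<forall>t\<ge>0. \<exists>N. ennreal t < T N"
  show "T \<longlonglongrightarrow> \<infinity>"
  proof (rule order_tendstoI)
    fix a :: ennreal assume "a < \<infinity>"
    then obtain t where "a = ennreal t" "0 \<le> t" by (cases a) auto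
    with * obtain N where "a < T N" by blast
    then show "\<forall>\<^sub>F x in sequentially. a < T x"
      unfolding eventually_sequentially using assms by (auto simp: mono_def intro: less_le_trans)
  qed auto
qed

subsection \<open>Strategies and nonnegative supermartingales\<close>

lemma agree_mono: "agree_upto J \<omega> \<omega>' s \<Longrightarrow> s' \<le> s \<Longrightarrow> agree_upto J \<omega> \<omega>' s'"
  by (auto simp: agree_upto_def intro: order_trans)

lemma agree_sym: "agree_upto J \<omega> \<omega>' s \<Longrightarrow> agree_upto J \<omega>' \<omega> s"
  by (auto simp: agree_upto_def)

text \<open>The path-dependence half of \<open>stopping_time\<close>. Times that define positions in
  the class \<open>mart\<close> below need only this half; measurability is supplied by the
  grids.\<close>

definition path_stopping :: "nat \<Rightarrow> (path \<Rightarrow> ennreal) \<Rightarrow> bool" where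
  "path_stopping J \<tau> \<longleftrightarrow>
     (\<forall>\<omega>\<in>Omega J. \<forall>\<omega>'\<in>Omega J. agree_upto J \<omega> \<omega>' (\<tau> \<omega>) \<longrightarrow> \<tau> \<omega> = \<tau> \<omega>')"

lemma stopping_time_iff:
  "stopping_time J \<tau> \<longleftrightarrow> \<tau> \<in> borel_measurable (FOmega J) \<and> path_stopping J \<tau>"
  by (simp add: stopping_time_def path_stopping_def)

lemma path_stoppingD:
  "path_stopping J \<tau> \<Longrightarrow> \<omega> \<in> Omega J \<Longrightarrow> \<omega>' \<in> Omega J \<Longrightarrow> agree_upto J \<omega> \<omega>' s \<Longrightarrow> \<tau> \<omega> \<le> s \<Longrightarrow> \<tau> \<omega>' = \<tau> \<omega>"
  unfolding path_stopping_def by (metis agree_mono)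

lemma path_stopping_le_iff:
  assumes "path_stopping J \<tau>" "\<omega> \<in> Omega J" "\<omega>' \<in> Omega J" "agree_upto J \<omega> \<omega>' s"
  shows "\<tau> \<omega> \<le> s \<longleftrightarrow> \<tau> \<omega>' \<le> s"
  using path_stoppingD[OF assms(1)] assms agree_sym by metis

lemma path_stopping_cut:
  assumes "path_stopping J \<tau>" "\<omega> \<in> Omega J" "\<omega>' \<in> Omega J" "agree_upto J \<omega> \<omega>' (ennreal t)"
  shows "cut (\<tau> \<omega>') t = cut (\<tau> \<omega>) t"
  using path_stopping_le_iff[OF assms] path_stoppingD[OF assms] unfolding cut_def by metis

text \<open>The order of two such times is decided at the earlier one: the path up to there fixes
  the earlier time, and if the other time overtook it on \<omega>', it would by symmetry do so on
  \<omega> as well.\<close>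

lemma path_stopping_less_iff:
  assumes "path_stopping J \<tau>" "path_stopping J \<sigma>" "\<omega> \<in> Omega J" "\<omega>' \<in> Omega J"
    and "agree_upto J \<omega> \<omega>' (min (\<tau> \<omega>) (\<sigma> \<omega>))"
  shows "\<tau> \<omega> \<le> \<sigma> \<omega> \<longleftrightarrow> \<tau> \<omega>' \<le> \<sigma> \<omega>'"
proof (cases "\<tau> \<omega> \<le> \<sigma> \<omega>")
  case True
  then have "agree_upto J \<omega> \<omega>' (\<tau> \<omega>)" using assms(5) by (simp add: min_def)
  then show ?thesis
    using True assms(1-4) path_stoppingD[of J \<tau> \<omega> \<omega>' "\<tau> \<omega>"] path_stoppingD[of J \<sigma> \<omega>' \<omega> "\<tau> \<omega>"] agree_sym
    by (metis linear order_refl)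
next
  case False
  then have "agree_upto J \<omega> \<omega>' (\<sigma> \<omega>)" using assms(5) by (simp add: min_def)
  then show ?thesis
    using False assms(1-4) path_stoppingD[of J \<sigma> \<omega> \<omega>' "\<sigma> \<omega>"] path_stoppingD[of J \<tau> \<omega>' \<omega> "\<sigma> \<omega>"] agree_sym
    by (metis order_refl)
qed

lemma path_stopping_const: "path_stopping J (\<lambda>_. a)"
  by (simp add: path_stopping_def)

lemma path_stopping_max:
  assumes "path_stopping J \<tau>" "path_stopping J \<sigma>"
  shows "path_stopping J (\<lambda>\<omega>. max (\<tau> \<omega>) (\<sigma> \<omega>))"
  unfolding path_stopping_def
proof (intro ballI impI)
  fix \<omega> \<omega>' assume *: "\<omega> \<in> Omega J" "\<omega>' \<in> Omega J" "agree_upto J \<omega> \<omega>' (max (\<tau> \<omega>) (\<sigma> \<omega>))"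
  show "max (\<tau> \<omega>) (\<sigma> \<omega>) = max (\<tau> \<omega>') (\<sigma> \<omega>')"
    using path_stoppingD[OF assms(1) *] path_stoppingD[OF assms(2) *] by simp
qed

definition path_sequence :: "nat \<Rightarrow> (nat \<Rightarrow> path \<Rightarrow> ennreal) \<Rightarrow> bool" where
  "path_sequence J T \<longleftrightarrow> (\<forall>k. path_stopping J (T k)) \<and>
     (\<forall>\<omega>\<in>Omega J. T 0 \<omega> = 0 \<and> mono (\<lambda>k. T k \<omega>))"

lemma path_sequenceD:
  assumes "path_sequence J T"
  shows "path_stopping J (T k)" "\<omega> \<in> Omega J \<Longrightarrow> T 0 \<omega> = 0" "\<omega> \<in> Omega J \<Longrightarrow> mono (\<lambda>k. T k \<omega>)"
  using assms by (auto simp: path_sequence_def)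

context
  fixes J :: nat and T S :: "nat \<Rightarrow> path \<Rightarrow> ennreal"
  assumes T: "path_sequence J T" and S: "path_sequence J S"
begin

text \<open>The branch taken at each step depends only on which of \<open>T (Suc i)\<close> and
  \<open>S (Suc j)\<close> comes first, and this is known at the smaller of the two, which is the
  next merged time.\<close>

lemma merge_idx_agree:
  assumes "\<omega> \<in> Omega J" "\<omega>' \<in> Omega J"
    and "agree_upto J \<omega> \<omega>' (merged (\<lambda>k. T k \<omega>) (\<lambda>k. S k \<omega>) k)"
  shows "merge_idx (\<lambda>k. T k \<omega>') (\<lambda>k. S k \<omega>') k = merge_idx (\<lambda>k. T k \<omega>) (\<lambda>k. S k \<omega>) k"
  using assms(3)
proof (induction k)
  case (Suc k)
  have TS: "mono (\<lambda>k. T k \<omega>)" "mono (\<lambda>k. S k \<omega>)" "T 0 \<omega> = 0" "S 0 \<omega> = 0"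
    by (intro path_sequenceD[OF T] path_sequenceD[OF S] assms)+
  have "agree_upto J \<omega> \<omega>' (merged (\<lambda>k. T k \<omega>) (\<lambda>k. S k \<omega>) k)"
    by (rule agree_mono[OF Suc.prems monoD[OF mono_merged[OF TS]]]) simp
  note IH = Suc.IH[OF this]
  obtain i j where ij: "merge_idx (\<lambda>k. T k \<omega>) (\<lambda>k. S k \<omega>) k = (i, j)" by fastforce
  have "agree_upto J \<omega> \<omega>' (min (T (Suc i) \<omega>) (S (Suc j) \<omega>))"
    using Suc.prems unfolding merged_Suc[OF TS] ij by simp
  then have "T (Suc i) \<omega> \<le> S (Suc j) \<omega> \<longleftrightarrow> T (Suc i) \<omega>' \<le> S (Suc j) \<omega>'"
    by (rule path_stopping_less_iff[OF path_sequenceD(1)[OF T] path_sequenceD(1)[OF S] assms(1,2)])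
  then show ?case using IH ij by simp
qed simp

lemma path_stopping_merged: "path_stopping J (\<lambda>\<omega>. merged (\<lambda>k. T k \<omega>) (\<lambda>k. S k \<omega>) n)"
  unfolding path_stopping_def
proof (intro ballI impI)
  fix \<omega> \<omega>' assume *: "\<omega> \<in> Omega J" "\<omega>' \<in> Omega J"
    "agree_upto J \<omega> \<omega>' (merged (\<lambda>k. T k \<omega>) (\<lambda>k. S k \<omega>) n)"
  have TS: "mono (\<lambda>k. T k \<omega>)" "mono (\<lambda>k. S k \<omega>)" "T 0 \<omega> = 0" "S 0 \<omega> = 0"
    by (intro path_sequenceD[OF T] path_sequenceD[OF S] *)+
  define i j where "i = fst (merge_idx (\<lambda>k. T k \<omega>) (\<lambda>k. S k \<omega>) n)"
    and "j = snd (merge_idx (\<lambda>k. T k \<omega>) (\<lambda>k. S k \<omega>) n)"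
  have "T i \<omega> \<le> merged (\<lambda>k. T k \<omega>) (\<lambda>k. S k \<omega>) n" "S j \<omega> \<le> merged (\<lambda>k. T k \<omega>) (\<lambda>k. S k \<omega>) n"
    unfolding i_def j_def by (fact merged_le(1)[OF TS] merged_le(2)[OF TS])+
  then have "T i \<omega>' = T i \<omega>" "S j \<omega>' = S j \<omega>"
    using path_stoppingD[OF path_sequenceD(1)[OF T] *] path_stoppingD[OF path_sequenceD(1)[OF S] *]
    by blast+
  moreover have "merge_idx (\<lambda>k. T k \<omega>') (\<lambda>k. S k \<omega>') n = (i, j)"
    unfolding merge_idx_agree[OF *] i_def j_def by (rule prod.collapse[symmetric])
  moreover have "merge_idx (\<lambda>k. T k \<omega>) (\<lambda>k. S k \<omega>) n = (i, j)"
    unfolding i_def j_def by (rule prod.collapse[symmetric])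
  ultimately show "merged (\<lambda>k. T k \<omega>) (\<lambda>k. S k \<omega>) n = merged (\<lambda>k. T k \<omega>') (\<lambda>k. S k \<omega>') n"
    unfolding merged_def by (simp only: fst_conv snd_conv)
qed

lemma path_sequence_merged: "path_sequence J (\<lambda>k \<omega>. merged (\<lambda>k. T k \<omega>) (\<lambda>k. S k \<omega>) k)"
  using path_stopping_merged T S mono_merged merged_0 by (simp add: path_sequence_def)

end

text \<open>The index pairs form a countable set, so each possible pair is treated separately and
  the results are recombined.\<close>

lemma measurable_merge_idx:
  fixes T S :: "nat \<Rightarrow> 'a \<Rightarrow> ennreal"
  assumes [measurable]: "\<And>k. T k \<in> borel_measurable M" "\<And>k. S k \<in> borel_measurable M"
  shows "(\<lambda>\<omega>. merge_idx (\<lambda>k. T k \<omega>) (\<lambda>k. S k \<omega>) k) \<in> measurable M (count_space UNIV)"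
proof (induction k)
  case (Suc k)
  note [measurable] = this
  define f where "f p \<omega> = (if T (Suc (fst p)) \<omega> \<le> S (Suc (snd p)) \<omega> then (Suc (fst p), snd p)
    else (fst p, Suc (snd p)))" for p \<omega>
  have "f p \<in> measurable M (count_space UNIV)" for p
    unfolding f_def by measurable
  then have "(\<lambda>\<omega>. f (merge_idx (\<lambda>k. T k \<omega>) (\<lambda>k. S k \<omega>) k) \<omega>) \<in> measurable M (count_space UNIV)"
    by (rule measurable_compose_countable[OF _ Suc])
  then show ?case by (simp add: f_def Let_def split_beta)
qed simp

lemma measurable_merged:
  fixes T S :: "nat \<Rightarrow> 'a \<Rightarrow> ennreal"
  assumes [measurable]: "\<And>k. T k \<in> borel_measurable M" "\<And>k. S k \<in> borel_measurable M"
  shows "(\<lambda>\<omega>. merged (\<lambda>k. T k \<omega>) (\<lambda>k. S k \<omega>) k) \<in> borel_measurable M"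
proof -
  have "(\<lambda>\<omega>. max (T (fst p) \<omega>) (S (snd p) \<omega>)) \<in> borel_measurable M" for p by measurable
  then show ?thesis
    unfolding merged_def
    by (rule measurable_compose_countable[OF _ measurable_merge_idx[OF assms]])
qed

section \<open>Simple capital processes as gains of strategies\<close>

text \<open>The first stopping time is normalised to 0, so that two strategies have a common refinement.\<close>

definition strategy :: "nat \<Rightarrow> nat \<Rightarrow> (nat \<Rightarrow> path \<Rightarrow> ennreal) \<Rightarrow> (nat \<Rightarrow> path \<Rightarrow> nat \<Rightarrow> real) \<Rightarrow> bool" where
  "strategy J Js T h \<longleftrightarrow> path_sequence J T \<and> (\<forall>k. T k \<in> borel_measurable (FOmega J)) \<and>
     (\<forall>\<omega>\<in>Omega J. \<forall>t\<ge>0. \<exists>N. ennreal t < T N \<omega>) \<and>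
     (\<forall>n. \<exists>B. \<forall>\<omega>\<in>Omega J. \<forall>j<Js. \<bar>h n \<omega> j\<bar> \<le> B) \<and>
     (\<forall>n. tau_measurable J (T n) (h n))"

definition gains :: "nat \<Rightarrow> (nat \<Rightarrow> path \<Rightarrow> ennreal) \<Rightarrow> (nat \<Rightarrow> path \<Rightarrow> nat \<Rightarrow> real) \<Rightarrow> real \<Rightarrow> path \<Rightarrow> real" where
  "gains Js T h t \<omega> = (\<Sum>j<Js. gsum (\<lambda>n. h n \<omega> j) (\<omega> j) (\<lambda>n. T n \<omega>) t)"

lemma strategyD:
  assumes "strategy J Js T h"
  shows "path_sequence J T" "T k \<in> borel_measurable (FOmega J)"
    "\<omega> \<in> Omega J \<Longrightarrow> 0 \<le> t \<Longrightarrow> \<exists>N. ennreal t < T N \<omega>"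
    "\<exists>B. \<forall>\<omega>\<in>Omega J. \<forall>j<Js. \<bar>h k \<omega> j\<bar> \<le> B"
    "tau_measurable J (T k) (h k)"
  using assms unfolding strategy_def by blast+

lemma gains_0 [simp]: "gains Js T h 0 \<omega> = 0"
  by (simp add: gains_def)

text \<open>Only finitely many trades happen before t, which permits exchanging the series over
  trades with the sum over securities.\<close>

lemma suminf_gains:
  assumes "0 \<le> t" "mono (\<lambda>n. T n \<omega>)" "ennreal t \<le> T N \<omega>"
  shows "(\<Sum>n. \<Sum>j<Js. h n \<omega> j * (\<omega> j (stopped (T (Suc n)) \<omega> t) - \<omega> j (stopped (T n) \<omega> t)))
    = gains Js T h t \<omega>"
proof -
  have "(\<Sum>n. \<Sum>j<Js. h n \<omega> j * (\<omega> j (cut (T (Suc n) \<omega>) t) - \<omega> j (cut (T n \<omega>) t)))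
    = (\<Sum>n<N. \<Sum>j<Js. h n \<omega> j * (\<omega> j (cut (T (Suc n) \<omega>) t) - \<omega> j (cut (T n \<omega>) t)))"
  proof (rule suminf_finite)
    fix k assume "k \<notin> {..<N}"
    then have "T N \<omega> \<le> T k \<omega>" "T N \<omega> \<le> T (Suc k) \<omega>" using assms(2) by (auto simp: mono_def)
    then have "cut (T k \<omega>) t = t" "cut (T (Suc k) \<omega>) t = t"
      using assms by (auto intro!: cut_eq intro: order_trans)
    then show "(\<Sum>j<Js. h k \<omega> j * (\<omega> j (cut (T (Suc k) \<omega>) t) - \<omega> j (cut (T k \<omega>) t))) = 0" by simp
  qed simp
  then show ?thesis
    unfolding stopped_cut gains_def gsum_fin[OF assms] by (subst sum.swap)
qed

lemma simple_capitalI: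
  assumes s: "strategy J Js T h" and K: "\<And>t \<omega>. 0 \<le> t \<Longrightarrow> \<omega> \<in> Omega J \<Longrightarrow> K t \<omega> = c + gains Js T h t \<omega>"
  shows "K \<in> simple_capital J Js"
  unfolding simple_capital_def mem_Collect_eq
proof (intro exI[of _ c] exI[of _ T] exI[of _ h] conjI)
  have seq: "path_sequence J T" using s by (simp add: strategy_def)
  show "\<forall>n. stopping_time J (T n)"
    using s by (simp add: strategy_def path_sequence_def stopping_time_iff)
  show "\<forall>n. \<forall>\<omega>\<in>Omega J. T n \<omega> \<le> T (Suc n) \<omega>"
    using path_sequenceD(3)[OF seq] by (simp add: mono_def)
  show "\<forall>\<omega>\<in>Omega J. (\<lambda>n. T n \<omega>) \<longlonglongrightarrow> \<infinity>"
    using s path_sequenceD(3)[OF seq] tendsto_top_mono_ennreal unfolding strategy_def by blast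
  show "\<forall>n. \<exists>B. \<forall>\<omega>\<in>Omega J. \<forall>j<Js. \<bar>h n \<omega> j\<bar> \<le> B" "\<forall>n. tau_measurable J (T n) (h n)"
    using s by (auto simp: strategy_def)
  show "\<forall>t\<ge>0. \<forall>\<omega>\<in>Omega J. K t \<omega> = c + (\<Sum>n. \<Sum>j<Js. h n \<omega> j *
            (\<omega> j (stopped (T (Suc n)) \<omega> t) - \<omega> j (stopped (T n) \<omega> t)))"
  proof (intro allI ballI impI)
    fix t :: real and \<omega> assume *: "0 \<le> t" "\<omega> \<in> Omega J"
    then obtain N where "ennreal t < T N \<omega>" using strategyD(3)[OF s] by blast
    then have "ennreal t \<le> T N \<omega>" by simp
    then show "K t \<omega> = c + (\<Sum>n. \<Sum>j<Js. h n \<omega> j *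
            (\<omega> j (stopped (T (Suc n)) \<omega> t) - \<omega> j (stopped (T n) \<omega> t)))"
      using K[OF *] suminf_gains[where T = T and \<omega> = \<omega> and N = N and t = t and Js = Js and h = h]
        path_sequenceD(3)[OF seq *(2)] *(1) by simp
  qed
qed

lemma simple_capitalE:
  assumes "K \<in> simple_capital J Js"
  obtains c T h where "strategy J Js T h"
    "\<And>t \<omega>. 0 \<le> t \<Longrightarrow> \<omega> \<in> Omega J \<Longrightarrow> K t \<omega> = c + gains Js T h t \<omega>"
proof -
  obtain c \<tau> h where *: "\<forall>n. stopping_time J (\<tau> n)"
    "\<forall>n. \<forall>\<omega>\<in>Omega J. \<tau> n \<omega> \<le> \<tau> (Suc n) \<omega>"
    "\<forall>\<omega>\<in>Omega J. (\<lambda>n. \<tau> n \<omega>) \<longlonglongrightarrow> \<infinity>"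
    "\<forall>n. \<exists>B. \<forall>\<omega>\<in>Omega J. \<forall>j<Js. \<bar>h n \<omega> j\<bar> \<le> B"
    "\<forall>n. tau_measurable J (\<tau> n) (h n)"
    "\<forall>t\<ge>0. \<forall>\<omega>\<in>Omega J. K t \<omega> = c + (\<Sum>n. \<Sum>j<Js. h n \<omega> j *
            (\<omega> j (stopped (\<tau> (Suc n)) \<omega> t) - \<omega> j (stopped (\<tau> n) \<omega> t)))"
    using assms unfolding simple_capital_def mem_Collect_eq by (elim exE conjE) (rule that)
  have
    st: "\<And>n. stopping_time J (\<tau> n)" and le: "\<And>n \<omega>. \<omega> \<in> Omega J \<Longrightarrow> \<tau> n \<omega> \<le> \<tau> (Suc n) \<omega>"
    and lim: "\<And>\<omega>. \<omega> \<in> Omega J \<Longrightarrow> (\<lambda>n. \<tau> n \<omega>) \<longlonglongrightarrow> \<infinity>"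
    and bd: "\<And>n. \<exists>B. \<forall>\<omega>\<in>Omega J. \<forall>j<Js. \<bar>h n \<omega> j\<bar> \<le> B"
    and meas: "\<And>n. tau_measurable J (\<tau> n) (h n)"
    and K: "\<And>t \<omega>. 0 \<le> t \<Longrightarrow> \<omega> \<in> Omega J \<Longrightarrow> K t \<omega> = c + (\<Sum>n. \<Sum>j<Js. h n \<omega> j *
            (\<omega> j (stopped (\<tau> (Suc n)) \<omega> t) - \<omega> j (stopped (\<tau> n) \<omega> t)))"
    using * by blast+
  \<comment> \<open>An initial period without trading is put in front: time 0 becomes the first
    time, with position 0 up to \<open>\<tau> 0\<close>.\<close>
  define T where "T n = (case n of 0 \<Rightarrow> \<lambda>_. 0 | Suc n \<Rightarrow> \<tau> n)" for n
  define h' where "h' n = (case n of 0 \<Rightarrow> \<lambda>_ _. 0 | Suc n \<Rightarrow> h n)" for n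
  have [simp]: "T 0 = (\<lambda>_. 0)" "T (Suc n) = \<tau> n" "h' 0 = (\<lambda>_ _. 0)" "h' (Suc n) = h n" for n
    by (auto simp: T_def h'_def)
  have mT: "mono (\<lambda>n. T n \<omega>)" if "\<omega> \<in> Omega J" for \<omega>
    unfolding mono_iff_le_Suc
  proof
    fix n show "T n \<omega> \<le> T (Suc n) \<omega>" using le that by (cases n) auto
  qed
  have m\<tau>: "mono (\<lambda>n. \<tau> n \<omega>)" if "\<omega> \<in> Omega J" for \<omega>
    using le that by (auto simp: mono_iff_le_Suc)
  have ex: "\<exists>N. ennreal t < \<tau> N \<omega>" if "\<omega> \<in> Omega J" "0 \<le> t" for \<omega> t
    using lim that m\<tau> tendsto_top_mono_ennreal by blast
  show ?thesis
  proof (rule that)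
    show "strategy J Js T h'"
      unfolding strategy_def path_sequence_def
    proof (intro conjI allI ballI impI)
      fix n
      show "path_stopping J (T n)" "T n \<in> borel_measurable (FOmega J)"
        using st by (cases n; simp add: path_stopping_const stopping_time_iff)+
      show "\<exists>B. \<forall>\<omega>\<in>Omega J. \<forall>j<Js. \<bar>h' n \<omega> j\<bar> \<le> B"
        using bd by (cases n) auto
      show "tau_measurable J (T n) (h' n)"
        using meas by (cases n) (auto simp: tau_measurable_def)
    next
      fix \<omega> and t :: real assume "\<omega> \<in> Omega J" "0 \<le> t"
      with ex obtain N where "ennreal t < T (Suc N) \<omega>" by auto
      then show "\<exists>N. ennreal t < T N \<omega>" by blast
    qed (auto simp: mT)
    fix t :: real and \<omega> assume *: "0 \<le> t" "\<omega> \<in> Omega J"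
    then obtain N where N: "ennreal t \<le> \<tau> N \<omega>" using ex less_imp_le by blast
    then have N': "ennreal t \<le> T (Suc N) \<omega>" by simp
    have "gains Js \<tau> h t \<omega> = gains Js T h' t \<omega>"
      unfolding gains_def gsum_fin[OF *(1) m\<tau>[OF *(2)] N] gsum_fin[OF *(1) mT[OF *(2)] N']
        sum.lessThan_Suc_shift by simp
    then show "K t \<omega> = c + gains Js T h' t \<omega>"
      using K[OF *] suminf_gains[where T = \<tau> and \<omega> = \<omega> and N = N and t = t and Js = Js and h = h]
        m\<tau>[OF *(2)] N *(1) by simp
  qed
qed

text \<open>On the common refinement the position is the sum of what the two strategies hold at
  their own current indices. After n steps both indices are at most n, so only the first n + 1
  bounds of each strategy enter, and the sum is bounded.\<close>

lemma simple_capital_add: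
  assumes "K \<in> simple_capital J Js" "L \<in> simple_capital J Js"
  shows "(\<lambda>t \<omega>. K t \<omega> + L t \<omega>) \<in> simple_capital J Js"
proof -
  obtain c T h where T: "strategy J Js T h"
    and K: "\<And>t \<omega>. 0 \<le> t \<Longrightarrow> \<omega> \<in> Omega J \<Longrightarrow> K t \<omega> = c + gains Js T h t \<omega>"
    by (rule simple_capitalE[OF assms(1)]) (rule that)
  obtain d S g where S: "strategy J Js S g"
    and L: "\<And>t \<omega>. 0 \<le> t \<Longrightarrow> \<omega> \<in> Omega J \<Longrightarrow> L t \<omega> = d + gains Js S g t \<omega>"
    by (rule simple_capitalE[OF assms(2)]) (rule that)
  have seq: "path_sequence J T" "path_sequence J S" by (fact strategyD(1)[OF T] strategyD(1)[OF S])+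
  define R where "R k \<omega> = merged (\<lambda>k. T k \<omega>) (\<lambda>k. S k \<omega>) k" for k \<omega>
  define i where "i k \<omega> = fst (merge_idx (\<lambda>k. T k \<omega>) (\<lambda>k. S k \<omega>) k)" for k \<omega>
  define j where "j k \<omega> = snd (merge_idx (\<lambda>k. T k \<omega>) (\<lambda>k. S k \<omega>) k)" for k \<omega>
  define f where "f k \<omega> l = h (i k \<omega>) \<omega> l + g (j k \<omega>) \<omega> l" for k \<omega> l
  have TS: "mono (\<lambda>k. T k \<omega>)" "mono (\<lambda>k. S k \<omega>)" "T 0 \<omega> = 0" "S 0 \<omega> = 0"
    if "\<omega> \<in> Omega J" for \<omega> by (intro path_sequenceD[OF seq(1)] path_sequenceD[OF seq(2)] that)+
  have ij: "i k \<omega> \<le> k" "j k \<omega> \<le> k" for k \<omega>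
    using merge_idx_sum[of "\<lambda>k. T k \<omega>" "\<lambda>k. S k \<omega>" k] by (auto simp: i_def j_def)
  have ex: "\<exists>a b. ennreal t < T a \<omega> \<and> ennreal t < S b \<omega>" if "\<omega> \<in> Omega J" "0 \<le> t" for \<omega> t
    using strategyD(3)[OF T] strategyD(3)[OF S] that by blast
  have "strategy J Js R f"
    unfolding strategy_def
  proof (intro conjI allI ballI impI)
    show "path_sequence J R" unfolding R_def by (rule path_sequence_merged[OF seq])
    fix n
    show "R n \<in> borel_measurable (FOmega J)"
      unfolding R_def by (rule measurable_merged[OF strategyD(2)[OF T] strategyD(2)[OF S]])
    have "\<exists>B. \<forall>\<omega>\<in>Omega J. \<forall>l<Js. \<bar>h m \<omega> l\<bar> \<le> B" "\<exists>B. \<forall>\<omega>\<in>Omega J. \<forall>l<Js. \<bar>g m \<omega> l\<bar> \<le> B" for m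
      using strategyD(4)[OF T] strategyD(4)[OF S] by blast+
    then obtain B B' where B: "\<And>m. \<forall>\<omega>\<in>Omega J. \<forall>l<Js. \<bar>h m \<omega> l\<bar> \<le> B m"
      "\<And>m. \<forall>\<omega>\<in>Omega J. \<forall>l<Js. \<bar>g m \<omega> l\<bar> \<le> B' m" by metis
    show "\<exists>B. \<forall>\<omega>\<in>Omega J. \<forall>l<Js. \<bar>f n \<omega> l\<bar> \<le> B"
    proof (intro exI ballI allI impI)
      fix \<omega> l assume *: "\<omega> \<in> Omega J" "l < Js"
      have "\<bar>h m \<omega> l\<bar> \<le> (\<Sum>k\<le>n. \<bar>B k\<bar>)" "\<bar>g m \<omega> l\<bar> \<le> (\<Sum>k\<le>n. \<bar>B' k\<bar>)" if "m \<le> n" for m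
      proof -
        have "\<bar>h m \<omega> l\<bar> \<le> \<bar>B m\<bar>" "\<bar>g m \<omega> l\<bar> \<le> \<bar>B' m\<bar>"
          using B[of m] * by (smt (verit) abs_ge_self)+
        moreover have "\<bar>B m\<bar> \<le> (\<Sum>k\<le>n. \<bar>B k\<bar>)" "\<bar>B' m\<bar> \<le> (\<Sum>k\<le>n. \<bar>B' k\<bar>)"
          using that by (intro member_le_sum; simp)+
        ultimately show "\<bar>h m \<omega> l\<bar> \<le> (\<Sum>k\<le>n. \<bar>B k\<bar>)" "\<bar>g m \<omega> l\<bar> \<le> (\<Sum>k\<le>n. \<bar>B' k\<bar>)" by auto
      qed
      from this(1)[OF ij(1), of \<omega>] this(2)[OF ij(2), of \<omega>]
      show "\<bar>f n \<omega> l\<bar> \<le> (\<Sum>k\<le>n. \<bar>B k\<bar>) + (\<Sum>k\<le>n. \<bar>B' k\<bar>)"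
        unfolding f_def by linarith
    qed
    show "tau_measurable J (R n) (f n)"
      unfolding tau_measurable_def
    proof (intro ballI impI)
      fix \<omega> \<omega>' assume *: "\<omega> \<in> Omega J" "\<omega>' \<in> Omega J" "agree_upto J \<omega> \<omega>' (R n \<omega>)"
      have idx: "i n \<omega>' = i n \<omega>" "j n \<omega>' = j n \<omega>"
        using merge_idx_agree[OF seq *(1,2) *(3)[unfolded R_def]] by (simp_all only: i_def j_def)
      have "agree_upto J \<omega> \<omega>' (T (i n \<omega>) \<omega>)" "agree_upto J \<omega> \<omega>' (S (j n \<omega>) \<omega>)"
        unfolding i_def j_def
        by (rule agree_mono[OF *(3)[unfolded R_def] merged_le(1)[OF TS[OF *(1)]]]
            agree_mono[OF *(3)[unfolded R_def] merged_le(2)[OF TS[OF *(1)]]])+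
      then have "h (i n \<omega>) \<omega> = h (i n \<omega>) \<omega>'" "g (j n \<omega>) \<omega> = g (j n \<omega>) \<omega>'"
        using strategyD(5)[OF T] strategyD(5)[OF S] *(1,2) unfolding tau_measurable_def by blast+
      then show "f n \<omega> = f n \<omega>'" using idx by (auto simp: f_def)
    qed
  next
    fix \<omega> and t :: real assume *: "\<omega> \<in> Omega J" "0 \<le> t"
    then show "\<exists>N. ennreal t < R N \<omega>"
      using ex[OF *] merged_greater[OF TS[OF *(1)]] unfolding R_def by blast
  qed
  then show ?thesis
  proof (rule simple_capitalI[where c = "c + d"])
    fix t :: real and \<omega> assume *: "0 \<le> t" "\<omega> \<in> Omega J"
    obtain a b where ab: "ennreal t < T a \<omega>" "ennreal t < S b \<omega>" using ex[OF *(2,1)] by blast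
    have N: "ennreal t \<le> R (a + b) \<omega>"
      using merged_greater[OF TS[OF *(2)] ab] by (simp add: R_def less_imp_le)
    have m: "mono (\<lambda>k. R k \<omega>)"
      using mono_merged[OF TS[OF *(2)]] by (simp add: R_def[abs_def])
    have R': "merged (\<lambda>k. T k \<omega>) (\<lambda>k. S k \<omega>) = (\<lambda>k. R k \<omega>)" by (simp add: R_def)
    have "gains Js T h t \<omega> + gains Js S g t \<omega> = gains Js R f t \<omega>"
      unfolding gains_def sum.distrib[symmetric]
    proof (rule sum.cong[OF refl])
      fix l
      show "gsum (\<lambda>n. h n \<omega> l) (\<omega> l) (\<lambda>n. T n \<omega>) t + gsum (\<lambda>n. g n \<omega> l) (\<omega> l) (\<lambda>n. S n \<omega>) t
        = gsum (\<lambda>n. f n \<omega> l) (\<omega> l) (\<lambda>n. R n \<omega>) t"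
        unfolding gsum_merged(1)[OF TS[OF *(2)] *(1) ab] gsum_merged(2)[OF TS[OF *(2)] *(1) ab] R'
          gsum_fin[OF *(1) m N]
        by (simp add: f_def i_def j_def algebra_simps flip: sum.distrib)
    qed
    then show "K t \<omega> + L t \<omega> = c + d + gains Js R f t \<omega>"
      using K L * by simp
  qed
qed

lemma gains_scale:
  assumes "0 \<le> t" "mono (\<lambda>n. T n \<omega>)" "ennreal t \<le> T N \<omega>"
  shows "gains Js T (\<lambda>n \<omega> j. a * h n \<omega> j) t \<omega> = a * gains Js T h t \<omega>"
  unfolding gains_def gsum_fin[OF assms] by (simp add: sum_distrib_left mult.assoc)

lemma simple_capital_scale:
  assumes "K \<in> simple_capital J Js"
  shows "(\<lambda>t \<omega>. a * K t \<omega>) \<in> simple_capital J Js"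
proof -
  obtain c T h where T: "strategy J Js T h"
    and K: "\<And>t \<omega>. 0 \<le> t \<Longrightarrow> \<omega> \<in> Omega J \<Longrightarrow> K t \<omega> = c + gains Js T h t \<omega>"
    by (rule simple_capitalE[OF assms(1)]) (rule that)
  have "\<exists>B. \<forall>\<omega>\<in>Omega J. \<forall>j<Js. \<bar>a * h n \<omega> j\<bar> \<le> B" for n
  proof -
    obtain B where "\<forall>\<omega>\<in>Omega J. \<forall>j<Js. \<bar>h n \<omega> j\<bar> \<le> B" using strategyD(4)[OF T] by blast
    then show ?thesis
      by (intro exI[of _ "\<bar>a\<bar> * B"]) (simp add: abs_mult mult_left_mono)
  qed
  then have "strategy J Js T (\<lambda>n \<omega> j. a * h n \<omega> j)"
    using T unfolding strategy_def tau_measurable_def by auto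
  then show ?thesis
  proof (rule simple_capitalI[where c = "a * c"])
    fix t :: real and \<omega> assume *: "0 \<le> t" "\<omega> \<in> Omega J"
    obtain N where "ennreal t \<le> T N \<omega>" using strategyD(3)[OF T *(2,1)] less_imp_le by blast
    moreover have "mono (\<lambda>n. T n \<omega>)" using T *(2) by (auto simp: strategy_def path_sequence_def)
    ultimately show "a * K t \<omega> = a * c + gains Js T (\<lambda>n \<omega> j. a * h n \<omega> j) t \<omega>"
      using * by (simp add: K gains_scale algebra_simps)
  qed
qed

lemma simple_capital_const: "(\<lambda>t \<omega>. c) \<in> simple_capital J Js"
proof (rule simple_capitalI[where T = "\<lambda>n _. of_nat n" and h = "\<lambda>_ _ _. 0" and c = c])
  show "strategy J Js (\<lambda>n _. of_nat n) (\<lambda>_ _ _. 0)"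
    unfolding strategy_def path_sequence_def
    by (auto simp: path_stopping_const mono_def tau_measurable_def)
       (metis ennreal_of_nat_eq_real_of_nat ennreal_less_iff reals_Archimedean2)
qed (simp add: gains_def gsum_def)

section \<open>Algebra of nonnegative supermartingales and of quasi-always statements\<close>

lemma nn_supermartingale_const: "0 \<le> c \<Longrightarrow> (\<lambda>t \<omega>. ennreal c) \<in> nn_supermartingale J Js"
  using nn_supermartingale.simple[OF simple_capital_const[of c J Js]] by simp

text \<open>Gains vanish at time 0 and limits inferior preserve constants, so the starting value is
  a single number, by which one can normalise.\<close>

lemma nn_supermartingale_init:
  "X \<in> nn_supermartingale J Js \<Longrightarrow> \<exists>c. \<forall>\<omega>\<in>Omega J. X 0 \<omega> = c"
proof (induction rule: nn_supermartingale.induct)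
  case (simple K)
  from simple_capitalE[OF simple(1)] obtain c where "\<And>\<omega>. \<omega> \<in> Omega J \<Longrightarrow> K 0 \<omega> = c"
    by (metis add.right_neutral gains_0 order_refl)
  then show ?case by auto
next
  case (liminf X)
  then obtain c where "\<And>k \<omega>. \<omega> \<in> Omega J \<Longrightarrow> X k 0 \<omega> = c k" by metis
  then show ?case by (intro exI[of _ "liminf c"]) simp
qed

text \<open>The limit inferior is only superadditive, so limits are taken in one summand at a time:
  the inductions are nested, and the other summand is constant in k. Equality is claimed for t \<ge>
  0 on \<open>Omega J\<close>, where the real processes are nonnegative and \<open>ennreal\<close>
  is additive.\<close>

lemma nn_supermartingale_add:
  assumes X: "X \<in> nn_supermartingale J Js" and Y: "Y \<in> nn_supermartingale J Js"
  shows "\<exists>Z\<in>nn_supermartingale J Js. \<forall>t\<ge>0. \<forall>\<omega>\<in>Omega J. Z t \<omega> = X t \<omega> + Y t \<omega>"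
  using X
proof (induction rule: nn_supermartingale.induct)
  case (simple K)
  from Y show ?case
  proof (induction rule: nn_supermartingale.induct)
    case L: (simple L)
    have "(\<lambda>t \<omega>. ennreal (K t \<omega> + L t \<omega>)) \<in> nn_supermartingale J Js"
      using simple L by (intro nn_supermartingale.simple simple_capital_add) auto
    moreover have "\<forall>t\<ge>0. \<forall>\<omega>\<in>Omega J. ennreal (K t \<omega> + L t \<omega>) = ennreal (K t \<omega>) + ennreal (L t \<omega>)"
      using simple L by (simp add: ennreal_plus)
    ultimately show ?case by (intro bexI[where x = "\<lambda>t \<omega>. ennreal (K t \<omega> + L t \<omega>)"])
  next
    case (liminf X)
    then obtain Z where Z: "\<And>k. Z k \<in> nn_supermartingale J Js"
      "\<And>k t \<omega>. 0 \<le> t \<Longrightarrow> \<omega> \<in> Omega J \<Longrightarrow> Z k t \<omega> = ennreal (K t \<omega>) + X k t \<omega>" by metis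
    show ?case
      by (rule bexI[OF _ nn_supermartingale.liminf[of Z, OF Z(1)]])
         (simp add: Z(2) add.commute[of "ennreal _"] Liminf_add_const)
  qed
next
  case (liminf X)
  then obtain Z where Z: "\<And>k. Z k \<in> nn_supermartingale J Js"
    "\<And>k t \<omega>. 0 \<le> t \<Longrightarrow> \<omega> \<in> Omega J \<Longrightarrow> Z k t \<omega> = X k t \<omega> + Y t \<omega>" by metis
  show ?case
    by (rule bexI[OF _ nn_supermartingale.liminf[of Z, OF Z(1)]])
       (simp add: Z(2) Liminf_add_const)
qed

lemma nn_supermartingale_scale:
  assumes X: "X \<in> nn_supermartingale J Js" and "0 \<le> a"
  shows "\<exists>Z\<in>nn_supermartingale J Js. \<forall>t\<ge>0. \<forall>\<omega>\<in>Omega J. Z t \<omega> = ennreal a * X t \<omega>"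
  using X
proof (induction rule: nn_supermartingale.induct)
  case (simple K)
  have "(\<lambda>t \<omega>. ennreal (a * K t \<omega>)) \<in> nn_supermartingale J Js"
    using simple assms(2) by (intro nn_supermartingale.simple simple_capital_scale) auto
  moreover have "\<forall>t\<ge>0. \<forall>\<omega>\<in>Omega J. ennreal (a * K t \<omega>) = ennreal a * ennreal (K t \<omega>)"
    using simple assms(2) by (simp add: ennreal_mult)
  ultimately show ?case by (intro bexI[where x = "\<lambda>t \<omega>. ennreal (a * K t \<omega>)"])
next
  case (liminf X)
  then obtain Z where Z: "\<And>k. Z k \<in> nn_supermartingale J Js"
    "\<And>k t \<omega>. 0 \<le> t \<Longrightarrow> \<omega> \<in> Omega J \<Longrightarrow> Z k t \<omega> = ennreal a * X k t \<omega>" by metis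
  have "liminf (\<lambda>k. ennreal a * x k) = ennreal a * liminf x" for x :: "nat \<Rightarrow> ennreal"
    by (intro Liminf_compose_continuous_mono ennreal_continuous_on_cmult continuous_on_id monoI
        mult_left_mono) auto
  then show ?case
    by (intro bexI[OF _ nn_supermartingale.liminf[of Z, OF Z(1)]]) (simp add: Z(2))
qed

text \<open>Partial sums of nonnegative terms increase, so their limit inferior is the
  series.\<close>

lemma nn_supermartingale_suminf:
  assumes X: "\<And>n. X n \<in> nn_supermartingale J Js"
  shows "\<exists>Z\<in>nn_supermartingale J Js. \<forall>t\<ge>0. \<forall>\<omega>\<in>Omega J. Z t \<omega> = (\<Sum>n. X n t \<omega>)"
proof -
  have "\<exists>Z\<in>nn_supermartingale J Js. \<forall>t\<ge>0. \<forall>\<omega>\<in>Omega J. Z t \<omega> = (\<Sum>n<N. X n t \<omega>)" for N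
  proof (induction N)
    case 0
    show ?case by (rule bexI[OF _ nn_supermartingale_const[of 0]]) auto
  next
    case (Suc N)
    then obtain Z where "Z \<in> nn_supermartingale J Js" "\<forall>t\<ge>0. \<forall>\<omega>\<in>Omega J. Z t \<omega> = (\<Sum>n<N. X n t \<omega>)"
      by blast
    then show ?case using nn_supermartingale_add[OF _ X[of N], of Z] by simp
  qed
  then obtain Z where Z: "\<And>N. Z N \<in> nn_supermartingale J Js"
    "\<And>N t \<omega>. 0 \<le> t \<Longrightarrow> \<omega> \<in> Omega J \<Longrightarrow> Z N t \<omega> = (\<Sum>n<N. X n t \<omega>)" by metis
  have "liminf (\<lambda>N. \<Sum>n<N. x n) = (\<Sum>n. x n)" for x :: "nat \<Rightarrow> ennreal"
    by (rule lim_imp_Liminf) (auto intro: summable_LIMSEQ)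
  then show ?thesis
    by (intro bexI[OF _ nn_supermartingale.liminf[of Z, OF Z(1)]]) (simp add: Z(2))
qed

text \<open>If W starts at a finite r, then (W + 1) / (r + 1) starts at 1 and is infinite where W
  is; the added 1 covers the case r = 0.\<close>

lemma quasi_alwaysI:
  assumes W: "W \<in> nn_supermartingale J Js" and fin: "\<And>\<omega>. \<omega> \<in> Omega J \<Longrightarrow> W 0 \<omega> < \<infinity>"
    and inf: "\<And>t \<omega>. 0 \<le> t \<Longrightarrow> \<omega> \<in> Omega J \<Longrightarrow> \<not> E t \<omega> \<Longrightarrow> W t \<omega> = \<infinity>"
  shows "quasi_always J Js E"
proof -
  obtain c where c: "\<And>\<omega>. \<omega> \<in> Omega J \<Longrightarrow> W 0 \<omega> = c" using nn_supermartingale_init[OF W] by blast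
  have "Omega J \<noteq> {}" by (auto simp: Omega_def intro!: exI[of _ "\<lambda>_ _. 0"])
  then have "c < \<infinity>" using c fin by auto
  then obtain r where r: "c = ennreal r" "0 \<le> r" by (cases c) auto
  obtain Z where Z: "Z \<in> nn_supermartingale J Js"
    "\<And>t \<omega>. 0 \<le> t \<Longrightarrow> \<omega> \<in> Omega J \<Longrightarrow> Z t \<omega> = W t \<omega> + ennreal 1"
    using nn_supermartingale_add[OF W nn_supermartingale_const[of 1]] by auto
  obtain Y where Y: "Y \<in> nn_supermartingale J Js"
    "\<And>t \<omega>. 0 \<le> t \<Longrightarrow> \<omega> \<in> Omega J \<Longrightarrow> Y t \<omega> = ennreal (1 / (r + 1)) * Z t \<omega>"
    using nn_supermartingale_scale[OF Z(1), of "1 / (r + 1)"] r by auto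
  show ?thesis
    unfolding quasi_always_def
  proof (intro bexI[OF _ Y(1)] conjI ballI allI impI)
    fix \<omega> assume "\<omega> \<in> Omega J"
    then have "Y 0 \<omega> = ennreal (1 / (r + 1)) * ennreal (r + 1)"
      using Y(2)[of 0 \<omega>] Z(2)[of 0 \<omega>] c r by (simp add: ennreal_plus)
    also have "\<dots> = 1" using r by (subst ennreal_mult[symmetric]) auto
    finally show "Y 0 \<omega> = 1" .
  next
    fix t :: real and \<omega> assume "0 \<le> t" "\<omega> \<in> Omega J" "\<not> E t \<omega>"
    then show "Y t \<omega> = \<infinity>" using Y(2) Z(2) inf r by (simp add: ennreal_mult_top)
  qed
qed

lemma quasi_always_mono:
  assumes "quasi_always J Js E" "\<And>t \<omega>. 0 \<le> t \<Longrightarrow> \<omega> \<in> Omega J \<Longrightarrow> E t \<omega> \<Longrightarrow> E' t \<omega>"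
  shows "quasi_always J Js E'"
  using assms unfolding quasi_always_def by metis

text \<open>The witness starts at the finite value 1, so there are no exceptions at time 0. In
  particular, convergence quasi-always gives convergence of the initial values along every
  path.\<close>

lemma quasi_always_0:
  assumes "quasi_always J Js E" "\<omega> \<in> Omega J"
  shows "E 0 \<omega>"
  using assms unfolding quasi_always_def by fastforce

text \<open>The witnesses are averaged with weights 2^(-(n+1)), which sum to 1; a single infinite
  term makes the average infinite.\<close>

lemma quasi_always_all:
  assumes "\<And>n::nat. quasi_always J Js (E n)"
  shows "quasi_always J Js (\<lambda>t \<omega>. \<forall>n. E n t \<omega>)"
proof -
  obtain X where X: "\<And>n. X n \<in> nn_supermartingale J Js"
    "\<And>n \<omega>. \<omega> \<in> Omega J \<Longrightarrow> X n 0 \<omega> = 1"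
    "\<And>n t \<omega>. 0 \<le> t \<Longrightarrow> \<omega> \<in> Omega J \<Longrightarrow> \<not> E n t \<omega> \<Longrightarrow> X n t \<omega> = \<infinity>"
    using assms unfolding quasi_always_def by metis
  have "\<exists>Z\<in>nn_supermartingale J Js. \<forall>t\<ge>0. \<forall>\<omega>\<in>Omega J. Z t \<omega> = ennreal ((1/2)^Suc n) * X n t \<omega>" for n
    using nn_supermartingale_scale[OF X(1)] by simp
  then obtain Y where Y: "\<And>n. Y n \<in> nn_supermartingale J Js"
    "\<And>n t \<omega>. 0 \<le> t \<Longrightarrow> \<omega> \<in> Omega J \<Longrightarrow> Y n t \<omega> = ennreal ((1/2)^Suc n) * X n t \<omega>" by metis
  obtain Z where Z: "Z \<in> nn_supermartingale J Js"
    "\<And>t \<omega>. 0 \<le> t \<Longrightarrow> \<omega> \<in> Omega J \<Longrightarrow> Z t \<omega> = (\<Sum>n. Y n t \<omega>)"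
    using nn_supermartingale_suminf[of Y, OF Y(1)] by blast
  show ?thesis
  proof (rule quasi_alwaysI[OF Z(1)])
    fix \<omega> assume \<omega>: "\<omega> \<in> Omega J"
    have "Z 0 \<omega> = (\<Sum>n. ennreal ((1/2)^Suc n))"
      using \<omega> by (simp add: Z(2) Y(2) X(2) del: power_Suc)
    also have "\<dots> = ennreal 1"
      by (rule suminf_ennreal_eq) (use power_half_series in auto)
    finally show "Z 0 \<omega> < \<infinity>" by simp
  next
    fix t :: real and \<omega> assume *: "0 \<le> t" "\<omega> \<in> Omega J" and "\<not> (\<forall>n. E n t \<omega>)"
    then obtain n where "\<not> E n t \<omega>" by blast
    then have "Y n t \<omega> = \<infinity>" using * Y(2) X(3) by (simp add: ennreal_mult_top)
    moreover have "Y n t \<omega> \<le> Z t \<omega>"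
      using sum_le_suminf[of "\<lambda>n. Y n t \<omega>" "{n}"] * by (simp add: Z(2))
    ultimately show "Z t \<omega> = \<infinity>" by (simp add: top_unique)
  qed
qed

lemma quasi_always_conj:
  assumes "quasi_always J Js E" "quasi_always J Js E'"
  shows "quasi_always J Js (\<lambda>t \<omega>. E t \<omega> \<and> E' t \<omega>)"
proof -
  have "quasi_always J Js (\<lambda>t \<omega>. \<forall>n::nat. (if n = 0 then E else E') t \<omega>)"
    using assms by (intro quasi_always_all) auto
  then show ?thesis by (rule quasi_always_mono) (metis one_neq_zero)
qed

lemma quasi_always_True: "quasi_always J Js (\<lambda>_ _. True)"
  by (rule quasi_alwaysI[OF nn_supermartingale_const[of 0]]) auto

text \<open>The series of all \<open>W n\<close> has a finite start by summability, and it is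
  infinite wherever infinitely many terms are at least 1.\<close>

lemma Borel_Cantelli:
  assumes W: "\<And>n. W n \<in> nn_supermartingale J Js"
    and init: "\<And>n \<omega>. \<omega> \<in> Omega J \<Longrightarrow> W n 0 \<omega> \<le> ennreal (c n)"
    and c: "\<And>n. 0 \<le> c n" "summable c"
  shows "quasi_always J Js (\<lambda>t \<omega>. \<forall>\<^sub>F n in sequentially. W n t \<omega> < 1)"
proof -
  obtain Z where Z: "Z \<in> nn_supermartingale J Js"
    "\<And>t \<omega>. 0 \<le> t \<Longrightarrow> \<omega> \<in> Omega J \<Longrightarrow> Z t \<omega> = (\<Sum>n. W n t \<omega>)"
    using nn_supermartingale_suminf[of W, OF W] by blast
  show ?thesis
  proof (rule quasi_alwaysI[OF Z(1)])
    fix \<omega> assume \<omega>: "\<omega> \<in> Omega J"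
    have "Z 0 \<omega> \<le> (\<Sum>n. ennreal (c n))"
      using \<omega> init by (auto simp: Z(2) intro!: suminf_le)
    also have "\<dots> < \<infinity>" using c by (simp add: suminf_ennreal2)
    finally show "Z 0 \<omega> < \<infinity>" .
  next
    fix t :: real and \<omega> assume *: "0 \<le> t" "\<omega> \<in> Omega J" "\<not> (\<forall>\<^sub>F n in sequentially. W n t \<omega> < 1)"
    define A where "A = {n. 1 \<le> W n t \<omega>}"
    have "infinite A"
      using *(3) unfolding A_def infinite_nat_iff_unbounded_le eventually_sequentially
      by (auto simp: not_less)
    have "of_nat m \<le> Z t \<omega>" for m :: nat
    proof -
      obtain F where F: "F \<subseteq> A" "finite F" "card F = m"
        using infinite_arbitrarily_large[OF \<open>infinite A\<close>] by blast
      have "of_nat m = (\<Sum>n\<in>F. 1::ennreal)" using F by simp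
      also have "\<dots> \<le> (\<Sum>n\<in>F. W n t \<omega>)" using F by (intro sum_mono) (auto simp: A_def)
      also have "\<dots> \<le> (\<Sum>n. W n t \<omega>)" using F by (intro sum_le_suminf) auto
      finally show ?thesis using Z(2) * by simp
    qed
    then show "Z t \<omega> = \<infinity>"
      by (metis ennreal_Ex_less_of_nat infinity_ennreal_def not_le less_top)
  qed
qed

subsection \<open>Grids of exit times\<close>

lemma Omega_continuous: "\<omega> \<in> Omega J \<Longrightarrow> j < J \<Longrightarrow> continuous_on {0..} (\<omega> j)"
  by (simp add: Omega_def)

lemma space_FOmega [simp]: "space (FOmega J) = Omega J"
  by (simp add: FOmega_def space_measure_of_conv)

lemma measurable_coordinate:
  assumes "j < J"
  shows "(\<lambda>\<omega>. \<omega> j t) \<in> borel_measurable (FOmega J)"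
proof (cases "0 \<le> t")
  case True
  show ?thesis
  proof (rule measurableI)
    fix B :: "real set" assume "B \<in> sets borel"
    then have "{\<omega> \<in> Omega J. \<omega> j t \<in> B} \<in> sets (FOmega J)"
      unfolding FOmega_def using assms True by (subst sets_measure_of) auto
    moreover have "(\<lambda>\<omega>. \<omega> j t) -` B \<inter> space (FOmega J) = {\<omega> \<in> Omega J. \<omega> j t \<in> B}" by auto
    ultimately show "(\<lambda>\<omega>. \<omega> j t) -` B \<inter> space (FOmega J) \<in> sets (FOmega J)" by simp
  qed simp
next
  case False
  then have "(\<lambda>\<omega>. \<omega> j t) \<in> borel_measurable (FOmega J) \<longleftrightarrow>
    (\<lambda>\<omega>. 0 :: real) \<in> borel_measurable (FOmega J)"
    by (intro measurable_cong) (auto simp: Omega_def)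
  then show ?thesis by simp
qed

text \<open>The random time is rounded down to multiples of 1/(m + 1), where only countably many
  coordinates occur, and path continuity gives the limit. Nonnegativity of the time keeps the
  rounded times in the half-line on which paths are continuous.\<close>

lemma measurable_coordinate_random_time:
  assumes j: "j < J" and \<rho> [measurable]: "\<rho> \<in> borel_measurable (FOmega J)"
    and nn: "\<And>\<omega>. \<omega> \<in> Omega J \<Longrightarrow> 0 \<le> \<rho> \<omega>"
  shows "(\<lambda>\<omega>. \<omega> j (\<rho> \<omega>)) \<in> borel_measurable (FOmega J)"
proof (rule borel_measurable_LIMSEQ_real)
  fix m :: nat
  show "(\<lambda>\<omega>. \<omega> j (of_int \<lfloor>real (Suc m) * \<rho> \<omega>\<rfloor> / real (Suc m))) \<in> borel_measurable (FOmega J)"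
    by (rule measurable_compose_countable[where f = "\<lambda>i \<omega>. \<omega> j (of_int i / real (Suc m))"])
       (auto intro: measurable_coordinate[OF j])
next
  fix \<omega> assume "\<omega> \<in> space (FOmega J)"
  then have \<omega>: "\<omega> \<in> Omega J" by simp
  let ?u = "\<lambda>m. of_int \<lfloor>real (Suc m) * \<rho> \<omega>\<rfloor> / real (Suc m)"
  have "?u m \<le> \<rho> \<omega>" "\<rho> \<omega> - 1 / real (Suc m) \<le> ?u m" for m
    by (auto simp: divide_simps mult.commute)
  moreover have "(\<lambda>m. \<rho> \<omega> - 1 / real (Suc m)) \<longlonglongrightarrow> \<rho> \<omega> - 0"
    by (intro tendsto_diff tendsto_const LIMSEQ_Suc[OF lim_1_over_n])
  ultimately have "?u \<longlonglongrightarrow> \<rho> \<omega>"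
    by (intro tendsto_sandwich[of "\<lambda>m. \<rho> \<omega> - 1 / real (Suc m)" ?u sequentially "\<lambda>_. \<rho> \<omega>"] always_eventually)
       (simp_all only: diff_zero tendsto_const simp_thms)
  moreover have "0 \<le> ?u m" for m using nn[OF \<omega>] by simp
  ultimately show "(\<lambda>m. \<omega> j (?u m)) \<longlonglongrightarrow> \<omega> j (\<rho> \<omega>)"
    using nn[OF \<omega>]
    by (intro continuous_on_tendsto_compose[OF Omega_continuous[OF \<omega> j]]) auto
qed

text \<open>With a non-strict inequality the set is closed along a continuous path, so its infimum
  is attained and the exit is visible from the path up to and including the exit time.\<close>

definition exit_set :: "nat \<Rightarrow> real \<Rightarrow> real \<Rightarrow> path \<Rightarrow> real set" where
  "exit_set J \<delta> s \<omega> = {t. s \<le> t \<and> (\<exists>j<J. \<delta> \<le> \<bar>\<omega> j t - \<omega> j s\<bar>)}"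

definition exit_time :: "nat \<Rightarrow> real \<Rightarrow> real \<Rightarrow> path \<Rightarrow> ennreal" where
  "exit_time J \<delta> s \<omega> = (if exit_set J \<delta> s \<omega> = {} then \<infinity> else ennreal (Inf (exit_set J \<delta> s \<omega>)))"

primrec grid :: "nat \<Rightarrow> real \<Rightarrow> nat \<Rightarrow> path \<Rightarrow> ennreal" where
  "grid J \<delta> 0 \<omega> = 0"
| "grid J \<delta> (Suc k) \<omega> =
    (if grid J \<delta> k \<omega> = \<infinity> then \<infinity> else exit_time J \<delta> (enn2real (grid J \<delta> k \<omega>)) \<omega>)"

lemma closed_exit_set:
  assumes "\<omega> \<in> Omega J" "0 \<le> s"
  shows "closed (exit_set J \<delta> s \<omega>)"
proof -
  have "exit_set J \<delta> s \<omega> = (\<Union>j<J. {t\<in>{s..}. \<delta> \<le> \<bar>\<omega> j t - \<omega> j s\<bar>})"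
    by (auto simp: exit_set_def)
  moreover have "closed {t\<in>{s..}. \<delta> \<le> \<bar>\<omega> j t - \<omega> j s\<bar>}" if "j < J" for j
    using continuous_on_subset[OF Omega_continuous[OF assms(1) that], of "{s..}"] assms(2)
    by (intro continuous_on_closed_Collect_le continuous_intros) auto
  ultimately show ?thesis by auto
qed

lemma Inf_exit_set:
  assumes "\<omega> \<in> Omega J" "0 \<le> s" "exit_set J \<delta> s \<omega> \<noteq> {}"
  shows "Inf (exit_set J \<delta> s \<omega>) \<in> exit_set J \<delta> s \<omega>"
  using assms by (intro closed_contains_Inf closed_exit_set) (auto simp: exit_set_def intro: bdd_belowI)

lemma exit_time_le:
  assumes "0 \<le> s" "u \<in> exit_set J \<delta> s \<omega>"
  shows "exit_time J \<delta> s \<omega> \<le> ennreal u"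
proof -
  have "Inf (exit_set J \<delta> s \<omega>) \<le> u"
    by (intro cInf_lower assms(2) bdd_belowI[of _ s]) (auto simp: exit_set_def)
  then show ?thesis using assms by (auto simp: exit_time_def intro: ennreal_leI)
qed

lemma exit_time_le_iff:
  assumes "\<omega> \<in> Omega J" "0 \<le> s" "0 \<le> t"
  shows "exit_time J \<delta> s \<omega> \<le> ennreal t \<longleftrightarrow> (\<exists>u\<in>exit_set J \<delta> s \<omega>. u \<le> t)"
proof
  assume *: "exit_time J \<delta> s \<omega> \<le> ennreal t"
  then have ne: "exit_set J \<delta> s \<omega> \<noteq> {}" by (auto simp: exit_time_def top_unique)
  then have "Inf (exit_set J \<delta> s \<omega>) \<le> t" using * assms by (simp add: exit_time_def)
  with Inf_exit_set[OF assms(1,2) ne] show "\<exists>u\<in>exit_set J \<delta> s \<omega>. u \<le> t" by blast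
next
  assume "\<exists>u\<in>exit_set J \<delta> s \<omega>. u \<le> t"
  then obtain u where "u \<in> exit_set J \<delta> s \<omega>" "u \<le> t" by blast
  then show "exit_time J \<delta> s \<omega> \<le> ennreal t"
    using exit_time_le[OF assms(2)] ennreal_leI order_trans by blast
qed

lemma exit_time_ge: "\<omega> \<in> Omega J \<Longrightarrow> 0 \<le> s \<Longrightarrow> ennreal s \<le> exit_time J \<delta> s \<omega>"
  using Inf_exit_set[of \<omega> J s \<delta>] by (auto simp: exit_time_def exit_set_def intro!: ennreal_leI)

text \<open>By the intermediate value theorem a deviation beyond \<delta> at t is preceded by one
  equal to \<delta>. That one is an exit, hence not before t, so the two times coincide although the
  deviations differ.\<close>

lemma exit_time_osc:
  assumes \<omega>: "\<omega> \<in> Omega J" and s: "0 \<le> s" "s \<le> t" and t: "ennreal t \<le> exit_time J \<delta> s \<omega>"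
    and j: "j < J" and \<delta>: "0 \<le> \<delta>"
  shows "\<bar>\<omega> j t - \<omega> j s\<bar> \<le> \<delta>"
proof (rule ccontr)
  assume *: "\<not> ?thesis"
  have "continuous_on {s..t} (\<lambda>u. \<bar>\<omega> j u - \<omega> j s\<bar>)"
    using continuous_on_subset[OF Omega_continuous[OF \<omega> j], of "{s..t}"] s
    by (intro continuous_intros) auto
  then obtain u where u: "s \<le> u" "u \<le> t" "\<bar>\<omega> j u - \<omega> j s\<bar> = \<delta>"
    using IVT'[of "\<lambda>u. \<bar>\<omega> j u - \<omega> j s\<bar>" s \<delta> t] * \<delta> s by auto
  then have "u \<in> exit_set J \<delta> s \<omega>" using j by (auto simp: exit_set_def)
  then have "ennreal t \<le> ennreal u" using exit_time_le[OF s(1)] t order_trans by blast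
  then have "t \<le> u" using u s by (simp add: ennreal_le_iff)
  then have "t = u" using u by simp
  then show False using * u by simp
qed

text \<open>Up to the exit time of \<omega> the two paths have the same exit set, and infima are
  attained. So the exit of \<omega> is an exit of \<omega>', and an earlier exit of \<omega>' would
  be one of \<omega>.\<close>

lemma exit_time_agree:
  assumes \<omega>: "\<omega> \<in> Omega J" "\<omega>' \<in> Omega J" and s: "0 \<le> s"
    and a: "agree_upto J \<omega> \<omega>' (exit_time J \<delta> s \<omega>)"
  shows "exit_time J \<delta> s \<omega>' = exit_time J \<delta> s \<omega>"
proof -
  have ge: "ennreal s \<le> exit_time J \<delta> s \<omega>" by (rule exit_time_ge[OF \<omega>(1) s])
  have iff: "u \<in> exit_set J \<delta> s \<omega> \<longleftrightarrow> u \<in> exit_set J \<delta> s \<omega>'"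
    if "ennreal u \<le> exit_time J \<delta> s \<omega>" for u
  proof -
    have "\<omega> j s = \<omega>' j s" "s \<le> u \<Longrightarrow> \<omega> j u = \<omega>' j u" if "j < J" for j
      using a ge \<open>ennreal u \<le> _\<close> that s by (auto simp: agree_upto_def)
    then show ?thesis by (auto simp: exit_set_def)
  qed
  have le: "exit_time J \<delta> s \<omega>' \<le> exit_time J \<delta> s \<omega>"
  proof (cases "exit_set J \<delta> s \<omega> = {}")
    case False
    have eq: "exit_time J \<delta> s \<omega> = ennreal (Inf (exit_set J \<delta> s \<omega>))"
      using False by (simp add: exit_time_def)
    then have "Inf (exit_set J \<delta> s \<omega>) \<in> exit_set J \<delta> s \<omega>'"
      using iff Inf_exit_set[OF \<omega>(1) s False] by simp
    then show ?thesis using exit_time_le[OF s] eq by simp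
  qed (simp add: exit_time_def)
  show ?thesis
  proof (cases "exit_set J \<delta> s \<omega>' = {}")
    case True
    then show ?thesis using le by (simp add: exit_time_def top_unique)
  next
    case False
    have eq: "exit_time J \<delta> s \<omega>' = ennreal (Inf (exit_set J \<delta> s \<omega>'))"
      using False by (simp add: exit_time_def)
    then have "Inf (exit_set J \<delta> s \<omega>') \<in> exit_set J \<delta> s \<omega>"
      using iff Inf_exit_set[OF \<omega>(2) s False] le by simp
    then have "exit_time J \<delta> s \<omega> \<le> exit_time J \<delta> s \<omega>'" using exit_time_le[OF s] eq by simp
    then show ?thesis using le by simp
  qed
qed

lemma grid_Suc_ge: "\<omega> \<in> Omega J \<Longrightarrow> grid J \<delta> k \<omega> \<le> grid J \<delta> (Suc k) \<omega>"
  by (cases "grid J \<delta> k \<omega>") (auto simp: exit_time_ge)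

lemma mono_grid: "\<omega> \<in> Omega J \<Longrightarrow> mono (\<lambda>k. grid J \<delta> k \<omega>)"
  unfolding mono_iff_le_Suc using grid_Suc_ge by blast

lemma path_stopping_grid: "path_stopping J (grid J \<delta> k)"
proof (induction k)
  case (Suc k)
  show ?case
    unfolding path_stopping_def
  proof (intro ballI impI)
    fix \<omega> \<omega>' assume *: "\<omega> \<in> Omega J" "\<omega>' \<in> Omega J" "agree_upto J \<omega> \<omega>' (grid J \<delta> (Suc k) \<omega>)"
    have eq: "grid J \<delta> k \<omega>' = grid J \<delta> k \<omega>"
      by (rule path_stoppingD[OF Suc * grid_Suc_ge[OF *(1)]])
    show "grid J \<delta> (Suc k) \<omega> = grid J \<delta> (Suc k) \<omega>'"
    proof (cases "grid J \<delta> k \<omega> = \<infinity>")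
      case False
      then show ?thesis
        using exit_time_agree[OF *(1,2), of "enn2real (grid J \<delta> k \<omega>)" \<delta>] *(3) eq by simp
    qed (simp add: eq)
  qed
qed (simp add: path_stopping_def)

lemma path_sequence_grid: "path_sequence J (grid J \<delta>)"
  by (simp add: path_sequence_def path_stopping_grid mono_grid)

lemma grid_osc:
  assumes "\<omega> \<in> Omega J" "j < J" "0 \<le> \<delta>" "0 \<le> t"
    and "grid J \<delta> k \<omega> \<le> ennreal t" "ennreal t \<le> grid J \<delta> (Suc k) \<omega>"
  shows "\<bar>\<omega> j t - \<omega> j (enn2real (grid J \<delta> k \<omega>))\<bar> \<le> \<delta>"
proof -
  have fin: "grid J \<delta> k \<omega> \<noteq> \<infinity>" using assms(5) by (auto simp: top_unique)
  then have "ennreal (enn2real (grid J \<delta> k \<omega>)) \<le> ennreal t" using assms(5) by (simp add: less_top)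
  then have "enn2real (grid J \<delta> k \<omega>) \<le> t" using assms(4) by (simp add: ennreal_le_iff)
  then show ?thesis
    using assms fin by (intro exit_time_osc) auto
qed

lemma uniform_modulus:
  assumes \<omega>: "\<omega> \<in> Omega J" and \<delta>: "0 < \<delta>"
  shows "\<exists>\<eta>>0. \<forall>j<J. \<forall>u\<in>{0..T}. \<forall>v\<in>{0..T}. \<bar>u - v\<bar> < \<eta> \<longrightarrow> \<bar>\<omega> j u - \<omega> j v\<bar> < \<delta>"
proof -
  have "\<exists>\<eta>>0. \<forall>u\<in>{0..T}. \<forall>v\<in>{0..T}. \<bar>u - v\<bar> < \<eta> \<longrightarrow> \<bar>\<omega> j u - \<omega> j v\<bar> < \<delta>" if "j < J" for j
  proof -
    have "uniformly_continuous_on {0..T} (\<omega> j)"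
      by (rule compact_uniformly_continuous)
         (auto intro: continuous_on_subset[OF Omega_continuous[OF \<omega> that]])
    then show ?thesis using \<delta> unfolding uniformly_continuous_on_def dist_real_def by metis
  qed
  then obtain \<eta> where \<eta>: "\<And>j. j < J \<Longrightarrow> 0 < \<eta> j"
    "\<And>j u v. j < J \<Longrightarrow> u \<in> {0..T} \<Longrightarrow> v \<in> {0..T} \<Longrightarrow> \<bar>u - v\<bar> < \<eta> j \<Longrightarrow> \<bar>\<omega> j u - \<omega> j v\<bar> < \<delta>"
    by metis
  \<comment> \<open>The 1 keeps the set nonempty when J = 0.\<close>
  define e where "e = Min (insert 1 (\<eta> ` {..<J}))"
  have "0 < e" unfolding e_def using \<eta>(1) by (subst Min_gr_iff) auto
  moreover have "e \<le> \<eta> j" if "j < J" for j unfolding e_def using that by (intro Min_le) auto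
  ultimately show ?thesis using \<eta>(2) by (intro exI[of _ e]) (meson less_le_trans)
qed

text \<open>Uniform continuity on [0, t + 1] gives a fixed lower bound for the length of every grid
  step that starts in [0, t], so finitely many steps pass t.\<close>

lemma grid_unbounded:
  assumes \<omega>: "\<omega> \<in> Omega J" and \<delta>: "0 < \<delta>" and t: "0 \<le> t"
  shows "\<exists>N. ennreal t < grid J \<delta> N \<omega>"
proof -
  obtain \<eta>0 where \<eta>0: "0 < \<eta>0"
    "\<And>j u v. j < J \<Longrightarrow> u \<in> {0..t+1} \<Longrightarrow> v \<in> {0..t+1} \<Longrightarrow> \<bar>u - v\<bar> < \<eta>0 \<Longrightarrow> \<bar>\<omega> j u - \<omega> j v\<bar> < \<delta>"
    using uniform_modulus[OF \<omega> \<delta>, of "t + 1"] by blast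
  \<comment> \<open>At most 1, so that points within this distance after some s \<le> t stay in
    [0, t + 1].\<close>
  define \<eta> where "\<eta> = min 1 \<eta>0"
  have \<eta>: "0 < \<eta>" "\<eta> \<le> 1" "\<eta> \<le> \<eta>0" using \<eta>0(1) by (auto simp: \<eta>_def)
  have step: "ennreal (s + \<eta>) \<le> exit_time J \<delta> s \<omega>" if s: "0 \<le> s" "s \<le> t" for s
  proof (rule ccontr)
    assume "\<not> ?thesis"
    then have less: "exit_time J \<delta> s \<omega> < ennreal (s + \<eta>)" by simp
    then have ne: "exit_set J \<delta> s \<omega> \<noteq> {}" by (auto simp: exit_time_def)
    let ?u = "Inf (exit_set J \<delta> s \<omega>)"
    have "?u \<in> exit_set J \<delta> s \<omega>" by (rule Inf_exit_set[OF \<omega> s(1) ne])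
    then obtain j where j: "s \<le> ?u" "j < J" "\<delta> \<le> \<bar>\<omega> j ?u - \<omega> j s\<bar>"
      by (auto simp: exit_set_def)
    have "?u < s + \<eta>" using less ne j s by (simp add: exit_time_def ennreal_less_iff)
    then show False using \<eta>0(2)[of j ?u s] j s \<eta> by auto
  qed
  have claim: "ennreal t < grid J \<delta> k \<omega> \<or> ennreal (real k * \<eta>) \<le> grid J \<delta> k \<omega>" for k
  proof (induction k)
    case (Suc k)
    show ?case
    proof (cases "ennreal t < grid J \<delta> k \<omega>")
      case True
      then show ?thesis using grid_Suc_ge[OF \<omega>, of \<delta> k] less_le_trans by blast
    next
      case False
      define s where "s = enn2real (grid J \<delta> k \<omega>)"
      have fin: "grid J \<delta> k \<omega> \<noteq> \<infinity>" using False by auto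
      then have s: "grid J \<delta> k \<omega> = ennreal s" "0 \<le> s" by (auto simp: s_def less_top)
      then have "s \<le> t" using False t by (simp add: not_less ennreal_le_iff)
      have "ennreal (real k * \<eta>) \<le> ennreal s" using False Suc s by simp
      then have "real k * \<eta> \<le> s" using s(2) by (simp add: ennreal_le_iff)
      then have "real (Suc k) * \<eta> \<le> s + \<eta>" by (simp add: algebra_simps)
      then have "ennreal (real (Suc k) * \<eta>) \<le> exit_time J \<delta> s \<omega>"
        using step[OF s(2) \<open>s \<le> t\<close>] ennreal_leI order_trans by blast
      then show ?thesis using fin by (simp add: s_def del: of_nat_Suc)
    qed
  qed simp
  obtain k :: nat where "t / \<eta> < real k" using reals_Archimedean2 by blast
  then have "t < real k * \<eta>" using \<eta> by (simp add: divide_less_eq)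
  then have "ennreal t < ennreal (real k * \<eta>)" using t by (simp add: ennreal_less_iff)
  then show ?thesis using claim[of k] less_le_trans by blast
qed

text \<open>The event is rewritten with countably many evaluations of the path. Staying strictly
  within \<delta> on a compact interval means staying within \<delta> - 1/(n + 1) for some n, and
  this closed condition can be tested at rational times clamped to the interval.\<close>

lemma grid_Suc_greater_iff:
  assumes \<omega>: "\<omega> \<in> Omega J" and t: "0 \<le> t"
  shows "ennreal t < grid J \<delta> (Suc k) \<omega> \<longleftrightarrow> ennreal t < grid J \<delta> k \<omega> \<or>
    (\<forall>j<J. \<exists>n. \<forall>q\<in>\<rat>. \<bar>\<omega> j (max (min q t) (cut (grid J \<delta> k \<omega>) t)) -
       \<omega> j (cut (grid J \<delta> k \<omega>) t)\<bar> \<le> \<delta> - 1 / real (Suc n))"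
proof (cases "ennreal t < grid J \<delta> k \<omega>")
  case True
  then show ?thesis using grid_Suc_ge[OF \<omega>, of \<delta> k] less_le_trans by blast
next
  case False
  define s where "s = enn2real (grid J \<delta> k \<omega>)"
  have fin: "grid J \<delta> k \<omega> \<noteq> \<infinity>" using False by auto
  then have s: "grid J \<delta> k \<omega> = ennreal s" "0 \<le> s" by (auto simp: s_def less_top)
  then have "s \<le> t" using False t by (auto simp: not_less ennreal_le_iff)
  have cut: "cut (grid J \<delta> k \<omega>) t = s" using False by (simp add: cut_def s_def not_less)
  have "ennreal t < grid J \<delta> (Suc k) \<omega> \<longleftrightarrow> \<not> exit_time J \<delta> s \<omega> \<le> ennreal t"
    using fin by (simp add: s_def not_le)
  also have "\<dots> \<longleftrightarrow> (\<forall>j<J. \<forall>u\<in>{s..t}. \<bar>\<omega> j u - \<omega> j s\<bar> < \<delta>)"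
    unfolding exit_time_le_iff[OF \<omega> s(2) t] 
    by (auto simp: exit_set_def not_le) (meson not_le)
  also have "\<dots> \<longleftrightarrow> (\<forall>j<J. \<exists>n. \<forall>q\<in>\<rat>. \<bar>\<omega> j (max (min q t) s) - \<omega> j s\<bar> \<le> \<delta> - 1 / real (Suc n))"
  proof (intro all_cong iffI)
    fix j assume j: "j < J" and *: "\<forall>u\<in>{s..t}. \<bar>\<omega> j u - \<omega> j s\<bar> < \<delta>"
    have "continuous_on {s..t} (\<lambda>u. \<bar>\<omega> j u - \<omega> j s\<bar>)"
      using continuous_on_subset[OF Omega_continuous[OF \<omega> j], of "{s..t}"] s
      by (intro continuous_intros) auto
    then obtain u where u: "u \<in> {s..t}" "\<And>v. v \<in> {s..t} \<Longrightarrow> \<bar>\<omega> j v - \<omega> j s\<bar> \<le> \<bar>\<omega> j u - \<omega> j s\<bar>"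
      using continuous_attains_sup[of "{s..t}" "\<lambda>u. \<bar>\<omega> j u - \<omega> j s\<bar>"] \<open>s \<le> t\<close> by auto
    then have "0 < \<delta> - \<bar>\<omega> j u - \<omega> j s\<bar>" using * by auto
    then obtain n where "inverse (real (Suc n)) < \<delta> - \<bar>\<omega> j u - \<omega> j s\<bar>"
      using reals_Archimedean by blast
    then have "1 / real (Suc n) < \<delta> - \<bar>\<omega> j u - \<omega> j s\<bar>" by (simp only: inverse_eq_divide)
    then have "\<bar>\<omega> j v - \<omega> j s\<bar> \<le> \<delta> - 1 / real (Suc n)" if "v \<in> {s..t}" for v
      using u(2)[OF that] by linarith
    moreover have "max (min q t) s \<in> {s..t}" for q using \<open>s \<le> t\<close> by auto
    ultimately show "\<exists>n. \<forall>q\<in>\<rat>. \<bar>\<omega> j (max (min q t) s) - \<omega> j s\<bar> \<le> \<delta> - 1 / real (Suc n)"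
      by blast
  next
    fix j assume j: "j < J"
      and "\<exists>n. \<forall>q\<in>\<rat>. \<bar>\<omega> j (max (min q t) s) - \<omega> j s\<bar> \<le> \<delta> - 1 / real (Suc n)"
    then obtain n where n: "\<forall>q\<in>\<rat>. \<bar>\<omega> j (max (min q t) s) - \<omega> j s\<bar> \<le> \<delta> - 1 / real (Suc n)" by blast
    have "continuous_on UNIV (\<lambda>q. \<omega> j (max (min q t) s))"
      by (rule continuous_on_compose2[OF Omega_continuous[OF \<omega> j]])
         (use s(2) in \<open>auto intro!: continuous_intros\<close>)
    then have "closed {q. \<bar>\<omega> j (max (min q t) s) - \<omega> j s\<bar> \<le> \<delta> - 1 / real (Suc n)}"
      by (intro closed_Collect_le continuous_intros)
    then have "closure \<rat> \<subseteq> {q. \<bar>\<omega> j (max (min q t) s) - \<omega> j s\<bar> \<le> \<delta> - 1 / real (Suc n)}"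
      using n by (intro closure_minimal) auto
    then have *: "\<bar>\<omega> j (max (min q t) s) - \<omega> j s\<bar> \<le> \<delta> - 1 / real (Suc n)" for q
      by (auto simp: Rats_closure_real)
    show "\<forall>u\<in>{s..t}. \<bar>\<omega> j u - \<omega> j s\<bar> < \<delta>"
    proof
      fix u assume "u \<in> {s..t}"
      then have "max (min u t) s = u" by auto
      moreover have "0 < 1 / real (Suc n)" by simp
      ultimately show "\<bar>\<omega> j u - \<omega> j s\<bar> < \<delta>" using *[of u] by (simp only:)
    qed
  qed
  finally show ?thesis using False by (simp add: cut)
qed

lemma measurable_grid: "grid J \<delta> k \<in> borel_measurable (FOmega J)"
proof (induction k)
  case (Suc k)
  note [measurable] = this
  show ?case
  proof (rule borel_measurableI_greater)
    fix y :: ennreal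
    show "{\<omega> \<in> space (FOmega J). y < grid J \<delta> (Suc k) \<omega>} \<in> sets (FOmega J)"
    proof (cases y)
      case (real t)
      have cut [measurable]: "(\<lambda>\<omega>. cut (grid J \<delta> k \<omega>) t) \<in> borel_measurable (FOmega J)"
        unfolding cut_def by measurable
      have [measurable]: "(\<lambda>\<omega>. \<omega> j (max (min q t) (cut (grid J \<delta> k \<omega>) t))) \<in> borel_measurable (FOmega J)"
        "(\<lambda>\<omega>. \<omega> j (cut (grid J \<delta> k \<omega>) t)) \<in> borel_measurable (FOmega J)" if "j \<in> {..<J}" for q j
        using that real by (auto intro!: measurable_coordinate_random_time simp: le_max_iff_disj)
      let ?P = "\<lambda>\<omega>. y < grid J \<delta> k \<omega> \<or>
        (\<forall>j\<in>{..<J}. \<exists>n. \<forall>q\<in>\<rat>. \<bar>\<omega> j (max (min q t) (cut (grid J \<delta> k \<omega>) t)) -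
          \<omega> j (cut (grid J \<delta> k \<omega>) t)\<bar> \<le> \<delta> - 1 / real (Suc n))"
      have "y < grid J \<delta> (Suc k) \<omega> \<longleftrightarrow> ?P \<omega>" if "\<omega> \<in> Omega J" for \<omega>
        unfolding real(2) grid_Suc_greater_iff[OF that real(1)] by (simp only: Ball_def lessThan_iff)
      then have "{\<omega> \<in> space (FOmega J). y < grid J \<delta> (Suc k) \<omega>} = {\<omega> \<in> space (FOmega J). ?P \<omega>}"
        by (intro Collect_cong conj_cong) (simp_all only: space_FOmega)
      also have "\<dots> \<in> sets (FOmega J)"
        using countable_rat by measurable
      finally show ?thesis .
    qed (simp add: top.not_eq_extremum)
  qed
qed simp

subsection \<open>Martingales and the maximal inequality\<close>

lemma gsum_cong:
  assumes "0 \<le> t" "mono T" "mono T'" "\<And>k. cut (T k) t = cut (T' k) t"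
    and "\<And>s. 0 \<le> s \<Longrightarrow> s \<le> t \<Longrightarrow> y s = y' s" "\<And>k. T k \<le> ennreal t \<Longrightarrow> h k = h' k"
  shows "gsum h y T t = gsum h' y' T' t"
proof -
  have "h k * (y (cut (T (Suc k)) t) - y (cut (T k) t)) =
    h' k * (y' (cut (T' (Suc k)) t) - y' (cut (T' k) t))" for k
  proof (cases "T k \<le> ennreal t")
    case True
    then show ?thesis using assms(1,4,5,6) by simp
  next
    case False
    moreover have "T k \<le> T (Suc k)" using assms(2) by (simp add: mono_def)
    ultimately have "cut (T k) t = t" "cut (T (Suc k)) t = t"
      using assms(1) by (auto intro!: cut_eq)
    then show ?thesis using assms(4)[symmetric] by simp
  qed
  then show ?thesis by (simp only: gsum_def)
qed

lemma gains_agree: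
  assumes T: "path_sequence J T" and h: "\<And>k. tau_measurable J (T k) (h k)" and "Js \<le> J"
    and \<omega>: "\<omega> \<in> Omega J" "\<omega>' \<in> Omega J" and t: "0 \<le> t" and a: "agree_upto J \<omega> \<omega>' (ennreal t)"
  shows "gains Js T h t \<omega> = gains Js T h t \<omega>'"
  unfolding gains_def
proof (rule sum.cong[OF refl])
  fix j assume "j \<in> {..<Js}"
  then have j: "j < J" using assms(3) by simp
  show "gsum (\<lambda>n. h n \<omega> j) (\<omega> j) (\<lambda>n. T n \<omega>) t = gsum (\<lambda>n. h n \<omega>' j) (\<omega>' j) (\<lambda>n. T n \<omega>') t"
  proof (rule gsum_cong[OF t path_sequenceD(3)[OF T \<omega>(1)] path_sequenceD(3)[OF T \<omega>(2)]])
    show "cut (T k \<omega>) t = cut (T k \<omega>') t" for k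
      by (rule path_stopping_cut[OF path_sequenceD(1)[OF T] \<omega> a, symmetric])
    show "\<omega> j s = \<omega>' j s" if "0 \<le> s" "s \<le> t" for s
      using a j that by (auto simp: agree_upto_def intro: ennreal_leI)
    show "h k \<omega> j = h k \<omega>' j" if "T k \<omega> \<le> ennreal t" for k
      using h[of k] \<omega> agree_mono[OF a that] by (auto simp: tau_measurable_def)
  qed
qed

lemma le_ennreal_finite: "a \<le> ennreal t \<Longrightarrow> a < \<infinity>"
  by (metis le_less_trans ennreal_less_top infinity_ennreal_def)

lemma gains_inc:
  assumes "mono (\<lambda>n. T n \<omega>)" "T i \<omega> \<le> ennreal a" "0 \<le> a" "a \<le> b" "ennreal b \<le> T (Suc i) \<omega>"
  shows "gains Js T h b \<omega> - gains Js T h a \<omega> = (\<Sum>j<Js. h i \<omega> j * (\<omega> j b - \<omega> j a))"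
  unfolding gains_def sum_subtractf[symmetric]
  using assms by (intro sum.cong refl gsum_inc) auto

definition conv :: "nat \<Rightarrow> nat \<Rightarrow> (nat \<Rightarrow> real \<Rightarrow> path \<Rightarrow> real) \<Rightarrow> (real \<Rightarrow> path \<Rightarrow> real) \<Rightarrow> bool" where
  "conv J Js Xs X \<longleftrightarrow>
    quasi_always J Js (\<lambda>t \<omega>. uniform_limit {0..t} (\<lambda>k s. Xs k s \<omega>) (\<lambda>s. X s \<omega>) sequentially)"

text \<open>The bound C is common to all grid steps, unlike the bounds in
  \<open>simple_capital\<close>, which may vary with the step. It limits the oscillation of the
  gains within one grid step to \<open>real Js * C * (1/2)^m\<close>, as in
  \<open>gains_osc\<close>.\<close>

definition grid_class :: "nat \<Rightarrow> nat \<Rightarrow> nat \<Rightarrow> real \<Rightarrow> (real \<Rightarrow> path \<Rightarrow> real) set" where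
  "grid_class J Js m C = {K. \<exists>c H. (\<forall>k. tau_measurable J (grid J ((1/2)^m) k) (H k)) \<and>
     (\<forall>k. \<forall>\<omega>\<in>Omega J. \<forall>j<Js. \<bar>H k \<omega> j\<bar> \<le> C) \<and>
     (\<forall>t\<ge>0. \<forall>\<omega>\<in>Omega J. K t \<omega> = c + gains Js (grid J ((1/2)^m)) H t \<omega>)}"

lemma grid_classE:
  assumes "K \<in> grid_class J Js m C"
  obtains c H where "\<And>k. tau_measurable J (grid J ((1/2)^m) k) (H k)"
    "\<And>k \<omega> j. \<omega> \<in> Omega J \<Longrightarrow> j < Js \<Longrightarrow> \<bar>H k \<omega> j\<bar> \<le> C"
    "\<And>t \<omega>. 0 \<le> t \<Longrightarrow> \<omega> \<in> Omega J \<Longrightarrow> K t \<omega> = c + gains Js (grid J ((1/2)^m)) H t \<omega>"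
  using assms unfolding grid_class_def by blast

lemma grid_classI:
  assumes "\<And>k. tau_measurable J (grid J ((1/2)^m) k) (H k)"
    "\<And>k \<omega> j. \<omega> \<in> Omega J \<Longrightarrow> j < Js \<Longrightarrow> \<bar>H k \<omega> j\<bar> \<le> C"
    "\<And>t \<omega>. 0 \<le> t \<Longrightarrow> \<omega> \<in> Omega J \<Longrightarrow> K t \<omega> = c + gains Js (grid J ((1/2)^m)) H t \<omega>"
  shows "K \<in> grid_class J Js m C"
  using assms unfolding grid_class_def by blast

lemma grid_class_mono:
  assumes "K \<in> grid_class J Js m C" "C \<le> C'"
  shows "K \<in> grid_class J Js m C'"
  by (rule grid_classE[OF assms(1)], rule grid_classI) (blast intro: order_trans[OF _ assms(2)])+

lemma grid_class_init:
  assumes "K \<in> grid_class J Js m C"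
  shows "\<exists>c. \<forall>\<omega>\<in>Omega J. K 0 \<omega> = c"
proof (rule grid_classE[OF assms])
  fix c H assume "\<And>t \<omega>. 0 \<le> t \<Longrightarrow> \<omega> \<in> Omega J \<Longrightarrow> K t \<omega> = c + gains Js (grid J ((1/2)^m)) H t \<omega>"
  then show ?thesis by (intro exI[of _ c]) simp
qed

text \<open>The real-valued counterpart of continuous martingales. Admitting limits that are only locally
  uniform quasi-always makes domains unnecessary, and starting from the grid class allows
  strategies that stop at non-measurable path-dependent times.\<close>

inductive_set mart :: "nat \<Rightarrow> nat \<Rightarrow> (real \<Rightarrow> path \<Rightarrow> real) set" for J Js where
  base: "(\<And>m. K m \<in> grid_class J Js m C) \<Longrightarrow> conv J Js K X \<Longrightarrow> X \<in> mart J Js"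
| limit: "(\<And>k. Xs k \<in> mart J Js) \<Longrightarrow> conv J Js Xs X \<Longrightarrow> X \<in> mart J Js"

text \<open>A form of Ville's inequality: with capital b one owns at least 1 at every time by which
  X has exceeded 1 without ever having been negative. The strict inequality and the restriction to
  nonnegative paths leave room for the shifts used in passing to limits. A negative b stands for
  capital 0.\<close>

definition maximal_bound :: "nat \<Rightarrow> nat \<Rightarrow> (real \<Rightarrow> path \<Rightarrow> real) \<Rightarrow> real \<Rightarrow> bool" where
  "maximal_bound J Js X b \<longleftrightarrow> (\<exists>W\<in>nn_supermartingale J Js. (\<forall>\<omega>\<in>Omega J. W 0 \<omega> \<le> ennreal b) \<and>
     (\<forall>t\<ge>0. \<forall>\<omega>\<in>Omega J. (\<forall>s\<in>{0..t}. 0 \<le> X s \<omega>) \<and> (\<exists>s\<in>{0..t}. 1 < X s \<omega>) \<longrightarrow> 1 \<le> W t \<omega>))"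

lemma gains_osc:
  assumes \<omega>: "\<omega> \<in> Omega J" and "Js \<le> J" "0 \<le> \<delta>" "0 \<le> C" and H: "\<And>k j. j < Js \<Longrightarrow> \<bar>H k \<omega> j\<bar> \<le> C"
    and u: "0 \<le> u" "grid J \<delta> i \<omega> \<le> ennreal u" "ennreal u \<le> grid J \<delta> (Suc i) \<omega>"
  shows "\<bar>gains Js (grid J \<delta>) H u \<omega> - gains Js (grid J \<delta>) H (enn2real (grid J \<delta> i \<omega>)) \<omega>\<bar> \<le> real Js * C * \<delta>"
proof -
  define r where "r = enn2real (grid J \<delta> i \<omega>)"
  have "grid J \<delta> i \<omega> \<noteq> top" using u(2) by (auto simp: top_unique)
  then have r: "grid J \<delta> i \<omega> = ennreal r" "0 \<le> r" by (auto simp: r_def less_top)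
  then have "r \<le> u" using u by (simp add: ennreal_le_iff)
  have "gains Js (grid J \<delta>) H u \<omega> - gains Js (grid J \<delta>) H r \<omega> = (\<Sum>j<Js. H i \<omega> j * (\<omega> j u - \<omega> j r))"
    using r \<open>r \<le> u\<close> u by (intro gains_inc mono_grid \<omega>) auto
  also have "\<bar>\<dots>\<bar> \<le> (\<Sum>j<Js. \<bar>H i \<omega> j * (\<omega> j u - \<omega> j r)\<bar>)" by (rule sum_abs)
  also have "\<dots> \<le> (\<Sum>j<Js. C * \<delta>)"
  proof (rule sum_mono)
    fix j assume "j \<in> {..<Js}"
    then have "\<bar>H i \<omega> j\<bar> \<le> C" "\<bar>\<omega> j u - \<omega> j r\<bar> \<le> \<delta>"
      using H grid_osc[OF \<omega> _ assms(3) u, of j] assms(2) by (auto simp: r_def)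
    then show "\<bar>H i \<omega> j * (\<omega> j u - \<omega> j r)\<bar> \<le> C * \<delta>"
      unfolding abs_mult using assms(4) by (intro mult_mono) auto
  qed
  finally show ?thesis by (simp add: r_def mult.assoc)
qed

text \<open>Up to the oscillation between grid points, stop at the first grid point where the process
  leaves the interval \<open>[0, 1)\<close>.\<close>

lemma maximal_bound_grid_class:
  assumes K: "K \<in> grid_class J Js m C" and "Js \<le> J" and c: "\<And>\<omega>. \<omega> \<in> Omega J \<Longrightarrow> K 0 \<omega> = c"
    and C: "0 \<le> C"
  shows "maximal_bound J Js (\<lambda>t \<omega>. K t \<omega> + a) (c + a + real Js * C * (1/2)^m)"
proof -
  define \<delta> :: real where "\<delta> = (1/2)^m"
  have \<delta>: "0 < \<delta>" by (simp add: \<delta>_def)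
  define g where "g = grid J \<delta>"
  define e where "e = real Js * C * \<delta>"
  have "0 \<le> e" using C \<delta> by (simp add: e_def)
  obtain c' H where tm: "\<And>k. tau_measurable J (g k) (H k)"
    and HC: "\<And>k \<omega> j. \<omega> \<in> Omega J \<Longrightarrow> j < Js \<Longrightarrow> \<bar>H k \<omega> j\<bar> \<le> C"
    and K': "\<And>t \<omega>. 0 \<le> t \<Longrightarrow> \<omega> \<in> Omega J \<Longrightarrow> K t \<omega> = c' + gains Js g H t \<omega>"
    by (rule grid_classE[OF K, folded \<delta>_def, folded g_def]) (rule that, assumption+)
  have K'': "K t \<omega> = c + gains Js g H t \<omega>" if "0 \<le> t" "\<omega> \<in> Omega J" for t \<omega>
    using K'[of 0 \<omega>] K'[of t \<omega>] c[of \<omega>] that by simp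
  have seq: "path_sequence J g" unfolding g_def by (rule path_sequence_grid)
  show ?thesis
  proof (cases "c + a < 0")
    \<comment> \<open>Paths starting below 0 do not belong to the event, so the zero supermartingale
      serves.\<close>
    case True
    have "maximal_bound J Js (\<lambda>t \<omega>. K t \<omega> + a) b" for b
      unfolding maximal_bound_def
      by (rule bexI[OF _ nn_supermartingale_const[of 0]]) (use True c in \<open>auto dest!: bspec[of _ _ 0]\<close>)
    then show ?thesis .
  next
    case False
    define r where "r i \<omega> = enn2real (g i \<omega>)" for i \<omega>
    define V where "V t \<omega> = c + a + gains Js g H t \<omega>" for t \<omega>
    \<comment> \<open>A grid time at infinity counts as harmless. The upper threshold is lowered by
      e, the largest oscillation within a grid step, so that a value above 1 anywhere forces a value
      of at least 1 - e at the grid time before it.\<close>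
    define ok where "ok i \<omega> \<longleftrightarrow> (g i \<omega> \<noteq> \<infinity> \<longrightarrow> 0 \<le> V (r i \<omega>) \<omega> \<and> V (r i \<omega>) \<omega> < 1 - e)" for i \<omega>
    define H' where "H' k \<omega> j = (if \<forall>i\<le>k. ok i \<omega> then H k \<omega> j else 0)" for k \<omega> j
    define V' where "V' t \<omega> = c + a + gains Js g H' t \<omega>" for t \<omega>
    have r: "g i \<omega> = ennreal (r i \<omega>)" "0 \<le> r i \<omega>" if "g i \<omega> < \<infinity>" for i \<omega>
      using that by (auto simp: r_def less_top)
    have V0: "V 0 \<omega> = c + a" "V' 0 \<omega> = c + a" for \<omega> by (simp_all add: V_def V'_def)
    have V_agree: "V t \<omega> = V t \<omega>'"
      if "\<omega> \<in> Omega J" "\<omega>' \<in> Omega J" "0 \<le> t" "agree_upto J \<omega> \<omega>' (ennreal t)" for t \<omega> \<omega>'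
      using gains_agree[OF seq tm assms(2) that] by (simp add: V_def)
    have "strategy J Js g H'"
      unfolding strategy_def
    proof (intro conjI allI ballI impI seq)
      show "g k \<in> borel_measurable (FOmega J)" for k unfolding g_def by (rule measurable_grid)
      show "\<exists>N. ennreal t < g N \<omega>" if "\<omega> \<in> Omega J" "0 \<le> t" for t \<omega>
        unfolding g_def by (rule grid_unbounded[OF that(1) \<delta> that(2)])
      show "\<exists>B. \<forall>\<omega>\<in>Omega J. \<forall>j<Js. \<bar>H' n \<omega> j\<bar> \<le> B" for n
        using HC C by (intro exI[of _ C]) (auto simp: H'_def)
      show "tau_measurable J (g n) (H' n)" for n
        unfolding tau_measurable_def
      proof (intro ballI impI)
        fix \<omega> \<omega>' assume *: "\<omega> \<in> Omega J" "\<omega>' \<in> Omega J" "agree_upto J \<omega> \<omega>' (g n \<omega>)"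
        have "ok i \<omega> \<longleftrightarrow> ok i \<omega>'" if "i \<le> n" for i
        proof -
          have le: "g i \<omega> \<le> g n \<omega>" using path_sequenceD(3)[OF seq *(1)] that by (simp add: mono_def)
          have eq: "g i \<omega>' = g i \<omega>" by (rule path_stoppingD[OF path_sequenceD(1)[OF seq] * le])
          show ?thesis
          proof (cases "g i \<omega> < \<infinity>")
            case True
            have "V (r i \<omega>) \<omega> = V (r i \<omega>) \<omega>'"
              using r[OF True] agree_mono[OF *(3) le] by (intro V_agree *(1,2)) auto
            then show ?thesis using eq by (simp add: ok_def r_def)
          qed (use eq in \<open>auto simp: ok_def less_top[symmetric]\<close>)
        qed
        then have ok_iff: "(\<forall>i\<le>n. ok i \<omega>) \<longleftrightarrow> (\<forall>i\<le>n. ok i \<omega>')" by blast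
        have H_eq: "H n \<omega> = H n \<omega>'" using tm[of n] * by (auto simp: tau_measurable_def)
        show "H' n \<omega> = H' n \<omega>'" unfolding H'_def[abs_def] ok_iff H_eq by (rule refl)
      qed
    qed
    then have simple: "(\<lambda>t \<omega>. V' t \<omega> + e) \<in> simple_capital J Js"
      by (rule simple_capitalI[where c = "c + a + e"]) (simp add: V'_def)
    have osc: "\<bar>V u \<omega> - V (r i \<omega>) \<omega>\<bar> \<le> e"
      if "\<omega> \<in> Omega J" "0 \<le> u" "g i \<omega> \<le> ennreal u" "ennreal u \<le> g (Suc i) \<omega>" for u i \<omega>
      using gains_osc[where H = H and i = i and u = u, OF that(1) assms(2) _ C HC[OF that(1)]] that \<delta>
      by (simp add: V_def g_def r_def e_def)
    have inc: "V' u \<omega> - V' (r i \<omega>) \<omega> = (if \<forall>l\<le>i. ok l \<omega> then V u \<omega> - V (r i \<omega>) \<omega> else 0)"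
      if "\<omega> \<in> Omega J" "0 \<le> u" "g i \<omega> \<le> ennreal u" "ennreal u \<le> g (Suc i) \<omega>" for u i \<omega>
    proof -
      have "g i \<omega> < \<infinity>" by (rule le_ennreal_finite[OF that(3)])
      note ri = r[OF this]
      then have "r i \<omega> \<le> u" using that by (simp add: ennreal_le_iff)
      then have "gains Js g h u \<omega> - gains Js g h (r i \<omega>) \<omega> = (\<Sum>j<Js. h i \<omega> j * (\<omega> j u - \<omega> j (r i \<omega>)))" for h
        using that ri path_sequenceD(3)[OF seq that(1)] by (intro gains_inc) auto
      note this[of H] this[of H']
      moreover have "H' i \<omega> = (if \<forall>l\<le>i. ok l \<omega> then H i \<omega> else (\<lambda>_. 0))"
      proof (cases "\<forall>l\<le>i. ok l \<omega>")
        case True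
        show ?thesis unfolding H'_def[abs_def] if_P[OF True] by (rule refl)
      next
        case False
        show ?thesis unfolding H'_def[abs_def] if_not_P[OF False] by (rule refl)
      qed
      ultimately show ?thesis
        unfolding V_def V'_def by (cases "\<forall>l\<le>i. ok l \<omega>") (simp_all only: if_True if_False, simp_all)
    qed
    \<comment> \<open>The traded process is frozen at its value at the first grid time that is not
      \<open>ok\<close>; as long as there is none it follows V.\<close>
    have stopped: "\<exists>l\<le>i. (\<forall>l'<l. ok l' \<omega>) \<and> (l < i \<longrightarrow> \<not> ok l \<omega>) \<and> V' (r i \<omega>) \<omega> = V (r l \<omega>) \<omega>"
      if "\<omega> \<in> Omega J" "g i \<omega> < \<infinity>" for i \<omega>
      using that(2)
    proof (induction i)
      case 0
      then show ?case using V0 path_sequenceD(2)[OF seq that(1)] by (auto simp: r_def)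
    next
      case (Suc i)
      have le: "g i \<omega> \<le> g (Suc i) \<omega>" using path_sequenceD(3)[OF seq that(1)] by (simp add: mono_def)
      then have "g i \<omega> < \<infinity>" using Suc.prems le_less_trans by blast
      from Suc.IH[OF this] obtain l where l: "l \<le> i" "\<forall>l'<l. ok l' \<omega>" "l < i \<longrightarrow> \<not> ok l \<omega>"
        "V' (r i \<omega>) \<omega> = V (r l \<omega>) \<omega>" by blast
      note rS = r[OF Suc.prems]
      have inc': "V' (r (Suc i) \<omega>) \<omega> - V' (r i \<omega>) \<omega> =
          (if \<forall>l\<le>i. ok l \<omega> then V (r (Suc i) \<omega>) \<omega> - V (r i \<omega>) \<omega> else 0)"
        using rS le by (intro inc that(1)) auto
      show ?case
      proof (cases "\<forall>l\<le>i. ok l \<omega>")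
        case True
        then have "l = i" using l by (meson le_neq_implies_less)
        then have "V' (r (Suc i) \<omega>) \<omega> = V (r (Suc i) \<omega>) \<omega>" using inc' l(4) unfolding if_P[OF True] by simp
        then show ?thesis using True by (intro exI[of _ "Suc i"]) (simp add: less_Suc_eq_le)
      next
        case False
        then have "\<not> ok l \<omega>" using l by (metis le_neq_implies_less nat_less_le)
        moreover have "V' (r (Suc i) \<omega>) \<omega> = V (r l \<omega>) \<omega>" using inc' l(4) unfolding if_not_P[OF False] by simp
        ultimately show ?thesis using l by (intro exI[of _ l]) auto
      qed
    qed
    \<comment> \<open>Trading may stop below 0, but by at most e, because the grid value before was
      still nonnegative. Adding e therefore gives a nonnegative capital.\<close>
    have low: "- e \<le> V (r l \<omega>) \<omega>"
      if "\<omega> \<in> Omega J" "g l \<omega> < \<infinity>" "\<forall>l'<l. ok l' \<omega>" for l \<omega>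
    proof (cases l)
      case 0
      then show ?thesis using V0 False \<open>0 \<le> e\<close> path_sequenceD(2)[OF seq that(1)] by (simp add: r_def)
    next
      case (Suc k)
      have le: "g k \<omega> \<le> g l \<omega>" using path_sequenceD(3)[OF seq that(1)] Suc by (simp add: mono_def)
      then have "g k \<omega> < \<infinity>" using that(2) le_less_trans by blast
      then have "0 \<le> V (r k \<omega>) \<omega>" using that(3) Suc by (auto simp: ok_def)
      moreover have "\<bar>V (r l \<omega>) \<omega> - V (r k \<omega>) \<omega>\<bar> \<le> e"
        using r[OF that(2)] le Suc by (intro osc that(1)) auto
      ultimately show ?thesis by linarith
    qed
    have cases: "(\<exists>l. g l \<omega> \<le> ennreal t \<and> (\<forall>l'<l. ok l' \<omega>) \<and> \<not> ok l \<omega> \<and> V' t \<omega> = V (r l \<omega>) \<omega>) \<or>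
        (\<exists>i. g i \<omega> \<le> ennreal t \<and> ennreal t < g (Suc i) \<omega> \<and> (\<forall>l\<le>i. ok l \<omega>) \<and> V' t \<omega> = V t \<omega>)"
      if \<omega>: "\<omega> \<in> Omega J" and t: "0 \<le> t" for t \<omega>
    proof -
      obtain N where "ennreal t < g N \<omega>" using grid_unbounded[OF \<omega> \<delta> t] by (auto simp: g_def)
      then obtain i where i: "g i \<omega> \<le> ennreal t" "ennreal t < g (Suc i) \<omega>"
        using ex_index[of "\<lambda>i. g i \<omega>" "ennreal t" N] path_sequenceD(2)[OF seq \<omega>] by auto
      have fin: "g i \<omega> < \<infinity>" by (rule le_ennreal_finite[OF i(1)])
      obtain l where l: "l \<le> i" "\<forall>l'<l. ok l' \<omega>" "l < i \<longrightarrow> \<not> ok l \<omega>"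
        "V' (r i \<omega>) \<omega> = V (r l \<omega>) \<omega>" using stopped[OF \<omega> fin] by blast
      note inc' = inc[OF \<omega> t i(1) less_imp_le[OF i(2)]]
      show ?thesis
      proof (cases "\<forall>l\<le>i. ok l \<omega>")
        case True
        then have "l = i" using l by (meson le_neq_implies_less)
        then have "V' t \<omega> = V t \<omega>" using inc' l(4) unfolding if_P[OF True] by simp
        then show ?thesis using True i by blast
      next
        case False
        then have "\<not> ok l \<omega>" using l by (metis le_neq_implies_less nat_less_le)
        moreover have "g l \<omega> \<le> ennreal t"
          using monoD[OF path_sequenceD(3)[OF seq \<omega>] l(1)] i(1) by (rule order_trans)
        moreover have "V' t \<omega> = V (r l \<omega>) \<omega>" using inc' l(4) unfolding if_not_P[OF False] by simp
        ultimately show ?thesis using l(2) by blast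
      qed
    qed
    have nonneg: "0 \<le> V' t \<omega> + e" if "0 \<le> t" "\<omega> \<in> Omega J" for t \<omega>
      using cases[OF that(2,1)]
    proof (elim disjE exE conjE)
      fix l assume l: "g l \<omega> \<le> ennreal t" "\<forall>l'<l. ok l' \<omega>" "V' t \<omega> = V (r l \<omega>) \<omega>"
      show ?thesis using low[OF that(2) le_ennreal_finite[OF l(1)] l(2)] l(3) by simp
    next
      fix i assume i: "g i \<omega> \<le> ennreal t" "ennreal t < g (Suc i) \<omega>" "\<forall>l\<le>i. ok l \<omega>" "V' t \<omega> = V t \<omega>"
      have "g i \<omega> < \<infinity>" by (rule le_ennreal_finite[OF i(1)])
      then have "0 \<le> V (r i \<omega>) \<omega>" using i by (auto simp: ok_def)
      moreover have "\<bar>V t \<omega> - V (r i \<omega>) \<omega>\<bar> \<le> e" using i that by (intro osc) auto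
      ultimately show ?thesis using i by linarith
    qed
    have W: "(\<lambda>t \<omega>. ennreal (V' t \<omega> + e)) \<in> nn_supermartingale J Js"
      using nonneg by (intro nn_supermartingale.simple[OF simple]) auto
    \<comment> \<open>Either trading has stopped, and then at a value of at least 1 - e because V
      has not been negative, or all grid values so far are below 1 - e, and then V cannot have
      exceeded 1.\<close>
    have big: "1 \<le> V' t \<omega> + e"
      if t: "0 \<le> t" and \<omega>: "\<omega> \<in> Omega J" and nn: "\<And>s. s \<in> {0..t} \<Longrightarrow> 0 \<le> V s \<omega>" and s: "s \<in> {0..t}" "1 < V s \<omega>" for t s \<omega>
      using cases[OF \<omega> t]
    proof (elim disjE exE conjE)
      fix l assume l: "g l \<omega> \<le> ennreal t" "\<not> ok l \<omega>" "V' t \<omega> = V (r l \<omega>) \<omega>"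
      then have "g l \<omega> < \<infinity>" by (auto simp: ok_def less_top)
      note r_l = r[OF this]
      then have "ennreal (r l \<omega>) \<le> ennreal t" using l(1) by simp
      then have "r l \<omega> \<in> {0..t}" using r_l(2) t by (simp add: ennreal_le_iff)
      then show ?thesis using l nn by (auto simp: ok_def not_less)
    next
      fix i assume i: "g i \<omega> \<le> ennreal t" "ennreal t < g (Suc i) \<omega>" "\<forall>l\<le>i. ok l \<omega>" "V' t \<omega> = V t \<omega>"
      have st: "ennreal s \<le> ennreal t" using s by (intro ennreal_leI) auto
      then have "ennreal s < g (Suc i) \<omega>" using i(2) le_less_trans by blast
      then obtain k where k: "k < Suc i" "g k \<omega> \<le> ennreal s" "ennreal s < g (Suc k) \<omega>"
        using ex_index[of "\<lambda>i. g i \<omega>" "ennreal s" "Suc i"] path_sequenceD(2)[OF seq \<omega>] by auto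
      have "g k \<omega> < \<infinity>" by (rule le_ennreal_finite[OF k(2)])
      then have "V (r k \<omega>) \<omega> < 1 - e" using i(3) k(1) by (auto simp: ok_def less_Suc_eq_le)
      moreover have "\<bar>V s \<omega> - V (r k \<omega>) \<omega>\<bar> \<le> e" using k s by (intro osc \<omega>) auto
      ultimately show ?thesis using s by linarith
    qed
    show ?thesis
      unfolding maximal_bound_def
    proof (intro bexI[OF _ W] conjI ballI allI impI)
      fix \<omega> assume "\<omega> \<in> Omega J"
      show "ennreal (V' 0 \<omega> + e) \<le> ennreal (c + a + real Js * C * (1/2)^m)"
        using V0 by (simp add: e_def \<delta>_def)
    next
      fix t :: real and \<omega> assume *: "0 \<le> t" "\<omega> \<in> Omega J"
        and **: "(\<forall>s\<in>{0..t}. 0 \<le> K s \<omega> + a) \<and> (\<exists>s\<in>{0..t}. 1 < K s \<omega> + a)"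
      have "V s \<omega> = K s \<omega> + a" if "s \<in> {0..t}" for s
        using K''[of s \<omega>] that *(2) by (simp add: V_def)
      then have "1 \<le> V' t \<omega> + e" using big[OF *] ** by force
      then show "1 \<le> ennreal (V' t \<omega> + e)" by simp
    qed
  qed
qed

text \<open>Where convergence is uniform, \<open>Xs k\<close> + d lies above X for large k, so the
  capitals for the shifted processes eventually reach 1 when they should. Where it fails, d times
  the witness of \<open>conv\<close> is infinite. With d = \<epsilon>/3 the shift and the witness
  together cost less than \<epsilon>. The bound is assumed for all shifts because it is applied to a
  + d.\<close>

lemma maximal_bound_limit:
  assumes conv: "conv J Js Xs X" and b: "\<And>k a. maximal_bound J Js (\<lambda>t \<omega>. Xs k t \<omega> + a) (b k + a)"
    and lim: "b \<longlonglongrightarrow> c" and c: "\<And>\<omega>. \<omega> \<in> Omega J \<Longrightarrow> X 0 \<omega> = c" and "0 < \<epsilon>"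
  shows "maximal_bound J Js (\<lambda>t \<omega>. X t \<omega> + a) (c + a + \<epsilon>)"
proof (cases "c + a < 0")
  case True
  show ?thesis
    unfolding maximal_bound_def
    by (rule bexI[OF _ nn_supermartingale_const[of 0]]) (use True c in \<open>auto dest!: bspec[of _ _ 0]\<close>)
next
  case False
  define d where "d = \<epsilon> / 3"
  have d: "0 < d" using assms by (simp add: d_def)
  obtain W where W: "\<And>k. W k \<in> nn_supermartingale J Js"
    "\<And>k \<omega>. \<omega> \<in> Omega J \<Longrightarrow> W k 0 \<omega> \<le> ennreal (b k + (a + d))"
    "\<And>k t \<omega>. 0 \<le> t \<Longrightarrow> \<omega> \<in> Omega J \<Longrightarrow> \<forall>s\<in>{0..t}. 0 \<le> Xs k s \<omega> + (a + d) \<Longrightarrow>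
        \<exists>s\<in>{0..t}. 1 < Xs k s \<omega> + (a + d) \<Longrightarrow> 1 \<le> W k t \<omega>"
    using b[of _ "a + d"] unfolding maximal_bound_def by metis
  obtain N where N: "N \<in> nn_supermartingale J Js" "\<And>\<omega>. \<omega> \<in> Omega J \<Longrightarrow> N 0 \<omega> = 1"
    "\<And>t \<omega>. 0 \<le> t \<Longrightarrow> \<omega> \<in> Omega J \<Longrightarrow>
      \<not> uniform_limit {0..t} (\<lambda>k s. Xs k s \<omega>) (\<lambda>s. X s \<omega>) sequentially \<Longrightarrow> N t \<omega> = \<infinity>"
    using conv unfolding conv_def quasi_always_def by metis
  obtain N' where N': "N' \<in> nn_supermartingale J Js"
    "\<And>t \<omega>. 0 \<le> t \<Longrightarrow> \<omega> \<in> Omega J \<Longrightarrow> N' t \<omega> = ennreal d * N t \<omega>"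
    using nn_supermartingale_scale[OF N(1), of d] d by auto
  obtain Z where Z: "Z \<in> nn_supermartingale J Js"
    "\<And>t \<omega>. 0 \<le> t \<Longrightarrow> \<omega> \<in> Omega J \<Longrightarrow> Z t \<omega> = liminf (\<lambda>k. W k t \<omega>) + N' t \<omega>"
    using nn_supermartingale_add[OF nn_supermartingale.liminf[of W, OF W(1)] N'(1)] by auto
  show ?thesis
    unfolding maximal_bound_def
  proof (intro bexI[OF _ Z(1)] conjI ballI allI impI)
    fix \<omega> assume \<omega>: "\<omega> \<in> Omega J"
    have "(\<lambda>k. ennreal (b k + (a + d))) \<longlonglongrightarrow> ennreal (c + (a + d))"
      by (intro tendsto_ennrealI tendsto_add lim tendsto_const)
    then have "liminf (\<lambda>k. ennreal (b k + (a + d))) = ennreal (c + (a + d))"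
      by (intro lim_imp_Liminf) auto
    moreover have "liminf (\<lambda>k. W k 0 \<omega>) \<le> liminf (\<lambda>k. ennreal (b k + (a + d)))"
      by (intro Liminf_mono always_eventually allI W(2) \<omega>)
    ultimately have "Z 0 \<omega> \<le> ennreal (c + (a + d)) + ennreal d"
      using Z(2)[of 0 \<omega>] N'(2)[of 0 \<omega>] N(2)[OF \<omega>] \<omega> by (simp add: add_right_mono)
    also have "\<dots> = ennreal (c + (a + d) + d)"
      using False d by (intro ennreal_plus[symmetric]) auto
    also have "\<dots> \<le> ennreal (c + a + \<epsilon>)"
      using assms(5) by (intro ennreal_leI) (simp add: d_def)
    finally show "Z 0 \<omega> \<le> ennreal (c + a + \<epsilon>)" .
  next
    fix t :: real and \<omega> assume *: "0 \<le> t" "\<omega> \<in> Omega J"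
      and X: "(\<forall>s\<in>{0..t}. 0 \<le> X s \<omega> + a) \<and> (\<exists>s\<in>{0..t}. 1 < X s \<omega> + a)"
    show "1 \<le> Z t \<omega>"
    proof (cases "uniform_limit {0..t} (\<lambda>k s. Xs k s \<omega>) (\<lambda>s. X s \<omega>) sequentially")
      case True
      have "\<forall>\<^sub>F k in sequentially. \<forall>s\<in>{0..t}. dist (Xs k s \<omega>) (X s \<omega>) < d"
        using True d by (rule uniform_limitD)
      then have "\<forall>\<^sub>F k in sequentially. 1 \<le> W k t \<omega>"
      proof (rule eventually_mono)
        fix k assume k: "\<forall>s\<in>{0..t}. dist (Xs k s \<omega>) (X s \<omega>) < d"
        have near: "X s \<omega> + a < Xs k s \<omega> + (a + d)" if "s \<in> {0..t}" for s
          using bspec[OF k that] by (simp add: dist_real_def abs_less_iff)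
        show "1 \<le> W k t \<omega>"
        proof (rule W(3)[OF *])
          show "\<forall>s\<in>{0..t}. 0 \<le> Xs k s \<omega> + (a + d)" using near X by (meson order_le_less_trans less_imp_le)
          show "\<exists>s\<in>{0..t}. 1 < Xs k s \<omega> + (a + d)" using near X by (meson less_trans)
        qed
      qed
      then have "1 \<le> liminf (\<lambda>k. W k t \<omega>)" by (rule Liminf_bounded)
      then show ?thesis using Z(2)[OF *] by (simp add: add_increasing2)
    next
      case False
      then show ?thesis using Z(2)[OF *] N'(2)[OF *] N(3)[OF *] d by (simp add: ennreal_mult_top)
    qed
  qed
qed

lemma conv_init:
  assumes "conv J Js Xs X" "\<omega> \<in> Omega J"
  shows "(\<lambda>k. Xs k 0 \<omega>) \<longlonglongrightarrow> X 0 \<omega>"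
  using quasi_always_0[OF assms(1)[unfolded conv_def] assms(2)]
  by (intro tendsto_uniform_limitI[where S = "{0..0}"]) auto

lemma Omega_nonempty: "(\<lambda>_ _. 0) \<in> Omega J"
  by (simp add: Omega_def)

text \<open>Induction over the generation of the class. The oscillation term of the grid bound
  vanishes as m grows, and at a limit the k-th process is given slack 1/(k + 1), so slack does not
  accumulate over repeated limits. All shifts a are carried along because
  \<open>maximal_bound_limit\<close> uses one.\<close>

lemma mart_maximal:
  assumes X: "X \<in> mart J Js" and "Js \<le> J"
  shows "\<exists>c. (\<forall>\<omega>\<in>Omega J. X 0 \<omega> = c) \<and> (\<forall>a. \<forall>\<epsilon>>0. maximal_bound J Js (\<lambda>t \<omega>. X t \<omega> + a) (c + a + \<epsilon>))"
  using X
proof (induction rule: mart.induct)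
  case (base K C X)
  obtain c where c: "\<And>m \<omega>. \<omega> \<in> Omega J \<Longrightarrow> K m 0 \<omega> = c m"
    using grid_class_init[OF base(1)] by metis
  have C: "\<bar>C\<bar> \<ge> 0" by simp
  have K: "K m \<in> grid_class J Js m \<bar>C\<bar>" for m
    by (rule grid_class_mono[OF base(1)]) simp
  have X0: "X 0 \<omega> = lim c" "c \<longlonglongrightarrow> lim c" if "\<omega> \<in> Omega J" for \<omega>
    using conv_init[OF base(2) that] c[OF that] by (auto simp: limI)
  have "c \<longlonglongrightarrow> lim c" by (rule X0(2)[OF Omega_nonempty])
  moreover have "(\<lambda>m. real Js * \<bar>C\<bar> * (1/2)^m) \<longlonglongrightarrow> 0"
    by (intro tendsto_mult_right_zero LIMSEQ_realpow_zero) auto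
  ultimately have lim: "(\<lambda>m. c m + real Js * \<bar>C\<bar> * (1/2)^m) \<longlonglongrightarrow> lim c"
    using tendsto_add by fastforce
  have "maximal_bound J Js (\<lambda>t \<omega>. K m t \<omega> + a) (c m + real Js * \<bar>C\<bar> * (1/2)^m + a)" for m a
    using maximal_bound_grid_class[OF K assms(2) c C, of m a] by (simp add: algebra_simps)
  then show ?case
    using X0(1) maximal_bound_limit[OF base(2) _ lim X0(1)] by blast
next
  case (limit Xs X)
  then obtain c where c: "\<And>k \<omega>. \<omega> \<in> Omega J \<Longrightarrow> Xs k 0 \<omega> = c k"
    "\<And>k a \<epsilon>. 0 < \<epsilon> \<Longrightarrow> maximal_bound J Js (\<lambda>t \<omega>. Xs k t \<omega> + a) (c k + a + \<epsilon>)" by metis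
  have X0: "X 0 \<omega> = lim c" "c \<longlonglongrightarrow> lim c" if "\<omega> \<in> Omega J" for \<omega>
    using conv_init[OF limit(2) that] c(1)[OF that] by (auto simp: limI)
  have "c \<longlonglongrightarrow> lim c" by (rule X0(2)[OF Omega_nonempty])
  moreover have "(\<lambda>k. 1 / real (Suc k)) \<longlonglongrightarrow> 0" by (rule LIMSEQ_Suc[OF lim_1_over_n])
  ultimately have lim: "(\<lambda>k. c k + 1 / real (Suc k)) \<longlonglongrightarrow> lim c"
    using tendsto_add by fastforce
  have "maximal_bound J Js (\<lambda>t \<omega>. Xs k t \<omega> + a) (c k + 1 / real (Suc k) + a)" for k a
    using c(2)[of "1 / real (Suc k)" k a] by (simp add: algebra_simps)
  then show ?case
    using X0(1) maximal_bound_limit[OF limit(2) _ lim X0(1)] by blast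
qed

subsection \<open>Stochastic integrals of martingales\<close>

lemma conv_mono:
  assumes "conv J Js Xs X"
    and "\<And>t \<omega>. 0 \<le> t \<Longrightarrow> \<omega> \<in> Omega J \<Longrightarrow> uniform_limit {0..t} (\<lambda>k s. Xs k s \<omega>) (\<lambda>s. X s \<omega>) sequentially \<Longrightarrow>
      uniform_limit {0..t} (\<lambda>k s. Ys k s \<omega>) (\<lambda>s. Y s \<omega>) sequentially"
  shows "conv J Js Ys Y"
  using assms unfolding conv_def by (rule quasi_always_mono)

lemma conv_eventually_eq:
  assumes "quasi_always J Js (\<lambda>t \<omega>. \<exists>N. \<forall>n\<ge>N. \<forall>s\<in>{0..t}. Xs n s \<omega> = X s \<omega>)"
  shows "conv J Js Xs X"
  unfolding conv_def
proof (rule quasi_always_mono[OF assms])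
  fix t :: real and \<omega> assume "\<exists>N. \<forall>n\<ge>N. \<forall>s\<in>{0..t}. Xs n s \<omega> = X s \<omega>"
  then have "\<forall>\<^sub>F n in sequentially. \<forall>s\<in>{0..t}. Xs n s \<omega> = X s \<omega>"
    by (simp add: eventually_sequentially)
  then show "uniform_limit {0..t} (\<lambda>k s. Xs k s \<omega>) (\<lambda>s. X s \<omega>) sequentially"
    by (auto intro!: uniform_limitI elim!: eventually_mono)
qed

lemma conv_uniform_bound:
  assumes "\<And>k t \<omega>. 0 \<le> t \<Longrightarrow> \<omega> \<in> Omega J \<Longrightarrow> \<bar>Xs k t \<omega> - X t \<omega>\<bar> \<le> e k" and e: "e \<longlonglongrightarrow> 0"
  shows "conv J Js Xs X"
  unfolding conv_def
proof (rule quasi_always_mono[OF quasi_always_True])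
  fix t :: real and \<omega> assume \<omega>: "\<omega> \<in> Omega J"
  show "uniform_limit {0..t} (\<lambda>k s. Xs k s \<omega>) (\<lambda>s. X s \<omega>) sequentially"
  proof (rule uniform_limitI)
    fix r :: real assume "0 < r"
    then have "\<forall>\<^sub>F k in sequentially. e k < r" using e by (simp add: order_tendstoD)
    then show "\<forall>\<^sub>F k in sequentially. \<forall>s\<in>{0..t}. dist (Xs k s \<omega>) (X s \<omega>) < r"
    proof (rule eventually_mono)
      fix k assume "e k < r"
      then show "\<forall>s\<in>{0..t}. dist (Xs k s \<omega>) (X s \<omega>) < r"
        by (auto simp: dist_real_def intro: le_less_trans[OF assms(1)[OF _ \<omega>]])
    qed
  qed
qed

lemma mart_cong:
  assumes "X \<in> mart J Js" "\<And>t \<omega>. 0 \<le> t \<Longrightarrow> \<omega> \<in> Omega J \<Longrightarrow> X t \<omega> = Y t \<omega>"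
  shows "Y \<in> mart J Js"
  by (rule mart.limit[of "\<lambda>_. X"]) (use assms in \<open>auto intro!: conv_uniform_bound[where e = "\<lambda>_. 0"]\<close>)

lemma gains_fin:
  assumes "0 \<le> t" "mono (\<lambda>n. T n \<omega>)" "ennreal t \<le> T N \<omega>"
  shows "gains Js T h t \<omega> =
    (\<Sum>j<Js. \<Sum>k<N. h k \<omega> j * (\<omega> j (cut (T (Suc k) \<omega>) t) - \<omega> j (cut (T k \<omega>) t)))"
  unfolding gains_def gsum_fin[OF assms] by (rule refl)

lemma grid_class_const: "(\<lambda>t \<omega>. c) \<in> grid_class J Js m 0"
  by (rule grid_classI[where H = "\<lambda>_ _ _. 0" and c = c])
     (auto simp: tau_measurable_def gains_def gsum_def)

lemma mart_const: "(\<lambda>t \<omega>. c) \<in> mart J Js"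
  by (rule mart.base[of "\<lambda>_ _ _. c"]) (auto intro!: grid_class_const conv_uniform_bound[where e = "\<lambda>_. 0"])

lemma grid_class_add:
  assumes "K \<in> grid_class J Js m C" "L \<in> grid_class J Js m C'"
  shows "(\<lambda>t \<omega>. K t \<omega> + L t \<omega>) \<in> grid_class J Js m (C + C')"
proof (rule grid_classE[OF assms(1)], rule grid_classE[OF assms(2)])
  fix c H c' H'
  let ?g = "grid J ((1/2)^m)"
  assume H: "\<And>k. tau_measurable J (?g k) (H k)" "\<And>k \<omega> j. \<omega> \<in> Omega J \<Longrightarrow> j < Js \<Longrightarrow> \<bar>H k \<omega> j\<bar> \<le> C"
    "\<And>t \<omega>. 0 \<le> t \<Longrightarrow> \<omega> \<in> Omega J \<Longrightarrow> K t \<omega> = c + gains Js ?g H t \<omega>"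
  assume H': "\<And>k. tau_measurable J (?g k) (H' k)" "\<And>k \<omega> j. \<omega> \<in> Omega J \<Longrightarrow> j < Js \<Longrightarrow> \<bar>H' k \<omega> j\<bar> \<le> C'"
    "\<And>t \<omega>. 0 \<le> t \<Longrightarrow> \<omega> \<in> Omega J \<Longrightarrow> L t \<omega> = c' + gains Js ?g H' t \<omega>"
  show ?thesis
  proof (rule grid_classI[where H = "\<lambda>k \<omega> j. H k \<omega> j + H' k \<omega> j" and c = "c + c'"])
    show "tau_measurable J (?g k) (\<lambda>\<omega> j. H k \<omega> j + H' k \<omega> j)" for k
      using H(1)[of k] H'(1)[of k] unfolding tau_measurable_def by (metis (no_types))
    show "\<bar>H k \<omega> j + H' k \<omega> j\<bar> \<le> C + C'" if "\<omega> \<in> Omega J" "j < Js" for k \<omega> j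
      using H(2)[OF that, of k] H'(2)[OF that, of k] by linarith
    fix t :: real and \<omega> assume *: "0 \<le> t" "\<omega> \<in> Omega J"
    obtain N where "ennreal t < ?g N \<omega>" using grid_unbounded[OF *(2) _ *(1), of "(1/2)^m"] by auto
    then have N: "ennreal t \<le> ?g N \<omega>" by simp
    have "gains Js ?g H t \<omega> + gains Js ?g H' t \<omega> = gains Js ?g (\<lambda>k \<omega> j. H k \<omega> j + H' k \<omega> j) t \<omega>"
      unfolding gains_fin[where N = N and T = "?g", OF *(1) mono_grid[OF *(2)] N]
      by (simp add: algebra_simps flip: sum.distrib)
    then show "K t \<omega> + L t \<omega> = c + c' + gains Js ?g (\<lambda>k \<omega> j. H k \<omega> j + H' k \<omega> j) t \<omega>"
      using H(3)[OF *] H'(3)[OF *] by simp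
  qed
qed

text \<open>As for supermartingales, limits are taken in one summand at a time. When both summands
  come from the base rule, their m-th approximations trade on the same grid, so positions simply
  add.\<close>

lemma mart_add:
  assumes X: "X \<in> mart J Js" and Y: "Y \<in> mart J Js"
  shows "(\<lambda>t \<omega>. X t \<omega> + Y t \<omega>) \<in> mart J Js"
  using X
proof (induction rule: mart.induct)
  case (base K C X)
  from Y show ?case
  proof (induction rule: mart.induct)
    case L: (base L C' Y)
    have "conv J Js (\<lambda>m t \<omega>. K m t \<omega> + L m t \<omega>) (\<lambda>t \<omega>. X t \<omega> + Y t \<omega>)"
      unfolding conv_def
      by (rule quasi_always_mono[OF quasi_always_conj[OF base(2)[unfolded conv_def] L(2)[unfolded conv_def]]])
         (auto intro: uniform_limit_add)
    then show ?case
      by (rule mart.base[rotated]) (rule grid_class_add[OF base(1) L(1)])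
  next
    case (limit Ys Y)
    have "conv J Js (\<lambda>m t \<omega>. X t \<omega> + Ys m t \<omega>) (\<lambda>t \<omega>. X t \<omega> + Y t \<omega>)"
      by (rule conv_mono[OF limit(2)]) (auto intro: uniform_limit_add uniform_limit_const)
    then show ?case
      by (rule mart.limit[rotated]) (rule limit(3))
  qed
next
  case (limit Xs X)
  have "conv J Js (\<lambda>m t \<omega>. Xs m t \<omega> + Y t \<omega>) (\<lambda>t \<omega>. X t \<omega> + Y t \<omega>)"
    by (rule conv_mono[OF limit(2)]) (auto intro: uniform_limit_add uniform_limit_const)
  then show ?case
    by (rule mart.limit[rotated]) (rule limit(3))
qed

lemma mart_sum:
  assumes "\<And>i. i \<in> A \<Longrightarrow> X i \<in> mart J Js"
  shows "(\<lambda>t \<omega>. \<Sum>i\<in>A. X i t \<omega>) \<in> mart J Js"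
  using assms by (induction A rule: infinite_finite_induct) (auto intro: mart_const mart_add)

text \<open>Quasi-always the partial sums are eventually constant on [0, t]; \<open>conv\<close>
  accepts this even though the index from which they are constant varies with the path.\<close>

lemma mart_locally_finite_sum:
  fixes Y :: "nat \<Rightarrow> real \<Rightarrow> path \<Rightarrow> real"
  assumes "\<And>k. Y k \<in> mart J Js"
    and "quasi_always J Js (\<lambda>t \<omega>. \<exists>N. \<forall>n\<ge>N. \<forall>s\<in>{0..t}. (\<Sum>k<n. Y k s \<omega>) = X s \<omega>)"
  shows "X \<in> mart J Js"
proof (rule mart.limit)
  show "(\<lambda>t \<omega>. \<Sum>k<n. Y k t \<omega>) \<in> mart J Js" for n by (rule mart_sum) (rule assms(1))
  show "conv J Js (\<lambda>n t \<omega>. \<Sum>k<n. Y k t \<omega>) X" by (rule conv_eventually_eq) (rule assms(2))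
qed

section \<open>Positions held from a path-dependent time on\<close>

definition after :: "(path \<Rightarrow> ennreal) \<Rightarrow> (path \<Rightarrow> real) \<Rightarrow> (real \<Rightarrow> path \<Rightarrow> real) \<Rightarrow> real \<Rightarrow> path \<Rightarrow> real" where
  "after \<sigma> h X t \<omega> = h \<omega> * (X t \<omega> - X (cut (\<sigma> \<omega>) t) \<omega>)"

text \<open>Buying at s is postponed to the first grid time not before s. Both times lie in one grid
  step, so both prices are within \<delta> of the price at the start of that step. In this way times
  that are not measurable are reduced to grid times.\<close>

lemma grid_sample_error:
  fixes \<omega> :: path and s :: ennreal and a :: real
  assumes \<omega>: "\<omega> \<in> Omega J" and j: "j < J" and \<delta>: "0 < \<delta>" and t: "0 \<le> t"
  defines "H \<equiv> (\<lambda>k. if s \<le> grid J \<delta> k \<omega> then a else 0)"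
  shows "\<bar>gsum H (\<omega> j) (\<lambda>k. grid J \<delta> k \<omega>) t - a * (\<omega> j t - \<omega> j (cut s t))\<bar> \<le> \<bar>a\<bar> * (2 * \<delta>)"
proof -
  define g where "g = (\<lambda>k. grid J \<delta> k \<omega>)"
  have g: "mono g" "g 0 = 0" unfolding g_def using mono_grid[OF \<omega>] by auto
  obtain N where "ennreal t < g N" using grid_unbounded[OF \<omega> \<delta> t] by (auto simp: g_def)
  then have N: "ennreal t \<le> g N" by simp
  show ?thesis
  proof (cases "\<exists>k. s \<le> g k")
    case False
    have "s = \<infinity>"
    proof (rule ccontr)
      assume "s \<noteq> \<infinity>"
      then obtain r where "s = ennreal r" "0 \<le> r" by (cases s) auto
      then show False using grid_unbounded[OF \<omega> \<delta>, of r] False by (auto simp: g_def dest: less_imp_le)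
    qed
    moreover have "H = (\<lambda>_. 0)" using False by (auto simp: H_def g_def)
    ultimately show ?thesis using \<delta> by (simp add: gsum_def cut_def top_unique)
  next
    case True
    define k0 where "k0 = (LEAST k. s \<le> g k)"
    have k0: "s \<le> g k0" unfolding k0_def using True by (metis LeastI)
    have k0_iff: "s \<le> g k \<longleftrightarrow> k0 \<le> k" for k
    proof
      show "s \<le> g k \<Longrightarrow> k0 \<le> k" unfolding k0_def by (rule Least_le)
      show "k0 \<le> k \<Longrightarrow> s \<le> g k" using k0 monoD[OF g(1)] order_trans by blast
    qed
    \<comment> \<open>The gain of the postponed purchase; its increments along the grid are the
      terms of \<open>gsum\<close>, which thus telescopes.\<close>
    define \<phi> where "\<phi> u = a * (\<omega> j u - \<omega> j (cut (g k0) u))" for u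
    have step: "\<phi> (cut (g (Suc k)) t) - \<phi> (cut (g k) t) =
        H k * (\<omega> j (cut (g (Suc k)) t) - \<omega> j (cut (g k) t))" for k
    proof (cases "k0 \<le> k")
      case True
      then have "g k0 \<le> g k" "g k0 \<le> g (Suc k)" using g(1) by (auto simp: mono_def)
      then show ?thesis using k0_iff[of k] True
        by (simp add: \<phi>_def H_def cut_cut t min_absorb1 algebra_simps flip: g_def) (simp add: g_def algebra_simps)
    next
      case False
      then have "g k \<le> g k0" "g (Suc k) \<le> g k0" using g(1) by (auto simp: mono_def)
      moreover have "H k = 0" using k0_iff[of k] False by (simp add: H_def g_def)
      ultimately show ?thesis by (simp add: \<phi>_def cut_cut t min_absorb2)
    qed
    have "gsum H (\<omega> j) g t = \<phi> t - \<phi> 0"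
      unfolding gsum_fin[OF t g(1) N] step[symmetric] by (rule telescope_cut[OF t g(2) N])
    then have eq: "gsum H (\<omega> j) g t - a * (\<omega> j t - \<omega> j (cut s t)) = a * (\<omega> j (cut s t) - \<omega> j (cut (g k0) t))"
      by (simp add: \<phi>_def algebra_simps)
    have "\<bar>\<omega> j (cut s t) - \<omega> j (cut (g k0) t)\<bar> \<le> 2 * \<delta>"
    proof (cases "s \<le> ennreal t \<and> k0 \<noteq> 0")
      case True
      then obtain k where k: "k0 = Suc k" by (cases k0) auto
      then have less: "g k < s" using k0_iff[of k] by (simp add: not_le[symmetric])
      have le: "g k \<le> g k0" using g(1) by (simp add: k mono_def)
      have b: "\<bar>\<omega> j (cut b t) - \<omega> j (enn2real (g k))\<bar> \<le> \<delta>" if "g k \<le> b" "b \<le> g k0" for b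
      proof -
        have "g k \<le> ennreal (cut b t)" "ennreal (cut b t) \<le> g (Suc k)"
          using that True less t k by (auto simp: ennreal_cut min.coboundedI1)
        then show ?thesis
          using grid_osc[OF \<omega> j _ cut_nonneg[OF t], of \<delta> k b] \<delta> by (simp add: g_def)
      qed
      from b[of s] b[of "g k0"] less le k0 show ?thesis by (simp add: less_imp_le)
    next
      case False
      then have "cut s t = cut (g k0) t"
      proof (cases "k0 = 0")
        case True
        then have "s = g k0" using k0 g(2) by auto
        then show ?thesis by simp
      next
        case k0': False
        then have "ennreal t \<le> s" using False by auto
        then show ?thesis using k0 t cut_eq order_trans by metis
      qed
      then show ?thesis using \<delta> by simp
    qed
    then show ?thesis unfolding eq[unfolded g_def] abs_mult by (intro mult_left_mono) (auto simp: g_def)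
  qed
qed

text \<open>The position changes only at grid times, at which it is known whether \<sigma> has
  passed and, if so, what h is. So \<sigma> and h may fail to be measurable in \<omega>. The error
  of the m-th approximation is at most 2 * C * 2^(-m), uniformly in time and path.\<close>

lemma mart_after_coordinate_bounded:
  assumes j: "j < Js" "Js \<le> J" and \<sigma>: "path_stopping J \<sigma>" and h: "tau_measurable J \<sigma> h"
    and C: "\<And>\<omega>. \<omega> \<in> Omega J \<Longrightarrow> \<bar>h \<omega>\<bar> \<le> C"
  shows "after \<sigma> h (\<lambda>t \<omega>. \<omega> j t) \<in> mart J Js"
proof -
  define H where "H m k \<omega> i = (if i = j \<and> \<sigma> \<omega> \<le> grid J ((1/2)^m) k \<omega> then h \<omega> else 0)" for m k \<omega> i
  define K where "K m = gains Js (grid J ((1/2)^m)) (H m)" for m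
  have C0: "0 \<le> C" using C[OF Omega_nonempty] by linarith
  have K: "K m t \<omega> = gsum (\<lambda>k. if \<sigma> \<omega> \<le> grid J ((1/2)^m) k \<omega> then h \<omega> else 0) (\<omega> j) (\<lambda>k. grid J ((1/2)^m) k \<omega>) t"
    for m t \<omega>
  proof -
    have "K m t \<omega> = (\<Sum>i<Js. if i = j then gsum (\<lambda>k. if \<sigma> \<omega> \<le> grid J ((1/2)^m) k \<omega> then h \<omega> else 0) (\<omega> j) (\<lambda>k. grid J ((1/2)^m) k \<omega>) t else 0)"
      unfolding K_def gains_def by (intro sum.cong refl) (auto simp: H_def gsum_def)
    then show ?thesis using j(1) by simp
  qed
  show ?thesis
  proof (rule mart.base[of K J Js C])
    fix m
    show "K m \<in> grid_class J Js m C"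
    proof (rule grid_classI[where H = "H m" and c = 0])
      fix k
      show "tau_measurable J (grid J ((1/2)^m) k) (H m k)"
        unfolding tau_measurable_def
      proof (intro ballI impI)
        fix \<omega> \<omega>' assume *: "\<omega> \<in> Omega J" "\<omega>' \<in> Omega J" "agree_upto J \<omega> \<omega>' (grid J ((1/2)^m) k \<omega>)"
        have g: "grid J ((1/2)^m) k \<omega>' = grid J ((1/2)^m) k \<omega>"
          by (rule path_stoppingD[OF path_stopping_grid * order_refl])
        have iff: "\<sigma> \<omega> \<le> grid J ((1/2)^m) k \<omega> \<longleftrightarrow> \<sigma> \<omega>' \<le> grid J ((1/2)^m) k \<omega>"
          by (rule path_stopping_le_iff[OF \<sigma> *])
        moreover have "h \<omega> = h \<omega>'" if "\<sigma> \<omega> \<le> grid J ((1/2)^m) k \<omega>"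
          using h * agree_mono[OF *(3) that] by (simp add: tau_measurable_def)
        ultimately show "H m k \<omega> = H m k \<omega>'" using g by (auto simp: H_def fun_eq_iff)
      qed
    qed (use C C0 in \<open>auto simp: H_def K_def\<close>)
  next
    have "(\<lambda>m. C * (2 * (1/2)^m)) \<longlonglongrightarrow> 0"
      by (intro tendsto_mult_right_zero LIMSEQ_realpow_zero) auto
    moreover have "\<bar>K m t \<omega> - after \<sigma> h (\<lambda>t \<omega>. \<omega> j t) t \<omega>\<bar> \<le> C * (2 * (1/2)^m)"
      if "0 \<le> t" "\<omega> \<in> Omega J" for m t \<omega>
    proof -
      have "\<bar>K m t \<omega> - after \<sigma> h (\<lambda>t \<omega>. \<omega> j t) t \<omega>\<bar> \<le> \<bar>h \<omega>\<bar> * (2 * (1/2)^m)"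
        unfolding K after_def using that j by (intro grid_sample_error) auto
      also have "\<dots> \<le> C * (2 * (1/2)^m)" using C[OF that(2)] by (intro mult_right_mono) auto
      finally show ?thesis .
    qed
    ultimately show "conv J Js K (after \<sigma> h (\<lambda>t \<omega>. \<omega> j t))" by (rule conv_uniform_bound[rotated])
  qed
qed

lemma tau_measurable_comp:
  "tau_measurable J \<sigma> h \<Longrightarrow> tau_measurable J \<sigma> (\<lambda>\<omega>. f (h \<omega>))"
  unfolding tau_measurable_def by metis

lemma tau_measurable_comp2:
  "tau_measurable J \<sigma> h \<Longrightarrow> tau_measurable J \<sigma> h' \<Longrightarrow> tau_measurable J \<sigma> (\<lambda>\<omega>. f (h \<omega>) (h' \<omega>))"
  unfolding tau_measurable_def by metis

lemma tau_measurable_le: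
  assumes "tau_measurable J \<sigma> h" "\<And>\<omega>. \<omega> \<in> Omega J \<Longrightarrow> \<sigma> \<omega> \<le> \<tau> \<omega>"
  shows "tau_measurable J \<tau> h"
  using assms agree_mono unfolding tau_measurable_def by blast

text \<open>Truncating h at n has no effect along a given path once n is large, and
  \<open>conv\<close> tolerates a rate that depends on the path.\<close>

lemma mart_after_coordinate:
  assumes j: "j < Js" "Js \<le> J" and \<sigma>: "path_stopping J \<sigma>" and h: "tau_measurable J \<sigma> h"
  shows "after \<sigma> h (\<lambda>t \<omega>. \<omega> j t) \<in> mart J Js"
proof (rule mart.limit)
  fix n :: nat
  show "after \<sigma> (\<lambda>\<omega>. max (- real n) (min (real n) (h \<omega>))) (\<lambda>t \<omega>. \<omega> j t) \<in> mart J Js"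
    by (rule mart_after_coordinate_bounded[OF j \<sigma> tau_measurable_comp[OF h], where C = "real n"]) auto
next
  show "conv J Js (\<lambda>n. after \<sigma> (\<lambda>\<omega>. max (- real n) (min (real n) (h \<omega>))) (\<lambda>t \<omega>. \<omega> j t))
     (after \<sigma> h (\<lambda>t \<omega>. \<omega> j t))"
  proof (intro conv_eventually_eq quasi_always_mono[OF quasi_always_True])
    fix t :: real and \<omega>
    obtain N :: nat where "\<bar>h \<omega>\<bar> \<le> real N" using real_arch_simple by blast
    then have "max (- real n) (min (real n) (h \<omega>)) = h \<omega>" if "N \<le> n" for n
      using that by (auto simp: abs_le_iff)
    then show "\<exists>N. \<forall>n\<ge>N. \<forall>s\<in>{0..t}. after \<sigma> (\<lambda>\<omega>. max (- real n) (min (real n) (h \<omega>))) (\<lambda>t \<omega>. \<omega> j t) s \<omega>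
        = after \<sigma> h (\<lambda>t \<omega>. \<omega> j t) s \<omega>"
      by (intro exI[of _ N]) (simp add: after_def)
  qed
qed

lemma mart_after_diff:
  assumes 1: "after \<sigma> h X \<in> mart J Js" and 2: "after \<tau> (\<lambda>\<omega>. - h \<omega>) X \<in> mart J Js"
  shows "(\<lambda>t \<omega>. h \<omega> * (X (cut (\<tau> \<omega>) t) \<omega> - X (cut (\<sigma> \<omega>) t) \<omega>)) \<in> mart J Js"
  by (rule mart_cong[OF mart_add[OF 1 2]]) (simp add: after_def algebra_simps)

lemma cut_Icc: "s \<in> {0..t} \<Longrightarrow> cut a s \<in> {0..t}"
  by (auto intro: order_trans[OF cut_le])

lemma conv_after:
  assumes "conv J Js Xs X"
  shows "conv J Js (\<lambda>k. after \<sigma> h (Xs k)) (after \<sigma> h X)"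
proof (rule conv_mono[OF assms])
  fix t :: real and \<omega> assume u: "uniform_limit {0..t} (\<lambda>k s. Xs k s \<omega>) (\<lambda>s. X s \<omega>) sequentially"
  have "uniform_limit {0..t} (\<lambda>k s. Xs k (cut (\<sigma> \<omega>) s) \<omega>) (\<lambda>s. X (cut (\<sigma> \<omega>) s) \<omega>) sequentially"
  proof (rule uniform_limit_compose'[OF u])
    show "cut (\<sigma> \<omega>) \<in> {0..t} \<rightarrow> {0..t}" by (rule funcsetI) (rule cut_Icc)
  qed
  then have "uniform_limit {0..t} (\<lambda>k s. Xs k s \<omega> - Xs k (cut (\<sigma> \<omega>) s) \<omega>)
      (\<lambda>s. X s \<omega> - X (cut (\<sigma> \<omega>) s) \<omega>) sequentially"
    using u by (intro uniform_limit_minus)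
  then show "uniform_limit {0..t} (\<lambda>k s. after \<sigma> h (Xs k) s \<omega>) (\<lambda>s. after \<sigma> h X s \<omega>) sequentially"
    unfolding after_def by (rule bounded_linear.uniform_limit[OF bounded_linear_mult_right])
qed

text \<open>K is a locally finite sum of positions held over grid steps, and starting at \<sigma>
  replaces every grid time by its maximum with \<sigma>. The weight h * H k is known at both ends of
  the modified step, so \<open>mart_after_diff\<close> applies to each security.\<close>

lemma mart_after_grid_class:
  assumes K: "K \<in> grid_class J Js m C" and Js: "Js \<le> J" and \<sigma>: "path_stopping J \<sigma>" and h: "tau_measurable J \<sigma> h"
  shows "after \<sigma> h K \<in> mart J Js"
proof (rule grid_classE[OF K])
  fix c H
  let ?g = "grid J ((1/2)^m)"
  assume H: "\<And>k. tau_measurable J (?g k) (H k)" "\<And>k \<omega> j. \<omega> \<in> Omega J \<Longrightarrow> j < Js \<Longrightarrow> \<bar>H k \<omega> j\<bar> \<le> C"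
    "\<And>t \<omega>. 0 \<le> t \<Longrightarrow> \<omega> \<in> Omega J \<Longrightarrow> K t \<omega> = c + gains Js ?g H t \<omega>"
  define M where "M l \<omega> = max (?g l \<omega>) (\<sigma> \<omega>)" for l \<omega>
  have M: "path_stopping J (M l)" for l
    unfolding M_def by (rule path_stopping_max[OF path_stopping_grid \<sigma>])
  define Y where "Y k t \<omega> = (\<Sum>j<Js. h \<omega> * H k \<omega> j * (\<omega> j (cut (M (Suc k) \<omega>) t) - \<omega> j (cut (M k \<omega>) t)))"
    for k t \<omega>
  show ?thesis
  proof (rule mart_locally_finite_sum)
    fix k
    have tm: "tau_measurable J (M l) (\<lambda>\<omega>. h \<omega> * H k \<omega> j)" if "k \<le> l" for j l
    proof (rule tau_measurable_comp2[where f = "\<lambda>x y. x * y"])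
      show "tau_measurable J (M l) h" by (rule tau_measurable_le[OF h]) (simp add: M_def)
      show "tau_measurable J (M l) (\<lambda>\<omega>. H k \<omega> j)"
        by (rule tau_measurable_comp[OF tau_measurable_le[OF H(1)], where f = "\<lambda>f. f j"])
           (use monoD[OF mono_grid that] in \<open>auto simp: M_def le_max_iff_disj\<close>)
    qed
    show "Y k \<in> mart J Js"
      unfolding Y_def[abs_def]
    proof (rule mart_sum)
      fix j assume "j \<in> {..<Js}"
      then have j: "j < Js" by simp
      show "(\<lambda>t \<omega>. h \<omega> * H k \<omega> j * (\<omega> j (cut (M (Suc k) \<omega>) t) - \<omega> j (cut (M k \<omega>) t))) \<in> mart J Js"
        by (rule mart_after_diff; rule mart_after_coordinate[OF j Js M])
           (use tm[of k j] tau_measurable_comp[OF tm[of "Suc k" j], of uminus] in auto)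
    qed
  next
    show "quasi_always J Js (\<lambda>t \<omega>. \<exists>N. \<forall>n\<ge>N. \<forall>s\<in>{0..t}. (\<Sum>k<n. Y k s \<omega>) = after \<sigma> h K s \<omega>)"
    proof (rule quasi_always_mono[OF quasi_always_True])
      fix t :: real and \<omega> assume *: "0 \<le> t" "\<omega> \<in> Omega J"
      obtain N where N: "ennreal t < ?g N \<omega>" using grid_unbounded[OF *(2) _ *(1), of "(1/2)^m"] by auto
      have "(\<Sum>k<n. Y k s \<omega>) = after \<sigma> h K s \<omega>" if n: "N \<le> n" and s: "s \<in> {0..t}" for n s
      proof -
        have s0: "0 \<le> s" and "s \<le> t" using s by auto
        have "ennreal s \<le> ennreal t" using \<open>s \<le> t\<close> by (rule ennreal_leI)
        also have "\<dots> \<le> ?g N \<omega>" using N by simp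
        also have "\<dots> \<le> ?g n \<omega>" using monoD[OF mono_grid[OF *(2)] n] .
        finally have sn: "ennreal s \<le> ?g n \<omega>" .
        let ?r = "cut (\<sigma> \<omega>) s"
        have r: "0 \<le> ?r" "ennreal ?r \<le> ?g n \<omega>"
          using s0 sn by (auto simp: ennreal_cut min.coboundedI2)
        \<comment> \<open>Inclusion-exclusion for the maximum and the minimum of the grid time and
          \<sigma>, all cut at s.\<close>
        have M_cut: "x (cut (M l \<omega>) s) = x (cut (?g l \<omega>) s) + (x ?r - x (cut (?g l \<omega>) ?r))"
          for l and x :: "real \<Rightarrow> real"
        proof (cases "?g l \<omega> \<le> \<sigma> \<omega>")
          case True
          then show ?thesis by (simp add: M_def max_absorb2 cut_cut s0 min_absorb1)
        next
          case False
          then show ?thesis by (simp add: M_def max_absorb1 cut_cut s0 min_absorb2)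
        qed
        have term_eq: "H k \<omega> j * (\<omega> j (cut (?g (Suc k) \<omega>) s) - \<omega> j (cut (?g k \<omega>) s)) -
            H k \<omega> j * (\<omega> j (cut (?g (Suc k) \<omega>) ?r) - \<omega> j (cut (?g k \<omega>) ?r)) =
            H k \<omega> j * (\<omega> j (cut (M (Suc k) \<omega>) s) - \<omega> j (cut (M k \<omega>) s))" for k j
          unfolding M_cut[of "\<omega> j"] by (simp only: algebra_simps)
        have "after \<sigma> h K s \<omega> = h \<omega> * (gains Js ?g H s \<omega> - gains Js ?g H ?r \<omega>)"
          unfolding after_def H(3)[OF s0 *(2)] H(3)[OF r(1) *(2)] by (simp only: add_diff_cancel_left)
        also have "\<dots> = h \<omega> * (\<Sum>j<Js. \<Sum>k<n. H k \<omega> j * (\<omega> j (cut (M (Suc k) \<omega>) s) - \<omega> j (cut (M k \<omega>) s)))"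
          unfolding gains_fin[where T = "?g", OF s0 mono_grid[OF *(2)] sn]
            gains_fin[where T = "?g", OF r(1) mono_grid[OF *(2)] r(2)] sum_subtractf[symmetric] term_eq
          by (rule refl)
        also have "\<dots> = (\<Sum>k<n. Y k s \<omega>)"
          unfolding Y_def by (subst sum.swap) (simp only: sum_distrib_left mult.assoc)
        finally show ?thesis by simp
      qed
      then show "\<exists>N. \<forall>n\<ge>N. \<forall>s\<in>{0..t}. (\<Sum>k<n. Y k s \<omega>) = after \<sigma> h K s \<omega>" by blast
    qed
  qed
qed

lemma mart_after:
  assumes X: "X \<in> mart J Js" and Js: "Js \<le> J" and \<sigma>: "path_stopping J \<sigma>" and h: "tau_measurable J \<sigma> h"
  shows "after \<sigma> h X \<in> mart J Js"
  using X
proof (induction rule: mart.induct)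
  case (base K C X)
  show ?case
    by (rule mart.limit[OF mart_after_grid_class[OF base(1) Js \<sigma> h] conv_after[OF base(2)]])
next
  case (limit Xs X)
  show ?case by (rule mart.limit[OF limit(3) conv_after[OF limit(2)]])
qed

text \<open>Each term is a position opened at \<open>T k\<close> and closed at
  \<open>T (Suc k)\<close>, and quasi-always only finitely many terms matter up to t. The weights
  may be unbounded, since truncation was absorbed in \<open>mart_after_coordinate\<close>.\<close>

lemma mart_gsum:
  assumes X: "X \<in> mart J Js" and Js: "Js \<le> J" and T: "path_sequence J T"
    and ex: "quasi_always J Js (\<lambda>t \<omega>. \<exists>N. ennreal t < T N \<omega>)"
    and h: "\<And>k. tau_measurable J (T k) (h k)"
  shows "(\<lambda>t \<omega>. gsum (\<lambda>k. h k \<omega>) (\<lambda>s. X s \<omega>) (\<lambda>k. T k \<omega>) t) \<in> mart J Js"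
proof (rule mart_locally_finite_sum)
  fix k
  have le: "T k \<omega> \<le> T (Suc k) \<omega>" if "\<omega> \<in> Omega J" for \<omega>
    using monoD[OF path_sequenceD(3)[OF T that], of k "Suc k"] by simp
  show "(\<lambda>t \<omega>. h k \<omega> * (X (cut (T (Suc k) \<omega>) t) \<omega> - X (cut (T k \<omega>) t) \<omega>)) \<in> mart J Js"
    by (rule mart_after_diff; rule mart_after[OF X Js path_sequenceD(1)[OF T]])
       (use h[of k] tau_measurable_comp[OF tau_measurable_le[OF h[of k] le], of uminus] in auto)
next
  show "quasi_always J Js (\<lambda>t \<omega>. \<exists>N. \<forall>n\<ge>N. \<forall>s\<in>{0..t}.
     (\<Sum>k<n. h k \<omega> * (X (cut (T (Suc k) \<omega>) s) \<omega> - X (cut (T k \<omega>) s) \<omega>)) =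
     gsum (\<lambda>k. h k \<omega>) (\<lambda>s. X s \<omega>) (\<lambda>k. T k \<omega>) s)"
  proof (rule quasi_always_mono[OF ex])
    fix t :: real and \<omega> assume *: "0 \<le> t" "\<omega> \<in> Omega J" "\<exists>N. ennreal t < T N \<omega>"
    then obtain N where N: "ennreal t < T N \<omega>" by blast
    have m: "mono (\<lambda>k. T k \<omega>)" by (rule path_sequenceD(3)[OF T *(2)])
    have le: "ennreal s \<le> T n \<omega>" if "N \<le> n" "s \<in> {0..t}" for n s
    proof -
      have "ennreal s \<le> ennreal t" using that by (intro ennreal_leI) auto
      also have "\<dots> \<le> T N \<omega>" using N by simp
      also have "\<dots> \<le> T n \<omega>" using monoD[OF m that(1)] .
      finally show ?thesis .
    qed
    show "\<exists>N. \<forall>n\<ge>N. \<forall>s\<in>{0..t}.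
     (\<Sum>k<n. h k \<omega> * (X (cut (T (Suc k) \<omega>) s) \<omega> - X (cut (T k \<omega>) s) \<omega>)) =
     gsum (\<lambda>k. h k \<omega>) (\<lambda>s. X s \<omega>) (\<lambda>k. T k \<omega>) s"
      by (intro exI[of _ N] allI impI ballI, rule gsum_fin[OF _ m le, symmetric]) auto
  qed
qed

lemma mart_scale:
  assumes "X \<in> mart J Js" "Js \<le> J"
  shows "(\<lambda>t \<omega>. a * X t \<omega>) \<in> mart J Js"
proof -
  obtain c where c: "\<And>\<omega>. \<omega> \<in> Omega J \<Longrightarrow> X 0 \<omega> = c" using mart_maximal[OF assms] by blast
  have "after (\<lambda>_. 0) (\<lambda>_. a) X \<in> mart J Js"
    by (rule mart_after[OF assms path_stopping_const]) (simp add: tau_measurable_def)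
  from mart_add[OF this mart_const[of "a * c"]] show ?thesis
    by (rule mart_cong) (simp add: after_def c algebra_simps)
qed

lemma mart_diff:
  assumes "X \<in> mart J Js" "Y \<in> mart J Js" "Js \<le> J"
  shows "(\<lambda>t \<omega>. X t \<omega> - Y t \<omega>) \<in> mart J Js"
  using mart_add[OF assms(1) mart_scale[OF assms(2,3), of "-1"]] by simp

text \<open>Simple capital processes trade at arbitrary stopping times, whereas \<open>mart\<close>
  is generated from grids; \<open>mart_gsum\<close>, applied to each price, bridges the two.\<close>

lemma simple_capital_mart:
  assumes "K \<in> simple_capital J Js" "Js \<le> J"
  shows "K \<in> mart J Js"
proof (rule simple_capitalE[OF assms(1)])
  fix c T h assume s: "strategy J Js T h"
    and K: "\<And>t \<omega>. 0 \<le> t \<Longrightarrow> \<omega> \<in> Omega J \<Longrightarrow> K t \<omega> = c + gains Js T h t \<omega>"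
  have ex: "quasi_always J Js (\<lambda>t \<omega>. \<exists>N. ennreal t < T N \<omega>)"
    by (rule quasi_always_mono[OF quasi_always_True]) (rule strategyD(3)[OF s])
  have "(\<lambda>t \<omega>. gsum (\<lambda>k. h k \<omega> j) (\<omega> j) (\<lambda>k. T k \<omega>) t) \<in> mart J Js" if "j < Js" for j
  proof -
    \<comment> \<open>The price minus its initial value; the increments in \<open>gsum\<close> do
      not see the difference.\<close>
    have "after (\<lambda>_. 0) (\<lambda>_. 1) (\<lambda>t \<omega>. \<omega> j t) \<in> mart J Js"
      by (rule mart_after_coordinate[OF that assms(2) path_stopping_const]) (simp add: tau_measurable_def)
    from mart_gsum[OF this assms(2) strategyD(1)[OF s] ex tau_measurable_comp[OF strategyD(5)[OF s]], of "\<lambda>_ f. f j"]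
    show ?thesis by (rule mart_cong) (simp add: gsum_def after_def)
  qed
  then have "(\<lambda>t \<omega>. gains Js T h t \<omega>) \<in> mart J Js"
    unfolding gains_def by (intro mart_sum) auto
  from mart_add[OF mart_const[of c] this] show ?thesis
    by (rule mart_cong) (simp add: K)
qed

text \<open>Outside the domain the value is the unspecified \<open>the None\<close>, but the domain
  of the limit holds quasi-always, and uniform convergence on it is all that \<open>conv\<close>
  asks for.\<close>

lemma cont_martingale_mart:
  assumes "Y \<in> cont_martingale J Js" "Js \<le> J"
  shows "(\<lambda>t \<omega>. the (Y t \<omega>)) \<in> mart J Js"
  using assms(1)
proof (induction rule: cont_martingale.induct)
  case (simple K)
  then show ?case using simple_capital_mart assms(2) by simp
next
  case (limit X Xs)
  have "conv J Js (\<lambda>k t \<omega>. the (Xs k t \<omega>)) (\<lambda>t \<omega>. the (X t \<omega>))"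
    unfolding conv_def
  proof (rule quasi_always_mono)
    show "quasi_always J Js (\<lambda>t \<omega>. X t \<omega> \<noteq> None)" using limit(1) by (simp add: cont_process_def)
  qed (use limit in blast)
  then show ?case by (rule mart.limit[rotated]) (rule limit.IH)
qed

lemma continuous_on_halfline:
  fixes f :: "real \<Rightarrow> real"
  assumes "\<And>b. continuous_on {0..b} f"
  shows "continuous_on {0..} f"
  unfolding continuous_on_eq_continuous_within
proof
  fix x :: real assume "x \<in> {0..}"
  then have "continuous (at x within {0..x+1}) f"
    using assms[of "x+1"] by (auto simp: continuous_on_eq_continuous_within)
  moreover have "at x within {0..x+1} = at x within {0..}"
    by (rule at_within_nhd[of x "{..<x+1}"]) auto
  ultimately show "continuous (at x within {0..}) f" by simp
qed

lemma continuous_on_cut: "continuous_on {0..} (cut a)"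
proof (cases "a = \<infinity>")
  case True
  then show ?thesis
    by (simp add: cut_def[abs_def] continuous_on_id top_unique)
next
  case False
  then obtain r where r: "a = ennreal r" "0 \<le> r" by (cases a) auto
  have "continuous_on {0..} (\<lambda>t. min r t)" by (intro continuous_intros)
  then show ?thesis
    by (rule continuous_on_eq) (use r in \<open>auto simp: cut_def ennreal_le_iff min_def\<close>)
qed

lemma continuous_on_gsum:
  assumes y: "continuous_on {0..t} y" and T: "mono T" "ennreal t \<le> T N"
  shows "continuous_on {0..t} (gsum h y T)"
proof (cases "0 \<le> t")
  case True
  have "continuous_on {0..t} (\<lambda>s. y (cut a s))" for a
  proof (rule continuous_on_compose2[OF y])
    show "continuous_on {0..t} (cut a)" using continuous_on_cut by (rule continuous_on_subset) auto
    show "cut a ` {0..t} \<subseteq> {0..t}" by (rule image_subsetI) (rule cut_Icc)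
  qed
  then have "continuous_on {0..t} (\<lambda>s. \<Sum>k<N. h k * (y (cut (T (Suc k)) s) - y (cut (T k) s)))"
    by (intro continuous_intros)
  then show ?thesis
  proof (rule continuous_on_eq)
    fix s assume "s \<in> {0..t}"
    then have "ennreal s \<le> ennreal t" by (intro ennreal_leI) simp
    then have "ennreal s \<le> T N" using T(2) by (rule order_trans)
    then show "(\<Sum>k<N. h k * (y (cut (T (Suc k)) s) - y (cut (T k) s))) = gsum h y T s"
      using gsum_fin[OF _ T(1)] \<open>s \<in> {0..t}\<close> by simp
  qed
qed simp

text \<open>The limit rule of \<open>cont_martingale\<close> assumes a continuous process; this
  covers its base rule. The sums are known to be finite on bounded intervals, hence the passage
  through \<open>continuous_on_halfline\<close>.\<close>

lemma simple_capital_cont_process: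
  assumes "K \<in> simple_capital J Js" "Js \<le> J"
  shows "cont_process J Js (\<lambda>t \<omega>. Some (K t \<omega>))"
proof (rule simple_capitalE[OF assms(1)])
  fix c T h assume s: "strategy J Js T h"
    and K: "\<And>t \<omega>. 0 \<le> t \<Longrightarrow> \<omega> \<in> Omega J \<Longrightarrow> K t \<omega> = c + gains Js T h t \<omega>"
  have seq: "path_sequence J T" by (rule strategyD(1)[OF s])
  have "continuous_on {0..} (\<lambda>t. K t \<omega>)" if \<omega>: "\<omega> \<in> Omega J" for \<omega>
  proof (rule continuous_on_halfline)
    fix b :: real
    show "continuous_on {0..b} (\<lambda>t. K t \<omega>)"
    proof (cases "0 \<le> b")
      case True
      obtain N where "ennreal b < T N \<omega>" using strategyD(3)[OF s \<omega> True] by blast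
      then have N: "ennreal b \<le> T N \<omega>" by simp
      have "continuous_on {0..b} (\<lambda>t. c + gains Js T h t \<omega>)"
        unfolding gains_def
      proof (intro continuous_intros)
        fix j assume "j \<in> {..<Js}"
        then show "continuous_on {0..b} (\<lambda>t. gsum (\<lambda>n. h n \<omega> j) (\<omega> j) (\<lambda>n. T n \<omega>) t)"
          using assms(2) continuous_on_subset[OF Omega_continuous[OF \<omega>, of j], of "{0..b}"]
          by (intro continuous_on_gsum[where N = N] path_sequenceD(3)[OF seq \<omega>] N) auto
      qed
      then show ?thesis by (rule continuous_on_eq) (use K \<omega> in auto)
    qed simp
  qed
  moreover have "{t. 0 \<le> t} = {0::real..}" by auto
  moreover have "adapted J (\<lambda>t \<omega>. Some (K t \<omega>))"
    unfolding adapted_def using K gains_agree[OF seq strategyD(5)[OF s] assms(2)] by simp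
  ultimately show ?thesis
    by (simp add: cont_process_def quasi_always_True)
qed

lemma cont_martingale_cont_process:
  assumes "Y \<in> cont_martingale J Js" "Js \<le> J"
  shows "cont_process J Js Y"
  using assms(1) by (cases rule: cont_martingale.cases) (auto intro: simple_capital_cont_process[OF _ assms(2)])

subsection \<open>Quadratic variation\<close>

lemma partition_path_sequence: "partition J Js T \<Longrightarrow> path_sequence J T"
  by (auto simp: partition_def path_sequence_def stopping_time_iff mono_iff_le_Suc)

lemma partition_exceeds: "partition J Js T \<Longrightarrow> quasi_always J Js (\<lambda>t \<omega>. \<exists>N. ennreal t < T N \<omega>)"
  by (simp add: partition_def less_SUP_iff)

text \<open>Speaks of X alone: \<open>fine_for_semimart\<close> lets every sequence of partitions
  choose its own decomposition, and sequences with different choices have to be compared. The factor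
  2 adds the oscillations of the two components.\<close>

definition osc_fine :: "nat \<Rightarrow> cprocess \<Rightarrow> (nat \<Rightarrow> nat \<Rightarrow> path \<Rightarrow> ennreal) \<Rightarrow> bool" where
  "osc_fine J X T \<longleftrightarrow> (\<forall>n k. \<forall>\<omega>\<in>Omega J. \<forall>s\<ge>0. \<forall>s'\<ge>0.
      T n k \<omega> \<le> ennreal s \<and> ennreal s \<le> T n (Suc k) \<omega> \<and> X s \<omega> \<noteq> None \<and>
      T n k \<omega> \<le> ennreal s' \<and> ennreal s' \<le> T n (Suc k) \<omega> \<and> X s' \<omega> \<noteq> None \<longrightarrow>
      \<bar>the (X s \<omega>) - the (X s' \<omega>)\<bar> \<le> 2 * (1/2) ^ n)"

lemma osc_fineD:
  assumes "osc_fine J X T" "\<omega> \<in> Omega J" "0 \<le> s" "0 \<le> s'"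
    "T n k \<omega> \<le> ennreal s" "ennreal s \<le> T n (Suc k) \<omega>" "X s \<omega> \<noteq> None"
    "T n k \<omega> \<le> ennreal s'" "ennreal s' \<le> T n (Suc k) \<omega>" "X s' \<omega> \<noteq> None"
  shows "\<bar>the (X s \<omega>) - the (X s' \<omega>)\<bar> \<le> 2 * (1/2) ^ n"
  using assms unfolding osc_fine_def by blast

lemma fine_forD:
  assumes "fine_for J T Z" "\<omega> \<in> Omega J" "0 \<le> s" "0 \<le> s'"
    "T n k \<omega> \<le> ennreal s" "ennreal s \<le> T n (Suc k) \<omega>" "Z s \<omega> \<noteq> None"
    "T n k \<omega> \<le> ennreal s'" "ennreal s' \<le> T n (Suc k) \<omega>" "Z s' \<omega> \<noteq> None"
  shows "\<bar>the (Z s \<omega>) - the (Z s' \<omega>)\<bar> \<le> (1/2) ^ n"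
  using assms unfolding fine_for_def by blast

lemma fine_for_semimart_osc_fine:
  assumes "fine_for_semimart J Js X T"
  shows "osc_fine J X T"
proof -
  obtain Y A where d: "semimart_decomp J Js X Y A" and f: "fine_for J T Y" "fine_for J T A"
    using assms by (auto simp: fine_for_semimart_def)
  show ?thesis
    unfolding osc_fine_def
  proof (intro allI ballI impI)
    fix n k \<omega> and s s' :: real
    assume \<omega>: "\<omega> \<in> Omega J" and s: "0 \<le> s" "0 \<le> s'"
      and *: "T n k \<omega> \<le> ennreal s \<and> ennreal s \<le> T n (Suc k) \<omega> \<and> X s \<omega> \<noteq> None \<and>
      T n k \<omega> \<le> ennreal s' \<and> ennreal s' \<le> T n (Suc k) \<omega> \<and> X s' \<omega> \<noteq> None"
    have dom: "Y u \<omega> \<noteq> None" "A u \<omega> \<noteq> None" "the (X u \<omega>) = the (Y u \<omega>) + the (A u \<omega>)"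
      if "0 \<le> u" "X u \<omega> \<noteq> None" for u
      using d \<omega> that unfolding semimart_decomp_def by blast+
    have "\<bar>the (Y s \<omega>) - the (Y s' \<omega>)\<bar> \<le> (1/2)^n"
      using * s dom by (intro fine_forD[OF f(1) \<omega> s, of n k]) blast+
    moreover have "\<bar>the (A s \<omega>) - the (A s' \<omega>)\<bar> \<le> (1/2)^n"
      using * s dom by (intro fine_forD[OF f(2) \<omega> s, of n k]) blast+
    ultimately show "\<bar>the (X s \<omega>) - the (X s' \<omega>)\<bar> \<le> 2 * (1/2) ^ n"
      using dom(3)[of s] dom(3)[of s'] * s by (simp add: abs_le_iff)
  qed
qed

lemma cont_process_dom:
  assumes "cont_process J Js A" "\<omega> \<in> Omega J" "A t \<omega> \<noteq> None" "s \<in> {0..t}"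
  shows "A s \<omega> \<noteq> None"
proof -
  have "connected {t. 0 \<le> t \<and> A t \<omega> \<noteq> None}" "A 0 \<omega> \<noteq> None"
    using assms(1,2) unfolding cont_process_def by blast+
  then have "{0..t} \<subseteq> {t. 0 \<le> t \<and> A t \<omega> \<noteq> None}"
    using assms by (intro connected_contains_Icc) auto
  then show ?thesis using assms(4) by auto
qed

lemma cont_process_continuous:
  assumes "cont_process J Js A" "\<omega> \<in> Omega J" "A t \<omega> \<noteq> None"
  shows "continuous_on {0..t} (\<lambda>s. the (A s \<omega>))"
proof -
  have "continuous_on {t. 0 \<le> t \<and> A t \<omega> \<noteq> None} (\<lambda>t. the (A t \<omega>))"
    using assms(1,2) unfolding cont_process_def by blast+
  then show ?thesis
  proof (rule continuous_on_subset, intro subsetI CollectI conjI)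
    fix s assume s: "s \<in> {0..t}"
    then show "0 \<le> s" by simp
    show "A s \<omega> \<noteq> None" by (rule cont_process_dom[of J Js A, OF assms s])
  qed
qed

lemma adapted_tau_measurable:
  assumes x: "adapted J x" and \<sigma>: "path_stopping J \<sigma>"
  shows "tau_measurable J \<sigma> (\<lambda>\<omega>. x (enn2real (\<sigma> \<omega>)) \<omega>)"
  unfolding tau_measurable_def
proof (intro ballI impI)
  fix \<omega> \<omega>' assume *: "\<omega> \<in> Omega J" "\<omega>' \<in> Omega J" "agree_upto J \<omega> \<omega>' (\<sigma> \<omega>)"
  have eq: "\<sigma> \<omega>' = \<sigma> \<omega>" by (rule path_stoppingD[OF \<sigma> * order_refl])
  \<comment> \<open>If \<sigma> is infinite the left side is 0, so x is then read at time 0.\<close>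
  have "ennreal (enn2real (\<sigma> \<omega>)) \<le> \<sigma> \<omega>" by (cases "\<sigma> \<omega>") auto
  then have "agree_upto J \<omega> \<omega>' (ennreal (enn2real (\<sigma> \<omega>)))" by (rule agree_mono[OF *(3)])
  then show "x (enn2real (\<sigma> \<omega>)) \<omega> = x (enn2real (\<sigma> \<omega>')) \<omega>'"
    using x * eq by (simp add: adapted_def)
qed

lemma adapted_gsum:
  assumes y: "adapted J y" and T: "path_sequence J T" and h: "\<And>k. tau_measurable J (T k) (h k)"
  shows "adapted J (\<lambda>t \<omega>. gsum (\<lambda>k. h k \<omega>) (\<lambda>s. y s \<omega>) (\<lambda>k. T k \<omega>) t)"
  unfolding adapted_def
proof (intro allI impI ballI)
  fix t :: real and \<omega> \<omega>' assume t: "0 \<le> t" and \<omega>: "\<omega> \<in> Omega J" "\<omega>' \<in> Omega J"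
    and a: "agree_upto J \<omega> \<omega>' (ennreal t)"
  show "gsum (\<lambda>k. h k \<omega>) (\<lambda>s. y s \<omega>) (\<lambda>k. T k \<omega>) t = gsum (\<lambda>k. h k \<omega>') (\<lambda>s. y s \<omega>') (\<lambda>k. T k \<omega>') t"
  proof (rule gsum_cong[OF t path_sequenceD(3)[OF T \<omega>(1)] path_sequenceD(3)[OF T \<omega>(2)]])
    show "cut (T k \<omega>) t = cut (T k \<omega>') t" for k
      by (rule path_stopping_cut[OF path_sequenceD(1)[OF T] \<omega> a, symmetric])
    show "y s \<omega> = y s \<omega>'" if "0 \<le> s" "s \<le> t" for s
      using y \<omega> that agree_mono[OF a ennreal_leI[OF that(2)]] by (simp add: adapted_def)
    show "h k \<omega> = h k \<omega>'" if "T k \<omega> \<le> ennreal t" for k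
      using h[of k] \<omega> agree_mono[OF a that] by (auto simp: tau_measurable_def)
  qed
qed

text \<open>\<open>mart_maximal\<close> gives capitals only slightly above z n; with the slack
  (1/2)^n they remain summable, as \<open>Borel_Cantelli\<close> requires.\<close>

lemma mart_Borel_Cantelli:
  assumes Z: "\<And>n. Z n \<in> mart J Js" and Js: "Js \<le> J"
    and init: "\<And>n \<omega>. \<omega> \<in> Omega J \<Longrightarrow> Z n 0 \<omega> = z n" and z: "\<And>n. 0 \<le> z n" "summable z"
  shows "quasi_always J Js (\<lambda>t \<omega>. \<forall>\<^sub>F n in sequentially.
    (\<forall>s\<in>{0..t}. 0 \<le> Z n s \<omega>) \<longrightarrow> (\<forall>s\<in>{0..t}. Z n s \<omega> \<le> 1))"
proof -
  have "maximal_bound J Js (Z n) (z n + (1/2)^n)" for n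
  proof -
    obtain c where c: "\<forall>\<omega>\<in>Omega J. Z n 0 \<omega> = c"
      "\<forall>a. \<forall>\<epsilon>>0. maximal_bound J Js (\<lambda>t \<omega>. Z n t \<omega> + a) (c + a + \<epsilon>)"
      using mart_maximal[OF Z Js] by blast
    have "c = z n" using c(1) init[OF Omega_nonempty] Omega_nonempty by metis
    then show ?thesis using c(2)[rule_format, of "(1/2)^n" 0] by simp
  qed
  then obtain W where W: "\<And>n. W n \<in> nn_supermartingale J Js"
    "\<And>n \<omega>. \<omega> \<in> Omega J \<Longrightarrow> W n 0 \<omega> \<le> ennreal (z n + (1/2)^n)"
    "\<And>n t \<omega>. 0 \<le> t \<Longrightarrow> \<omega> \<in> Omega J \<Longrightarrow> \<forall>s\<in>{0..t}. 0 \<le> Z n s \<omega> \<Longrightarrow> \<exists>s\<in>{0..t}. 1 < Z n s \<omega> \<Longrightarrow>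
       1 \<le> W n t \<omega>"
    unfolding maximal_bound_def by metis
  have "quasi_always J Js (\<lambda>t \<omega>. \<forall>\<^sub>F n in sequentially. W n t \<omega> < 1)"
    by (rule Borel_Cantelli[OF W(1,2)]) (use z in \<open>auto intro!: summable_add summable_geometric\<close>)
  then show ?thesis
  proof (rule quasi_always_mono)
    fix t :: real and \<omega> assume *: "0 \<le> t" "\<omega> \<in> Omega J" "\<forall>\<^sub>F n in sequentially. W n t \<omega> < 1"
    show "\<forall>\<^sub>F n in sequentially. (\<forall>s\<in>{0..t}. 0 \<le> Z n s \<omega>) \<longrightarrow> (\<forall>s\<in>{0..t}. Z n s \<omega> \<le> 1)"
      using *(3) by (rule eventually_mono) (use W(3)[OF *(1,2)] in \<open>meson not_le\<close>)
  qed
qed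

lemma finite_variation_bound:
  assumes "finite_variation_on 0 t a"
  obtains V where "0 \<le> V" and
    "\<And>s R N. 0 \<le> s \<Longrightarrow> s \<le> t \<Longrightarrow> mono R \<Longrightarrow> R 0 = 0 \<Longrightarrow> ennreal s \<le> R N \<Longrightarrow>
      (\<Sum>k<N. \<bar>a (cut (R (Suc k)) s) - a (cut (R k) s)\<bar>) \<le> V"
proof -
  obtain V where V: "\<And>d m. d 0 = 0 \<Longrightarrow> d m = t \<Longrightarrow> (\<forall>i<m. d i \<le> d (Suc i)) \<Longrightarrow>
      (\<Sum>i<m. \<bar>a (d (Suc i)) - a (d i)\<bar>) \<le> V"
    using assms unfolding finite_variation_on_def bdd_above_def by blast
  show ?thesis
  proof (rule that[of "\<bar>V\<bar>"])
    fix s :: real and R :: "nat \<Rightarrow> ennreal" and N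
    assume *: "0 \<le> s" "s \<le> t" "mono R" "R 0 = 0" "ennreal s \<le> R N"
    define d where "d i = (if i \<le> N then cut (R i) s else t)" for i
    have "d i \<le> d (Suc i)" if "i < Suc N" for i
    proof (cases "i < N")
      case True
      then show ?thesis using *(1,3) by (auto simp: d_def mono_def intro: cut_mono)
    next
      case False
      then have "i = N" using that by simp
      then show ?thesis using * by (simp add: d_def cut_eq)
    qed
    then have "(\<Sum>i<Suc N. \<bar>a (d (Suc i)) - a (d i)\<bar>) \<le> V"
      by (intro V) (auto simp: d_def * simp flip: zero_ennreal_def)
    moreover have "(\<Sum>i<N. \<bar>a (d (Suc i)) - a (d i)\<bar>) = (\<Sum>k<N. \<bar>a (cut (R (Suc k)) s) - a (cut (R k) s)\<bar>)"
      by (intro sum.cong) (auto simp: d_def)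
    ultimately show "(\<Sum>k<N. \<bar>a (cut (R (Suc k)) s) - a (cut (R k) s)\<bar>) \<le> \<bar>V\<bar>" by simp
  qed simp
qed

text \<open>On a merged step the two integrands are the values of x at the beginnings of the T-step
  and the S-step containing the merged time \<open>R k\<close>. Each is within e of the value at
  \<open>R k\<close> itself, which gives the factor 2 * e.\<close>

lemma gsum_diff_small:
  fixes x y :: "real \<Rightarrow> real" and T S :: "nat \<Rightarrow> ennreal"
  assumes T: "mono T" "T 0 = 0" and S: "mono S" "S 0 = 0"
    and oscT: "\<And>k u v. 0 \<le> u \<Longrightarrow> u \<le> t \<Longrightarrow> 0 \<le> v \<Longrightarrow> v \<le> t \<Longrightarrow> T k \<le> ennreal u \<Longrightarrow> ennreal u \<le> T (Suc k) \<Longrightarrow>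
      T k \<le> ennreal v \<Longrightarrow> ennreal v \<le> T (Suc k) \<Longrightarrow> \<bar>x u - x v\<bar> \<le> e"
    and oscS: "\<And>k u v. 0 \<le> u \<Longrightarrow> u \<le> t \<Longrightarrow> 0 \<le> v \<Longrightarrow> v \<le> t \<Longrightarrow> S k \<le> ennreal u \<Longrightarrow> ennreal u \<le> S (Suc k) \<Longrightarrow>
      S k \<le> ennreal v \<Longrightarrow> ennreal v \<le> S (Suc k) \<Longrightarrow> \<bar>x u - x v\<bar> \<le> e"
  defines "M \<equiv> (\<lambda>s. gsum (\<lambda>k. x (enn2real (S k))) y S s - gsum (\<lambda>k. x (enn2real (T k))) y T s)"
    and "R \<equiv> merged T S"
  assumes s: "0 \<le> s" "s \<le> t"
  shows "\<bar>M (cut (R (Suc k)) s) - M (cut (R k) s)\<bar> \<le> 2 * e * \<bar>y (cut (R (Suc k)) s) - y (cut (R k) s)\<bar>"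
proof -
  note TS = T(1) S(1) T(2) S(2)
  define i j where "i = fst (merge_idx T S k)" and "j = snd (merge_idx T S k)"
  have eq: "M (cut (R (Suc k)) s) - M (cut (R k) s) =
      (x (enn2real (S j)) - x (enn2real (T i))) * (y (cut (R (Suc k)) s) - y (cut (R k) s))"
    using gsum_merged_inc[where T = T and S = S and k = k and y = y, OF TS s(1), of "\<lambda>k. x (enn2real (T k))"]
      gsum_merged_inc[where T = T and S = S and k = k and y = y, OF TS s(1), of "\<lambda>k. x (enn2real (S k))"]
    by (simp add: M_def R_def i_def j_def algebra_simps)
  have R: "R k \<le> R (Suc k)" using mono_merged[OF TS] by (simp add: R_def mono_def)
  show ?thesis
  proof (cases "R k \<le> ennreal s")
    case False
    then have "cut (R k) s = s" "cut (R (Suc k)) s = s" using s R by (auto intro!: cut_eq)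
    then show ?thesis by simp
  next
    case True
    have "R k < \<infinity>" by (rule le_ennreal_finite[OF True])
    then obtain r where r: "R k = ennreal r" "0 \<le> r" by (cases "R k") auto
    then have rs: "r \<le> s" using True s by (simp add: ennreal_le_iff)
    have le: "T i \<le> R k" "S j \<le> R k" "R (Suc k) \<le> T (Suc i)" "R (Suc k) \<le> S (Suc j)"
      unfolding R_def i_def j_def by (rule merged_le[OF TS])+
    have Ti: "T i = ennreal (enn2real (T i))" and Sj: "S j = ennreal (enn2real (S j))"
      using le_less_trans[OF le(1) \<open>R k < \<infinity>\<close>] le_less_trans[OF le(2) \<open>R k < \<infinity>\<close>] by (auto simp: less_top)
    have Tr: "enn2real (T i) \<le> r" and Sr: "enn2real (S j) \<le> r"
      using le(1,2) r Ti Sj by (metis ennreal_le_iff)+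
    have "\<bar>x (enn2real (T i)) - x r\<bar> \<le> e"
      using rs s Tr r R le monoD[OF T(1), of i "Suc i"]
      by (intro oscT[of _ _ i]) (auto simp flip: Ti)
    moreover have "\<bar>x (enn2real (S j)) - x r\<bar> \<le> e"
      using rs s Sr r R le monoD[OF S(1), of j "Suc j"]
      by (intro oscS[of _ _ j]) (auto simp flip: Sj)
    ultimately have "\<bar>x (enn2real (S j)) - x (enn2real (T i))\<bar> \<le> 2 * e" by linarith
    then show ?thesis unfolding eq abs_mult by (rule mult_right_mono) simp
  qed
qed

lemma gsum_add_process:
  assumes "\<And>s. 0 \<le> s \<Longrightarrow> s \<le> t \<Longrightarrow> x s = y s + a s" "0 \<le> t" "mono T" "ennreal t \<le> T N"
  shows "gsum h x T t = gsum h y T t + gsum h a T t"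
  unfolding gsum_fin[OF assms(2-4)] sum.distrib[symmetric]
  using assms(1,2) by (intro sum.cong refl) (simp add: algebra_simps)

text \<open>The difference of the two quadratic variations is a stochastic integral with
  an integrand of size \<open>2^(-n)\<close>; its martingale part \<open>M\<close> satisfies \<open>|dM| \<le> c |dY|\<close> along the common
  refinement \<open>R\<close>, so \<open>M\<^sup>2 - c\<^sup>2 Y\<^sup>2\<close> is dominated by the stochastic integral
  \<open>2 \<integral> M dM - 2 c\<^sup>2 \<integral> Y dY\<close>, to which the maximal inequality applies.\<close>

lemma qsum_diff_small:
  assumes Js: "Js \<le> J" and d: "semimart_decomp J Js X Y A"
    and T: "\<And>n. partition J Js (T n)" "osc_fine J X T"
    and S: "\<And>n. partition J Js (S n)" "osc_fine J X S"
  shows "quasi_always J Js (\<lambda>t \<omega>. \<exists>B. \<forall>\<^sub>F n in sequentially. \<forall>s\<in>{0..t}.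
    \<bar>qsum (\<lambda>s. the (X s \<omega>)) (\<lambda>k. T n k \<omega>) s - qsum (\<lambda>s. the (X s \<omega>)) (\<lambda>k. S n k \<omega>) s\<bar> \<le> B * (3/4)^n)"
proof -
  define x y a where "x t \<omega> = the (X t \<omega>)" and "y t \<omega> = the (Y t \<omega>)" and "a t \<omega> = the (A t \<omega>)" for t \<omega>
  have Y: "Y \<in> cont_martingale J Js" and A: "fv_process J Js A" and cA: "cont_process J Js A"
    using d unfolding semimart_decomp_def fv_process_def by blast+
  have cY: "cont_process J Js Y" by (rule cont_martingale_cont_process[OF Y Js])
  have dec: "X t \<omega> \<noteq> None \<longleftrightarrow> Y t \<omega> \<noteq> None" "X t \<omega> \<noteq> None \<longleftrightarrow> A t \<omega> \<noteq> None"
    "X t \<omega> \<noteq> None \<Longrightarrow> x t \<omega> = y t \<omega> + a t \<omega>" if "0 \<le> t" "\<omega> \<in> Omega J" for t \<omega>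
    using d that unfolding semimart_decomp_def x_def y_def a_def by blast+
  have ad: "adapted J Y" "adapted J A" using cY cA unfolding cont_process_def by blast+
  then have ad_y: "adapted J y" unfolding adapted_def y_def by metis
  have ad_x: "adapted J x"
    unfolding adapted_def
  proof (intro allI impI ballI)
    fix t :: real and \<omega> \<omega>' assume *: "0 \<le> t" "\<omega> \<in> Omega J" "\<omega>' \<in> Omega J" "agree_upto J \<omega> \<omega>' (ennreal t)"
    then have "Y t \<omega> = Y t \<omega>'" "A t \<omega> = A t \<omega>'" using ad unfolding adapted_def by blast+
    then show "x t \<omega> = x t \<omega>'"
      using dec[OF *(1,2)] dec[OF *(1,3)] by (cases "X t \<omega> = None") (auto simp: x_def y_def a_def)
  qed
  have mart_y: "y \<in> mart J Js" unfolding y_def by (rule cont_martingale_mart[OF Y Js])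
  have seq: "path_sequence J (T n)" "path_sequence J (S n)" for n
    by (rule partition_path_sequence[OF T(1)] partition_path_sequence[OF S(1)])+
  have ex: "quasi_always J Js (\<lambda>t \<omega>. \<exists>N. ennreal t < T n N \<omega>)"
    "quasi_always J Js (\<lambda>t \<omega>. \<exists>N. ennreal t < S n N \<omega>)" for n
    by (rule partition_exceeds[OF T(1)] partition_exceeds[OF S(1)])+
  define R where "R n k \<omega> = merged (\<lambda>k. T n k \<omega>) (\<lambda>k. S n k \<omega>) k" for n k \<omega>
  have seqR: "path_sequence J (R n)" for n
    unfolding R_def[abs_def] by (rule path_sequence_merged[OF seq])
  have TS: "mono (\<lambda>k. T n k \<omega>)" "mono (\<lambda>k. S n k \<omega>)" "T n 0 \<omega> = 0" "S n 0 \<omega> = 0"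
    if "\<omega> \<in> Omega J" for n \<omega>
    by (intro path_sequenceD[OF seq(1)] path_sequenceD[OF seq(2)] that)+
  have R_ex: "\<exists>N. ennreal t < R n N \<omega>"
    if "\<omega> \<in> Omega J" "\<exists>N. ennreal t < T n N \<omega>" "\<exists>N. ennreal t < S n N \<omega>" for t n \<omega>
    using merged_greater[OF TS[OF that(1)]] that(2,3) unfolding R_def by blast
  have exR: "quasi_always J Js (\<lambda>t \<omega>. \<exists>N. ennreal t < R n N \<omega>)" for n
    by (rule quasi_always_mono[OF quasi_always_conj[OF ex]]) (use R_ex in blast)
  \<comment> \<open>Twice the oscillation bound 2 * (1/2)^n of \<open>osc_fine\<close>, as it comes
    out of \<open>gsum_diff_small\<close>.\<close>
  define c :: "nat \<Rightarrow> real" where "c n = 2 * (2 * (1/2)^n)" for n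
  define G where "G P z t \<omega> = gsum (\<lambda>k. x (enn2real (P k \<omega>)) \<omega>) (\<lambda>s. z s \<omega>) (\<lambda>k. P k \<omega>) t"
    for P :: "nat \<Rightarrow> path \<Rightarrow> ennreal" and z :: "real \<Rightarrow> path \<Rightarrow> real" and t \<omega>
  define M where "M n t \<omega> = G (S n) y t \<omega> - G (T n) y t \<omega>" for n t \<omega>
  define U where "U n t \<omega> = 2 * gsum (\<lambda>k. M n (enn2real (R n k \<omega>)) \<omega>) (\<lambda>s. M n s \<omega>) (\<lambda>k. R n k \<omega>) t
     - 2 * (c n)\<^sup>2 * gsum (\<lambda>k. y (enn2real (R n k \<omega>)) \<omega>) (\<lambda>s. y s \<omega>) (\<lambda>k. R n k \<omega>) t" for n t \<omega>
  have mart_G: "G (T n) y \<in> mart J Js" "G (S n) y \<in> mart J Js" for n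
    unfolding G_def[abs_def]
    by (intro mart_gsum[OF mart_y Js seq(1) ex(1)] mart_gsum[OF mart_y Js seq(2) ex(2)]
        adapted_tau_measurable ad_x path_sequenceD(1)[OF seq(1)] path_sequenceD(1)[OF seq(2)])+
  have ad_G: "adapted J (G (T n) y)" "adapted J (G (S n) y)" for n
    unfolding G_def[abs_def]
    by (intro adapted_gsum[OF ad_y seq(1)] adapted_gsum[OF ad_y seq(2)]
        adapted_tau_measurable ad_x path_sequenceD(1)[OF seq(1)] path_sequenceD(1)[OF seq(2)])+
  have mart_M: "M n \<in> mart J Js" for n
    unfolding M_def[abs_def] by (rule mart_diff[OF mart_G(2) mart_G(1) Js])
  have ad_M: "adapted J (M n)" for n
    using ad_G[of n] unfolding adapted_def M_def by metis
  have mart_U: "U n \<in> mart J Js" for n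
    unfolding U_def[abs_def]
    by (intro mart_diff mart_scale Js mart_gsum[OF _ Js seqR exR] mart_M mart_y
        adapted_tau_measurable ad_M ad_y path_sequenceD(1)[OF seqR])
  \<comment> \<open>L will bound the path of y on [0, t]. The factor (16/9)^n is the square of
    (4/3)^n and scales the target |M| \<le> (3/4)^n to 1; since (c n)^2 = 16 * (1/4)^n, the starting
    values 16 * L^2 * (4/9)^n are summable.\<close>
  define Z where "Z L n t \<omega> = (16/9)^n * ((c n)\<^sup>2 * (real L)\<^sup>2 + U n t \<omega>)" for L n t \<omega>
  have mart_Z: "Z L n \<in> mart J Js" for L n
    unfolding Z_def[abs_def] by (intro mart_scale Js mart_add mart_const mart_U)
  have Z0: "Z L n 0 \<omega> = 16 * (real L)\<^sup>2 * (4/9)^n" for L n \<omega>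
  proof -
    have "(16/9)^n * (c n)\<^sup>2 = 16 * ((16/9)^n * ((1/2)^2)^n)"
      unfolding c_def power_mult[symmetric] by (simp add: power2_eq_square power_mult_distrib mult_2_right power_add mult.commute)
    also have "\<dots> = 16 * (4/9)^n" unfolding power_mult_distrib[symmetric] by (simp add: power2_eq_square)
    finally show ?thesis by (simp add: Z_def U_def algebra_simps)
  qed
  have "quasi_always J Js (\<lambda>t \<omega>. \<forall>\<^sub>F n in sequentially.
    (\<forall>s\<in>{0..t}. 0 \<le> Z L n s \<omega>) \<longrightarrow> (\<forall>s\<in>{0..t}. Z L n s \<omega> \<le> 1))" for L
    by (rule mart_Borel_Cantelli[OF mart_Z Js Z0]) (auto intro!: summable_mult summable_geometric)
  \<comment> \<open>A suitable L is known only after the path and t are given, so the exceptional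
    sets for all L are collected.\<close>
  then have q1: "quasi_always J Js (\<lambda>t \<omega>. \<forall>L. \<forall>\<^sub>F n in sequentially.
    (\<forall>s\<in>{0..t}. 0 \<le> Z L n s \<omega>) \<longrightarrow> (\<forall>s\<in>{0..t}. Z L n s \<omega> \<le> 1))" by (rule quasi_always_all)
  have q2: "quasi_always J Js (\<lambda>t \<omega>. \<forall>n. (\<exists>N. ennreal t < T n N \<omega>) \<and> (\<exists>N. ennreal t < S n N \<omega>))"
    by (rule quasi_always_all[OF quasi_always_conj[OF ex]])
  have q3: "quasi_always J Js (\<lambda>t \<omega>. A t \<omega> \<noteq> None)" using cA unfolding cont_process_def by blast
  show ?thesis
  proof (rule quasi_always_mono[OF quasi_always_conj[OF quasi_always_conj[OF q1 q2] q3]], elim conjE)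
    fix t :: real and \<omega> assume t: "0 \<le> t" and \<omega>: "\<omega> \<in> Omega J" and At: "A t \<omega> \<noteq> None"
      and ev: "\<forall>L. \<forall>\<^sub>F n in sequentially.
        (\<forall>s\<in>{0..t}. 0 \<le> Z L n s \<omega>) \<longrightarrow> (\<forall>s\<in>{0..t}. Z L n s \<omega> \<le> 1)"
      and exN: "\<forall>n. (\<exists>N. ennreal t < T n N \<omega>) \<and> (\<exists>N. ennreal t < S n N \<omega>)"
    have dom: "X s \<omega> \<noteq> None" if "0 \<le> s" "s \<le> t" for s
    proof -
      have "s \<in> {0..t}" using that by simp
      from cont_process_dom[of J Js A, OF cA \<omega> At this] show ?thesis using dec(2)[OF that(1) \<omega>] by blast
    qed
    have sum: "x s \<omega> = y s \<omega> + a s \<omega>" if "0 \<le> s" "s \<le> t" for s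
      using dec(3)[OF that(1) \<omega> dom[OF that]] .
    have "Y t \<omega> \<noteq> None" using dec(1)[OF t \<omega>] dom[of t] t by simp
    then have "continuous_on {0..t} (\<lambda>s. y s \<omega>)"
      unfolding y_def by (rule cont_process_continuous[of J Js Y, OF cY \<omega>])
    then have "bounded ((\<lambda>s. y s \<omega>) ` {0..t})"
      by (intro compact_imp_bounded compact_continuous_image) auto
    then obtain b where b: "\<forall>s\<in>{0..t}. \<bar>y s \<omega>\<bar> \<le> b" by (auto simp: bounded_iff)
    obtain L :: nat where "b \<le> real L" using real_arch_simple by blast
    with b have L: "\<bar>y s \<omega>\<bar> \<le> real L" if "s \<in> {0..t}" for s using that order_trans by blast
    have "finite_variation_on 0 t (\<lambda>s. a s \<omega>)"
      using A t \<omega> At unfolding fv_process_def a_def by blast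
    then obtain V where V: "0 \<le> V" "\<And>s R N. 0 \<le> s \<Longrightarrow> s \<le> t \<Longrightarrow> mono R \<Longrightarrow> R 0 = 0 \<Longrightarrow> ennreal s \<le> R N \<Longrightarrow>
      (\<Sum>k<N. \<bar>a (cut (R (Suc k)) s) \<omega> - a (cut (R k) s) \<omega>\<bar>) \<le> V"
      by (rule finite_variation_bound) (rule that, assumption+)
    have mR: "mono (\<lambda>k. R n k \<omega>)" "R n 0 \<omega> = 0" for n
      using path_sequenceD(2,3)[OF seqR \<omega>] by auto
    have small: "\<bar>(G (S n) z (cut (R n (Suc k) \<omega>) s) \<omega> - G (T n) z (cut (R n (Suc k) \<omega>) s) \<omega>) -
        (G (S n) z (cut (R n k \<omega>) s) \<omega> - G (T n) z (cut (R n k \<omega>) s) \<omega>)\<bar>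
        \<le> c n * \<bar>z (cut (R n (Suc k) \<omega>) s) \<omega> - z (cut (R n k \<omega>) s) \<omega>\<bar>"
      if s: "0 \<le> s" "s \<le> t" for n k s z
      unfolding G_def c_def R_def
    proof (rule gsum_diff_small[OF TS(1)[OF \<omega>] TS(3)[OF \<omega>] TS(2)[OF \<omega>] TS(4)[OF \<omega>] _ _ s])
      fix k u v
      assume *: "0 \<le> u" "u \<le> t" "0 \<le> v" "v \<le> t"
      show "\<bar>x u \<omega> - x v \<omega>\<bar> \<le> 2 * (1/2)^n"
        if "T n k \<omega> \<le> ennreal u" "ennreal u \<le> T n (Suc k) \<omega>" "T n k \<omega> \<le> ennreal v" "ennreal v \<le> T n (Suc k) \<omega>"
        unfolding x_def
        by (rule osc_fineD[where n = n and k = k and J = J and X = X and T = T, OF T(2) \<omega> *(1,3) that(1,2) dom[OF *(1,2)] that(3,4) dom[OF *(3,4)]])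
      show "\<bar>x u \<omega> - x v \<omega>\<bar> \<le> 2 * (1/2)^n"
        if "S n k \<omega> \<le> ennreal u" "ennreal u \<le> S n (Suc k) \<omega>" "S n k \<omega> \<le> ennreal v" "ennreal v \<le> S n (Suc k) \<omega>"
        unfolding x_def
        by (rule osc_fineD[where n = n and k = k and J = J and X = X and T = S, OF S(2) \<omega> *(1,3) that(1,2) dom[OF *(1,2)] that(3,4) dom[OF *(3,4)]])
    qed
    have bound_N: "ennreal s \<le> P N" if "0 \<le> s" "s \<le> t" "ennreal t < P N" for s N and P :: "nat \<Rightarrow> ennreal"
      using that(3) ennreal_leI[OF that(2)] by (meson le_less_trans less_imp_le)
    have RN: "\<exists>N. ennreal t < R n N \<omega>" for n
      using R_ex[OF \<omega>, of t n] exN by blast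
    have c0: "0 \<le> c n" for n by (simp add: c_def)
    \<comment> \<open>Summation by parts for M and for y. The sum of squares of M is at most (c n)^2
      times that of y, and the remaining term (c n)^2 * (y 0)^2 has the favourable sign.\<close>
    have U: "(M n s \<omega>)\<^sup>2 - (c n)\<^sup>2 * (y s \<omega>)\<^sup>2 \<le> U n s \<omega>" if s: "0 \<le> s" "s \<le> t" for n s
    proof -
      obtain N where N: "ennreal t < R n N \<omega>" using RN by blast
      note N = bound_N[OF s, where P = "\<lambda>k. R n k \<omega>", OF N]
      have M0: "M n 0 \<omega> = 0" by (simp add: M_def G_def)
      have "qsum (\<lambda>s. M n s \<omega>) (\<lambda>k. R n k \<omega>) s \<le> (c n)\<^sup>2 * qsum (\<lambda>s. y s \<omega>) (\<lambda>k. R n k \<omega>) s"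
        unfolding qsum_fin[OF s(1) mR(1) N] sum_distrib_left
      proof (rule sum_mono)
        fix k
        have "\<bar>M n (cut (R n (Suc k) \<omega>) s) \<omega> - M n (cut (R n k \<omega>) s) \<omega>\<bar>
          \<le> \<bar>c n * (y (cut (R n (Suc k) \<omega>) s) \<omega> - y (cut (R n k \<omega>) s) \<omega>)\<bar>"
          using small[OF s, of n y k] c0[of n] by (simp add: M_def abs_mult)
        then show "(M n (cut (R n (Suc k) \<omega>) s) \<omega> - M n (cut (R n k \<omega>) s) \<omega>)\<^sup>2
          \<le> (c n)\<^sup>2 * (y (cut (R n (Suc k) \<omega>) s) \<omega> - y (cut (R n k \<omega>) s) \<omega>)\<^sup>2"
          unfolding power_mult_distrib[symmetric] by (rule power2_mono)
      qed
      moreover have "U n s \<omega> = (M n s \<omega>)\<^sup>2 - qsum (\<lambda>s. M n s \<omega>) (\<lambda>k. R n k \<omega>) s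
          - (c n)\<^sup>2 * ((y s \<omega>)\<^sup>2 - (y 0 \<omega>)\<^sup>2 - qsum (\<lambda>s. y s \<omega>) (\<lambda>k. R n k \<omega>) s)"
        unfolding qsum_gsum[where y = "\<lambda>s. M n s \<omega>", OF s(1) mR N] qsum_gsum[where y = "\<lambda>s. y s \<omega>", OF s(1) mR N]
        by (simp add: U_def M0 algebra_simps)
      moreover have "0 \<le> (c n)\<^sup>2 * (y 0 \<omega>)\<^sup>2" by simp
      ultimately show ?thesis by (simp only: right_diff_distrib)
    qed
    have "\<forall>\<^sub>F n in sequentially. (\<forall>s\<in>{0..t}. 0 \<le> Z L n s \<omega>) \<longrightarrow> (\<forall>s\<in>{0..t}. Z L n s \<omega> \<le> 1)"
      using ev by blast
    then have M_small: "\<forall>\<^sub>F n in sequentially. \<forall>s\<in>{0..t}. \<bar>M n s \<omega>\<bar> \<le> (3/4)^n"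
    proof (rule eventually_mono)
      fix n assume imp: "(\<forall>s\<in>{0..t}. 0 \<le> Z L n s \<omega>) \<longrightarrow> (\<forall>s\<in>{0..t}. Z L n s \<omega> \<le> 1)"
      have Z: "(16/9)^n * (M n s \<omega>)\<^sup>2 \<le> Z L n s \<omega>" if "s \<in> {0..t}" for s
        unfolding Z_def
      proof (rule mult_left_mono)
        have "(y s \<omega>)\<^sup>2 \<le> (real L)\<^sup>2" using L[OF that] by (simp add: abs_le_square_iff[symmetric])
        then have "(c n)\<^sup>2 * (y s \<omega>)\<^sup>2 \<le> (c n)\<^sup>2 * (real L)\<^sup>2" by (rule mult_left_mono) simp
        then show "(M n s \<omega>)\<^sup>2 \<le> (c n)\<^sup>2 * (real L)\<^sup>2 + U n s \<omega>"
          using U[of s n] that by simp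
      qed simp
      show "\<forall>s\<in>{0..t}. \<bar>M n s \<omega>\<bar> \<le> (3/4)^n"
      proof
        fix s assume s: "s \<in> {0..t}"
        \<comment> \<open>The nonnegativity presupposed by the maximal inequality comes from the
          lower bound by M^2, so no stopping is involved.\<close>
        have "\<forall>s\<in>{0..t}. 0 \<le> Z L n s \<omega>" using Z by (meson order_trans mult_nonneg_nonneg zero_le_power2 zero_le_power zero_le_divide_iff zero_le_numeral)
        then have "(16/9)^n * (M n s \<omega>)\<^sup>2 \<le> 1" using imp Z[OF s] s by force
        moreover have "((4/3::real)^n)\<^sup>2 = ((4/3)\<^sup>2)^n" by (metis power_mult mult.commute)
        moreover have "(4/3)\<^sup>2 = (16/9::real)" by (simp add: power2_eq_square)
        ultimately have "((4/3)^n * M n s \<omega>)\<^sup>2 \<le> 1" by (simp only: power_mult_distrib)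
        then have "\<bar>(4/3)^n * M n s \<omega>\<bar> \<le> 1" by (simp add: abs_square_le_1)
        then have "(4/3)^n * \<bar>M n s \<omega>\<bar> \<le> 1" by (simp add: abs_mult)
        then have "(3/4)^n * ((4/3)^n * \<bar>M n s \<omega>\<bar>) \<le> (3/4)^n * 1" by (rule mult_left_mono) simp
        then show "\<bar>M n s \<omega>\<bar> \<le> (3/4)^n" by (simp flip: mult.assoc power_mult_distrib)
      qed
    qed
    have main: "\<bar>qsum (\<lambda>s. x s \<omega>) (\<lambda>k. T n k \<omega>) s - qsum (\<lambda>s. x s \<omega>) (\<lambda>k. S n k \<omega>) s\<bar>
        \<le> 2 * \<bar>M n s \<omega>\<bar> + 2 * (c n * V)" if s: "0 \<le> s" "s \<le> t" for n s
    proof -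
      obtain N1 N2 N where N: "ennreal t < T n N1 \<omega>" "ennreal t < S n N2 \<omega>" "ennreal t < R n N \<omega>"
        using exN RN by blast
      note N1 = bound_N[OF s, where P = "\<lambda>k. T n k \<omega>", OF N(1)]
      note N2 = bound_N[OF s, where P = "\<lambda>k. S n k \<omega>", OF N(2)]
      note N3 = bound_N[OF s, where P = "\<lambda>k. R n k \<omega>", OF N(3)]
      have G_split: "G (T n) x s \<omega> = G (T n) y s \<omega> + G (T n) a s \<omega>"
        "G (S n) x s \<omega> = G (S n) y s \<omega> + G (S n) a s \<omega>"
        unfolding G_def using sum s
        by (intro gsum_add_process[OF _ s(1) TS(1)[OF \<omega>] N1] gsum_add_process[OF _ s(1) TS(2)[OF \<omega>] N2]; simp)+
      have "qsum (\<lambda>s. x s \<omega>) (\<lambda>k. T n k \<omega>) s - qsum (\<lambda>s. x s \<omega>) (\<lambda>k. S n k \<omega>) s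
        = 2 * (G (S n) x s \<omega> - G (T n) x s \<omega>)"
        unfolding qsum_gsum[where y = "\<lambda>s. x s \<omega>", OF s(1) TS(1)[OF \<omega>] TS(3)[OF \<omega>] N1]
          qsum_gsum[where y = "\<lambda>s. x s \<omega>", OF s(1) TS(2)[OF \<omega>] TS(4)[OF \<omega>] N2]
        by (simp add: G_def)
      also have "\<dots> = 2 * M n s \<omega> + 2 * (G (S n) a s \<omega> - G (T n) a s \<omega>)"
        by (simp add: G_split M_def)
      finally have eq: "qsum (\<lambda>s. x s \<omega>) (\<lambda>k. T n k \<omega>) s - qsum (\<lambda>s. x s \<omega>) (\<lambda>k. S n k \<omega>) s
        = 2 * M n s \<omega> + 2 * (G (S n) a s \<omega> - G (T n) a s \<omega>)" .
      \<comment> \<open>The finite variation part is estimated pathwise: along R its increments are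
        at most c n times those of a, whose sum is at most V.\<close>
      define D where "D u = G (S n) a u \<omega> - G (T n) a u \<omega>" for u
      have "D s = D s - D 0" by (simp add: D_def G_def)
      also have "\<dots> = (\<Sum>k<N. D (cut (R n (Suc k) \<omega>) s) - D (cut (R n k \<omega>) s))"
        by (rule telescope_cut[OF s(1) mR(2) N3, symmetric])
      also have "\<bar>\<dots>\<bar> \<le> (\<Sum>k<N. \<bar>D (cut (R n (Suc k) \<omega>) s) - D (cut (R n k \<omega>) s)\<bar>)" by (rule sum_abs)
      also have "\<dots> \<le> (\<Sum>k<N. c n * \<bar>a (cut (R n (Suc k) \<omega>) s) \<omega> - a (cut (R n k \<omega>) s) \<omega>\<bar>)"
        unfolding D_def by (intro sum_mono small[OF s])
      also have "\<dots> = c n * (\<Sum>k<N. \<bar>a (cut (R n (Suc k) \<omega>) s) \<omega> - a (cut (R n k \<omega>) s) \<omega>\<bar>)"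
        by (rule sum_distrib_left[symmetric])
      also have "\<dots> \<le> c n * V"
        by (intro mult_left_mono c0 V(2)[OF s mR N3])
      finally have "\<bar>D s\<bar> \<le> c n * V" .
      then show ?thesis
        unfolding eq D_def[symmetric] using abs_triangle_ineq[of "2 * M n s \<omega>" "2 * D s"]
        by (simp add: abs_mult)
    qed
    have c_le: "c n \<le> 4 * (3/4)^n" for n
      unfolding c_def using power_mono[of "1/2" "3/4::real" n] by simp
    show "\<exists>B. \<forall>\<^sub>F n in sequentially. \<forall>s\<in>{0..t}. \<bar>qsum (\<lambda>s. the (X s \<omega>)) (\<lambda>k. T n k \<omega>) s
        - qsum (\<lambda>s. the (X s \<omega>)) (\<lambda>k. S n k \<omega>) s\<bar> \<le> B * (3/4)^n"
    proof (intro exI[of _ "2 + 8 * V"])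
      show "\<forall>\<^sub>F n in sequentially. \<forall>s\<in>{0..t}. \<bar>qsum (\<lambda>s. the (X s \<omega>)) (\<lambda>k. T n k \<omega>) s
        - qsum (\<lambda>s. the (X s \<omega>)) (\<lambda>k. S n k \<omega>) s\<bar> \<le> (2 + 8 * V) * (3/4)^n"
        using M_small
      proof (rule eventually_mono, intro ballI)
        fix n s assume *: "\<forall>s\<in>{0..t}. \<bar>M n s \<omega>\<bar> \<le> (3/4)^n" "s \<in> {0..t}"
        have "c n * V \<le> 4 * (3/4)^n * V" by (rule mult_right_mono[OF c_le V(1)])
        moreover have "\<bar>M n s \<omega>\<bar> \<le> (3/4)^n" using * by blast
        ultimately show "\<bar>qsum (\<lambda>s. the (X s \<omega>)) (\<lambda>k. T n k \<omega>) s
          - qsum (\<lambda>s. the (X s \<omega>)) (\<lambda>k. S n k \<omega>) s\<bar> \<le> (2 + 8 * V) * (3/4)^n"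
          using main[of s n] *(2) unfolding x_def by (simp add: algebra_simps)
      qed
    qed
  qed
qed

text \<open>The sequence is compared with its own shift, which satisfies the same fineness bound.
  Consecutive sums then differ by at most a geometric term, and the Weierstrass test applies.
  Writing the limit with \<open>lim\<close> gives one process for all intervals [0, t].\<close>

lemma qsum_converges:
  assumes Js: "Js \<le> J" and d: "semimart_decomp J Js X Y A"
    and T: "\<And>n. partition J Js (T n)" "osc_fine J X T"
  shows "quasi_always J Js (\<lambda>t \<omega>. uniform_limit {0..t} (\<lambda>n s. qsum (\<lambda>s. the (X s \<omega>)) (\<lambda>k. T n k \<omega>) s)
    (\<lambda>s. lim (\<lambda>n. qsum (\<lambda>s. the (X s \<omega>)) (\<lambda>k. T n k \<omega>) s)) sequentially)"
proof -
  have "osc_fine J X (\<lambda>n. T (Suc n))"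
    unfolding osc_fine_def
  proof (intro allI ballI impI)
    fix n k \<omega> and s s' :: real
    assume \<omega>: "\<omega> \<in> Omega J" and s: "0 \<le> s" "0 \<le> s'"
      and *: "T (Suc n) k \<omega> \<le> ennreal s \<and> ennreal s \<le> T (Suc n) (Suc k) \<omega> \<and> X s \<omega> \<noteq> None \<and>
      T (Suc n) k \<omega> \<le> ennreal s' \<and> ennreal s' \<le> T (Suc n) (Suc k) \<omega> \<and> X s' \<omega> \<noteq> None"
    have "\<bar>the (X s \<omega>) - the (X s' \<omega>)\<bar> \<le> 2 * (1/2) ^ Suc n"
      using * by (intro osc_fineD[OF T(2) \<omega> s, of _ k]) blast+
    also have "\<dots> \<le> 2 * (1/2) ^ n" by simp
    finally show "\<bar>the (X s \<omega>) - the (X s' \<omega>)\<bar> \<le> 2 * (1/2) ^ n" .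
  qed
  from qsum_diff_small[OF Js d T T(1) this] show ?thesis
  proof (rule quasi_always_mono, elim exE)
    fix t :: real and \<omega> B
    define f where "f n s = qsum (\<lambda>s. the (X s \<omega>)) (\<lambda>k. T n k \<omega>) s" for n s
    assume "\<forall>\<^sub>F n in sequentially. \<forall>s\<in>{0..t}. \<bar>qsum (\<lambda>s. the (X s \<omega>)) (\<lambda>k. T n k \<omega>) s -
      qsum (\<lambda>s. the (X s \<omega>)) (\<lambda>k. T (Suc n) k \<omega>) s\<bar> \<le> B * (3/4)^n"
    then have "\<forall>\<^sub>F n in sequentially. \<forall>s\<in>{0..t}. norm (f (Suc n) s - f n s) \<le> B * (3/4)^n"
      by (simp add: f_def abs_minus_commute)
    moreover have "summable (\<lambda>n. B * (3/4::real)^n)" by (intro summable_mult summable_geometric) simp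
    ultimately have "uniform_limit {0..t} (\<lambda>n s. \<Sum>i<n. f (Suc i) s - f i s)
        (\<lambda>s. \<Sum>i. f (Suc i) s - f i s) sequentially"
      by (rule Weierstrass_m_test_ev)
    moreover have "(\<Sum>i<n. f (Suc i) s - f i s) = f n s - f 0 s" for n s
      by (rule sum_lessThan_telescope)
    ultimately have "uniform_limit {0..t} (\<lambda>n s. f n s - f 0 s) (\<lambda>s. \<Sum>i. f (Suc i) s - f i s) sequentially"
      by (simp only:)
    from uniform_limit_add[OF this uniform_limit_const[where c = "f 0"]]
    have u: "uniform_limit {0..t} f (\<lambda>s. (\<Sum>i. f (Suc i) s - f i s) + f 0 s) sequentially"
      by simp
    have "(\<Sum>i. f (Suc i) s - f i s) + f 0 s = lim (\<lambda>n. f n s)" if "s \<in> {0..t}" for s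
      using tendsto_uniform_limitI[OF u that] by (simp add: limI)
    then have "uniform_limit {0..t} f (\<lambda>s. lim (\<lambda>n. f n s)) sequentially"
      using u by (subst uniform_limit_cong'[symmetric, where f = f and h = "\<lambda>s. (\<Sum>i. f (Suc i) s - f i s) + f 0 s"]) auto
    then show "uniform_limit {0..t} (\<lambda>n s. qsum (\<lambda>s. the (X s \<omega>)) (\<lambda>k. T n k \<omega>) s)
      (\<lambda>s. lim (\<lambda>n. qsum (\<lambda>s. the (X s \<omega>)) (\<lambda>k. T n k \<omega>) s)) sequentially"
      by (simp add: f_def[abs_def])
  qed
qed

lemma qsum_same_limit:
  assumes Js: "Js \<le> J" and d: "semimart_decomp J Js X Y A"
    and T: "\<And>n. partition J Js (T n)" "osc_fine J X T"
    and S: "\<And>n. partition J Js (S n)" "osc_fine J X S"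
  shows "quasi_always J Js (\<lambda>t \<omega>. uniform_limit {0..t} (\<lambda>n s. qsum (\<lambda>s. the (X s \<omega>)) (\<lambda>k. S n k \<omega>) s)
    (\<lambda>s. lim (\<lambda>n. qsum (\<lambda>s. the (X s \<omega>)) (\<lambda>k. T n k \<omega>) s)) sequentially)"
proof (rule quasi_always_mono[OF quasi_always_conj[OF qsum_converges[OF Js d T] qsum_diff_small[OF Js d S T]]],
    elim conjE exE)
  fix t :: real and \<omega> B
  let ?f = "\<lambda>n s. qsum (\<lambda>s. the (X s \<omega>)) (\<lambda>k. T n k \<omega>) s"
  let ?g = "\<lambda>n s. qsum (\<lambda>s. the (X s \<omega>)) (\<lambda>k. S n k \<omega>) s"
  assume u: "uniform_limit {0..t} ?f (\<lambda>s. lim (\<lambda>n. ?f n s)) sequentially"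
  assume ev: "\<forall>\<^sub>F n in sequentially. \<forall>s\<in>{0..t}. \<bar>?g n s - ?f n s\<bar> \<le> B * (3/4)^n"
  have lim: "(\<lambda>n. B * (3/4)^n) \<longlonglongrightarrow> 0"
    by (intro tendsto_mult_right_zero LIMSEQ_realpow_zero) auto
  have "uniform_limit {0..t} (\<lambda>n s. ?g n s - ?f n s) (\<lambda>s. 0) sequentially"
  proof (rule uniform_limitI)
    fix e :: real assume "0 < e"
    then have "\<forall>\<^sub>F n in sequentially. B * (3/4)^n < e" using lim by (simp add: order_tendstoD)
    with ev show "\<forall>\<^sub>F n in sequentially. \<forall>s\<in>{0..t}. dist (?g n s - ?f n s) 0 < e"
      by eventually_elim (auto intro: le_less_trans)
  qed
  from uniform_limit_add[OF this u]
  show "uniform_limit {0..t} ?g (\<lambda>s. lim (\<lambda>n. ?f n s)) sequentially" by simp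
qed

subsection \<open>Pathwise change of variables\<close>

text \<open>Lagrange's remainder contains F'' at an intermediate point; replacing that point by z
  costs \<rho>.\<close>

lemma taylor2:
  fixes F F' F'' :: "real \<Rightarrow> real"
  assumes F: "\<And>x. (F has_real_derivative F' x) (at x)" and F': "\<And>x. (F' has_real_derivative F'' x) (at x)"
    and \<rho>: "\<And>\<xi>. \<bar>\<xi> - z\<bar> \<le> \<bar>v - z\<bar> \<Longrightarrow> \<bar>F'' \<xi> - F'' z\<bar> \<le> \<rho>"
  shows "\<bar>F v - F z - F' z * (v - z) - F'' z / 2 * (v - z)\<^sup>2\<bar> \<le> \<rho> / 2 * (v - z)\<^sup>2"
proof (cases "v = z")
  case False
  define D where "D = (\<lambda>m::nat. if m = 0 then F else if m = 1 then F' else F'')"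
  have "\<exists>\<xi>. (if v < z then v < \<xi> \<and> \<xi> < z else z < \<xi> \<and> \<xi> < v) \<and>
     F v = (\<Sum>m<2. (D m z / fact m) * (v - z)^m) + (D 2 \<xi> / fact 2) * (v - z)^2"
  proof (rule Taylor[where a = "min v z" and b = "max v z"])
    show "\<forall>m t. m < 2 \<and> min v z \<le> t \<and> t \<le> max v z \<longrightarrow> DERIV (D m) t :> D (Suc m) t"
      using F F' by (auto simp: D_def less_2_cases_iff)
  qed (use False in \<open>auto simp: D_def\<close>)
  then obtain \<xi> where \<xi>: "if v < z then v < \<xi> \<and> \<xi> < z else z < \<xi> \<and> \<xi> < v"
    and eq: "F v = F z + F' z * (v - z) + F'' \<xi> / 2 * (v - z)\<^sup>2"
    by (auto simp: D_def numeral_2_eq_2)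
  have "\<bar>\<xi> - z\<bar> \<le> \<bar>v - z\<bar>" using \<xi> by (auto split: if_splits)
  then have "\<bar>(F'' \<xi> - F'' z) / 2\<bar> * (v - z)\<^sup>2 \<le> \<rho> / 2 * (v - z)\<^sup>2"
    using \<rho> by (intro mult_right_mono) auto
  moreover have "F v - F z - F' z * (v - z) - F'' z / 2 * (v - z)\<^sup>2 = (F'' \<xi> - F'' z) / 2 * (v - z)\<^sup>2"
    unfolding eq by (simp add: algebra_simps diff_divide_distrib)
  ultimately show ?thesis by (simp only: abs_mult abs_power2)
qed simp

text \<open>q is controlled only on [0, t]. Clamping its argument extends it to a monotone
  continuous function on the line, as \<open>interval_measure\<close> requires, without adding mass
  outside [0, t].\<close>

lemma stopped_distribution:
  fixes q :: "real \<Rightarrow> real"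
  assumes "0 \<le> t" and mono: "\<And>a b. 0 \<le> a \<Longrightarrow> a \<le> b \<Longrightarrow> b \<le> t \<Longrightarrow> q a \<le> q b" and cont: "continuous_on {0..t} q"
  defines "G \<equiv> (\<lambda>s. q (max 0 (min s t)))"
  shows "a \<le> b \<Longrightarrow> emeasure (interval_measure G) {a<..b} = ennreal (G b - G a)"
    and "x \<le> y \<Longrightarrow> G x \<le> G y"
proof -
  show m: "G x \<le> G y" if "x \<le> y" for x y
    unfolding G_def using that assms(1) by (intro mono) auto
  have "continuous_on UNIV G"
    unfolding G_def by (rule continuous_on_compose2[OF cont]) (use assms(1) in \<open>auto intro!: continuous_intros\<close>)
  then have "continuous (at_right x) G" for x
    by (simp add: continuous_on_eq_continuous_at continuous_at_imp_continuous_within)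
  then show "a \<le> b \<Longrightarrow> emeasure (interval_measure G) {a<..b} = ennreal (G b - G a)"
    using m by (intro emeasure_interval_measure_Ioc)
qed

section \<open>Lebesgue-Stieltjes integrals as functions of the upper limit\<close>

context
  fixes t :: real and q f :: "real \<Rightarrow> real"
  assumes mono: "\<And>a b. 0 \<le> a \<Longrightarrow> a \<le> b \<Longrightarrow> b \<le> t \<Longrightarrow> q a \<le> q b"
    and cont_q: "continuous_on {0..t} q" and cont_f: "continuous_on {0..t} f"
begin

private definition "\<mu> b = interval_measure (\<lambda>s. q (max 0 (min s b)))"

lemma mu_Ioc:
  assumes "0 \<le> b" "b \<le> t" "u \<le> v"
  shows "emeasure (\<mu> b) {u<..v} = ennreal (q (max 0 (min v b)) - q (max 0 (min u b)))"
  unfolding \<mu>_def using assms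
  by (intro stopped_distribution mono continuous_on_subset[OF cont_q]) auto

lemma sets_mu [measurable_cong, simp]: "sets (\<mu> b) = sets borel"
  by (simp add: \<mu>_def)

lemma emeasure_density_Iic:
  "emeasure (density (\<mu> b) (\<lambda>s. ennreal (indicator {..a} s))) {u<..v} = emeasure (\<mu> b) {u<..min v a}"
proof -
  have "emeasure (density (\<mu> b) (\<lambda>s. ennreal (indicator {..a} s))) {u<..v} =
      (\<integral>\<^sup>+ s. ennreal (indicator {..a} s) * indicator {u<..v} s \<partial>\<mu> b)"
    by (rule emeasure_density) auto
  also have "\<dots> = (\<integral>\<^sup>+ s. indicator {u<..min v a} s \<partial>\<mu> b)"
    by (intro nn_integral_cong) (auto simp: indicator_def)
  also have "\<dots> = emeasure (\<mu> b) {u<..min v a}" by (rule nn_integral_indicator) simp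
  finally show ?thesis .
qed

text \<open>\<open>LS_integral\<close> uses a different measure for each upper limit. Up to a the
  two clamped functions have the same increments, and beyond a the one for a is constant, so both
  integrals can be written with respect to the measure for b and subtracted.\<close>

lemma mu_restrict:
  assumes ab: "0 \<le> a" "a \<le> b" "b \<le> t"
  shows "density (\<mu> b) (\<lambda>s. ennreal (indicator {..a} s)) = \<mu> a"
proof (rule measure_eqI_generator_eq)
  let ?E = "range (\<lambda>(u, v). {u<..v::real})"
  show "Int_stable ?E"
  proof (rule Int_stableI)
    fix A B assume "A \<in> ?E" "B \<in> ?E"
    then obtain u v u' v' where "A = {u<..v}" "B = {u'<..v'}" by auto
    then have "A \<inter> B = (\<lambda>(u, v). {u<..v}) (max u u', min v v')" by auto
    then show "A \<inter> B \<in> ?E" by (rule image_eqI) simp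
  qed
  show "emeasure (density (\<mu> b) (\<lambda>s. ennreal (indicator {..a} s))) X = emeasure (\<mu> a) X" if "X \<in> ?E" for X
  proof -
    obtain u v where X: "X = {u<..v}" using \<open>X \<in> ?E\<close> by auto
    have "emeasure (density (\<mu> b) (\<lambda>s. ennreal (indicator {..a} s))) X = emeasure (\<mu> b) {u<..min v a}"
      unfolding X by (rule emeasure_density_Iic)
    also have "\<dots> = emeasure (\<mu> a) {u<..v}"
    proof (cases "u \<le> v")
      case False
      then show ?thesis by simp
    next
      case uv: True
      show ?thesis
      proof (cases "u \<le> a")
        case True
        then show ?thesis using ab uv by (simp add: mu_Ioc min_absorb1)
      next
        case False
        then have "{u<..min v a} = {}" by auto
        moreover have "emeasure (\<mu> a) {u<..v} = 0" using False ab uv by (subst mu_Ioc) (auto simp: min_absorb2)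
        ultimately show ?thesis by (simp only: emeasure_empty)
      qed
    qed
    finally show ?thesis by (simp only: X)
  qed
  show "sets (density (\<mu> b) (\<lambda>s. ennreal (indicator {..a} s))) = sigma_sets UNIV ?E"
    "sets (\<mu> a) = sigma_sets UNIV ?E"
    by (simp_all add: borel_sigma_sets_Ioc)
  let ?A = "\<lambda>i. {- real i<..real i}"
  show "range ?A \<subseteq> ?E" by auto
  show "(\<Union>i. ?A i) = UNIV"
  proof (intro set_eqI iffI UNIV_I)
    fix x :: real
    obtain i :: nat where "\<bar>x\<bar> < real i" using reals_Archimedean2 by blast
    then have "x \<in> ?A i" by auto
    then show "x \<in> (\<Union>i. ?A i)" by blast
  qed
  fix i
  have "emeasure (density (\<mu> b) (\<lambda>s. ennreal (indicator {..a} s))) (?A i) =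
      emeasure (\<mu> b) {- real i<..min (real i) a}" by (rule emeasure_density_Iic)
  also have "\<dots> \<le> emeasure (\<mu> b) {- real i<..real i}" by (intro emeasure_mono) auto
  also have "\<dots> < \<infinity>" using ab by (simp add: mu_Ioc)
  finally show "emeasure (density (\<mu> b) (\<lambda>s. ennreal (indicator {..a} s))) (?A i) \<noteq> \<infinity>" by simp
qed auto

lemma integrable_piece:
  assumes "0 \<le> b" "b \<le> t" "A \<in> sets borel" "A \<subseteq> {0..b}"
  shows "integrable (\<mu> b) (\<lambda>s. indicator A s * f s)"
proof -
  have "bounded (f ` {0..t})" by (intro compact_imp_bounded compact_continuous_image cont_f) auto
  then obtain B where B: "\<forall>s\<in>{0..t}. \<bar>f s\<bar> \<le> B" by (auto simp: bounded_iff)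
  \<comment> \<open>f is known to be continuous only on [0, t]; its truncation is measurable on the
    whole line.\<close>
  define g where "g s = indicator {0..t} s * f s" for s
  have g [measurable]: "g \<in> borel_measurable borel"
    unfolding g_def using borel_measurable_continuous_on_indicator[of "{0..t}" f] cont_f by simp
  have "emeasure (\<mu> b) A \<le> emeasure (\<mu> b) {-1<..b}"
    using assms by (intro emeasure_mono) auto
  also have "\<dots> < \<infinity>" using assms by (simp add: mu_Ioc)
  finally have fin: "emeasure (\<mu> b) A < \<infinity>" .
  have "AE s in \<mu> b. s \<in> A \<longrightarrow> norm (g s) \<le> B"
    by (rule AE_I2) (use assms B in \<open>auto simp: g_def indicator_def\<close>)
  with fin have "integrable (\<mu> b) (\<lambda>s. indicator A s *\<^sub>R g s)"
    using assms(3) g by (intro integrableI_bounded_set_indicator[where B = B]) (auto simp: measurable_cong_sets[OF sets_mu refl])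
  moreover have "indicator A s *\<^sub>R g s = indicator A s * f s" for s
    using assms by (auto simp: g_def indicator_def)
  ultimately show ?thesis by (simp only:)
qed

text \<open>The difference is an integral over the half-open interval from a to b, whose mass is q b
  - q a, and there f stays within \<epsilon> of f a.\<close>

lemma LS_integral_diff:
  assumes ab: "0 \<le> a" "a \<le> b" "b \<le> t" and \<epsilon>: "\<And>u. a \<le> u \<Longrightarrow> u \<le> b \<Longrightarrow> \<bar>f u - f a\<bar> \<le> \<epsilon>"
  shows "\<bar>LS_integral b q f - LS_integral a q f - f a * (q b - q a)\<bar> \<le> \<epsilon> * (q b - q a)"
proof -
  have b: "0 \<le> b" using ab by simp
  have meas: "(\<lambda>s. indicator {0..a} s * f s) \<in> borel_measurable borel"
    using borel_measurable_continuous_on_indicator[of "{0..a}" f] continuous_on_subset[OF cont_f, of "{0..a}"] ab by simp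
  have "LS_integral a q f = integral\<^sup>L (density (\<mu> b) (\<lambda>s. ennreal (indicator {..a} s))) (\<lambda>s. indicator {0..a} s * f s)"
    unfolding mu_restrict[OF ab] by (simp add: LS_integral_def \<mu>_def)
  also have "\<dots> = (\<integral>s. indicator {..a} s *\<^sub>R (indicator {0..a} s * f s) \<partial>\<mu> b)"
    using meas by (intro integral_density) (auto simp: measurable_cong_sets[OF sets_mu refl])
  also have "\<dots> = (\<integral>s. indicator {0..a} s * f s \<partial>\<mu> b)"
    by (intro Bochner_Integration.integral_cong refl) (auto simp: indicator_def)
  finally have La: "LS_integral a q f = (\<integral>s. indicator {0..a} s * f s \<partial>\<mu> b)" .
  have Lb: "LS_integral b q f = (\<integral>s. indicator {0..b} s * f s \<partial>\<mu> b)"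
    by (simp add: LS_integral_def \<mu>_def)
  have "LS_integral b q f - LS_integral a q f =
      (\<integral>s. indicator {0..b} s * f s - indicator {0..a} s * f s \<partial>\<mu> b)"
    unfolding La Lb using ab by (intro Bochner_Integration.integral_diff[symmetric] integrable_piece) auto
  also have "\<dots> = (\<integral>s. indicator {a<..b} s * f s \<partial>\<mu> b)"
    using ab by (intro Bochner_Integration.integral_cong refl) (auto simp: indicator_def)
  finally have L: "LS_integral b q f - LS_integral a q f = (\<integral>s. indicator {a<..b} s * f s \<partial>\<mu> b)" .
  have em: "emeasure (\<mu> b) {a<..b} = ennreal (q b - q a)" using ab by (simp add: mu_Ioc min_absorb1)
  have q: "0 \<le> q b - q a" using mono[of a b] ab by simp
  have ind: "integrable (\<mu> b) (indicator {a<..b} :: real \<Rightarrow> real)" using em by (intro integrable_real_indicator) auto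
  have meas_ab: "measure (\<mu> b) {a<..b} = q b - q a" using em q by (simp add: measure_def)
  have const: "(\<integral>s. indicator {a<..b} s * c \<partial>\<mu> b) = c * (q b - q a)" for c
    using meas_ab by simp
  have int: "integrable (\<mu> b) (\<lambda>s. indicator {a<..b} s * f s)"
    using ab by (intro integrable_piece) auto
  have cint: "integrable (\<mu> b) (\<lambda>s. indicator {a<..b} s * c)" for c :: real
    using ind by (rule integrable_mult_left)
  have le: "indicator {a<..b} s * (f a - \<epsilon>) \<le> indicator {a<..b} s * f s"
    "indicator {a<..b} s * f s \<le> indicator {a<..b} s * (f a + \<epsilon>)" for s :: real
    using \<epsilon>[of s] by (auto simp: indicator_def abs_le_iff)
  have "(f a - \<epsilon>) * (q b - q a) \<le> LS_integral b q f - LS_integral a q f"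
    unfolding L const[symmetric] by (intro integral_mono int cint le)
  moreover have "LS_integral b q f - LS_integral a q f \<le> (f a + \<epsilon>) * (q b - q a)"
    unfolding L const[symmetric] by (intro integral_mono int cint le)
  ultimately show ?thesis by (simp add: abs_le_iff algebra_simps)
qed

text \<open>Clamping to the single point 0 leaves a constant function, whose measure puts no mass at
  0.\<close>

lemma LS_integral_0:
  assumes "0 \<le> t"
  shows "LS_integral 0 q f = 0"
proof -
  have "emeasure (\<mu> 0) {0..0} \<le> emeasure (\<mu> 0) {-1<..0}" by (intro emeasure_mono) auto
  also have "\<dots> = 0" using assms by (simp add: mu_Ioc)
  finally have "{0::real} \<in> null_sets (\<mu> 0)" by (auto simp: null_sets_def)
  then have "AE s in \<mu> 0. s \<notin> {0}" by (rule AE_not_in)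
  then have "AE s in \<mu> 0. indicator {0..0} s * f s = 0" by (rule eventually_mono) auto
  then have "(\<integral>s. indicator {0..0} s * f s \<partial>\<mu> 0) = 0" by (rule integral_eq_zero_AE)
  then show ?thesis by (simp add: LS_integral_def \<mu>_def)
qed

end

text \<open>Walks back from s to 0 in m steps of length at most \<delta>. The increments of q
  telescope, so c is not multiplied by the number of steps; only K is.\<close>

lemma chain_bound:
  fixes D q :: "real \<Rightarrow> real"
  assumes "D 0 = 0" and step: "\<And>a b. 0 \<le> a \<Longrightarrow> a \<le> b \<Longrightarrow> b \<le> t \<Longrightarrow> b - a \<le> \<delta> \<Longrightarrow>
      \<bar>D b - D a\<bar> \<le> c * (q b - q a) + K"
    and "0 \<le> \<delta>" "0 \<le> K" and s: "0 \<le> s" "s \<le> t" "s \<le> real m * \<delta>"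
  shows "\<bar>D s\<bar> \<le> c * (q s - q 0) + real m * K"
  using s
proof (induction m arbitrary: s)
  case 0
  then show ?case using assms(1) by simp
next
  case (Suc m)
  define a where "a = max 0 (s - \<delta>)"
  have a: "0 \<le> a" "a \<le> s" "s - a \<le> \<delta>" "a \<le> real m * \<delta>"
    using Suc.prems assms(3) by (auto simp: a_def algebra_simps)
  have "\<bar>D a\<bar> \<le> c * (q a - q 0) + real m * K" using a Suc.prems by (intro Suc.IH) auto
  moreover have "\<bar>D s - D a\<bar> \<le> c * (q s - q a) + K" using a Suc.prems by (intro step) auto
  ultimately show ?case by (simp add: algebra_simps abs_le_iff)
qed

section \<open>Sums of squares along a single partition\<close>

context
  fixes T :: "nat \<Rightarrow> ennreal" and x :: "real \<Rightarrow> real" and t e :: real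
  assumes T: "mono T" "T 0 = 0"
    and osc: "\<And>k u v. 0 \<le> u \<Longrightarrow> u \<le> t \<Longrightarrow> 0 \<le> v \<Longrightarrow> v \<le> t \<Longrightarrow> T k \<le> ennreal u \<Longrightarrow> ennreal u \<le> T (Suc k) \<Longrightarrow>
      T k \<le> ennreal v \<Longrightarrow> ennreal v \<le> T (Suc k) \<Longrightarrow> \<bar>x u - x v\<bar> \<le> e"
begin

private definition "P k s = (x (cut (T (Suc k)) s) - x (cut (T k) s))\<^sup>2"

lemma cut_increment_le:
  assumes "0 \<le> s" "s \<le> t"
  shows "\<bar>x (cut (T (Suc k)) s) - x (cut (T k) s)\<bar> \<le> e"
proof -
  have "T k \<le> T (Suc k)" using T(1) by (simp add: mono_def)
  show ?thesis
  proof (cases "T k \<le> ennreal s")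
    case True
    then show ?thesis
      using assms \<open>T k \<le> T (Suc k)\<close> order_trans[OF cut_le[OF assms(1)] assms(2)]
      by (intro osc[of _ _ k]) (auto simp: ennreal_cut)
  next
    case False
    then have "cut (T k) s = s" "cut (T (Suc k)) s = s"
      using assms(1) \<open>T k \<le> T (Suc k)\<close> by (auto intro!: cut_eq)
    \<comment> \<open>The increment is 0 here; a step containing s is used only to see that e is
      nonnegative.\<close>
    moreover obtain i where "T i \<le> ennreal s" "ennreal s \<le> T (Suc i)"
      using ex_index[of T "ennreal s" k] False T(2) by (auto simp: not_le dest: less_imp_le)
    then have "\<bar>x s - x s\<bar> \<le> e" using assms by (intro osc[of s s i]) auto
    ultimately show ?thesis by simp
  qed
qed

lemma P_bounds: "0 \<le> s \<Longrightarrow> s \<le> t \<Longrightarrow> 0 \<le> P k s \<and> P k s \<le> e\<^sup>2"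
  using power_mono[OF cut_increment_le[of s k], of 2] by (simp add: P_def)

text \<open>Steps finished before a contribute nothing, and a later step that has begun by b has its
  sample time in [a, b], where f is close to f a. Only the step i in progress at a is sampled too
  early: there f is off by up to 2 * B, but the square changes by at most e^2. The extra \<epsilon>
  * e^2 pays for a possible decrease of that square.\<close>

lemma weighted_increment:
  assumes ab: "0 \<le> a" "a \<le> b" "b \<le> t" and N: "ennreal b < T N"
    and B: "\<And>u. 0 \<le> u \<Longrightarrow> u \<le> t \<Longrightarrow> \<bar>f u\<bar> \<le> B" and \<epsilon>: "\<And>u. a \<le> u \<Longrightarrow> u \<le> b \<Longrightarrow> \<bar>f u - f a\<bar> \<le> \<epsilon>"
  shows "\<bar>(\<Sum>k<N. (f (enn2real (T k)) - f a) * (P k b - P k a))\<bar> \<le>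
      \<epsilon> * (\<Sum>k<N. P k b - P k a) + (2 * B + \<epsilon>) * e\<^sup>2"
proof -
  have b0: "0 \<le> b" "a \<le> t" using ab by auto
  have le_ab: "ennreal a \<le> ennreal b" using ab by (intro ennreal_leI)
  have \<epsilon>0: "0 \<le> \<epsilon>" using \<epsilon>[of a] ab by simp
  have B0: "0 \<le> B" using B[of a] ab by (meson abs_ge_zero order_trans)
  obtain i where i: "i < N" "T i \<le> ennreal a" "ennreal a < T (Suc i)"
    using ex_index[of T "ennreal a" N] T(2) le_less_trans[OF le_ab N] by auto
  have "\<bar>(f (enn2real (T k)) - f a) * (P k b - P k a)\<bar> \<le>
      \<epsilon> * (P k b - P k a) + (if k = i then (2 * B + \<epsilon>) * e\<^sup>2 else 0)" for k
  proof -
    consider "k < i" | "k = i" | "i < k" by linarith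
    then show ?thesis
    proof cases
      case 1
      then have "T k \<le> T i" "T (Suc k) \<le> T i" using T(1) by (auto simp: mono_def)
      then have le: "T k \<le> ennreal a" "T (Suc k) \<le> ennreal a" using i(2) by (auto elim: order_trans)
      then have "T k \<le> ennreal b" "T (Suc k) \<le> ennreal b" using le_ab by (auto elim: order_trans)
      with le have "P k b = P k a" by (simp add: P_def cut_eq')
      then show ?thesis using 1 by simp
    next
      case 3
      then have "T (Suc i) \<le> T k" "T (Suc i) \<le> T (Suc k)" using T(1) by (auto simp: mono_def)
      then have "ennreal a \<le> T k" "ennreal a \<le> T (Suc k)" using i(3) by (auto dest: less_imp_le elim: order_trans)
      then have Pa: "P k a = 0" using ab by (simp add: P_def cut_eq)
      have Pb: "0 \<le> P k b" by (simp add: P_def)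
      show ?thesis
      proof (cases "T k \<le> ennreal b")
        case True
        have "T k < \<infinity>" by (rule le_ennreal_finite[OF True])
        then obtain r where r: "T k = ennreal r" "0 \<le> r" by (cases "T k") auto
        then have "a \<le> r" "r \<le> b" using True \<open>ennreal a \<le> T k\<close> ab b0 by (auto simp: ennreal_le_iff)
        then have "\<bar>f r - f a\<bar> \<le> \<epsilon>" by (rule \<epsilon>)
        then have "\<bar>f r - f a\<bar> * P k b \<le> \<epsilon> * P k b" using Pb by (rule mult_right_mono)
        then show ?thesis using Pa Pb r 3 by (simp add: abs_mult)
      next
        case False
        moreover have "T k \<le> T (Suc k)" using T(1) by (simp add: mono_def)
        ultimately have "cut (T k) b = b" "cut (T (Suc k)) b = b" using b0 by (auto intro!: cut_eq)
        then have "P k b = 0" by (simp add: P_def)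
        then show ?thesis using Pa 3 by simp
      qed
    next
      case 2
      have "T i < \<infinity>" by (rule le_ennreal_finite[OF i(2)])
      then obtain r where r: "T i = ennreal r" "0 \<le> r" by (cases "T i") auto
      then have "r \<le> t" using i(2) ab b0 by (simp add: ennreal_le_iff)
      have p: "0 \<le> P k a" "P k a \<le> e\<^sup>2" "0 \<le> P k b" "P k b \<le> e\<^sup>2"
        using P_bounds[of a k] P_bounds[of b k] ab b0 by simp_all
      have "\<bar>f r - f a\<bar> \<le> 2 * B"
        using B[of r] B[of a] r \<open>r \<le> t\<close> ab b0 by (simp add: abs_le_iff)
      moreover have "\<bar>P k b - P k a\<bar> \<le> e\<^sup>2" using p by (simp add: abs_le_iff)
      ultimately have "\<bar>f r - f a\<bar> * \<bar>P k b - P k a\<bar> \<le> 2 * B * e\<^sup>2" using B0 by (intro mult_mono) auto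
      moreover have "\<epsilon> * (P k a - P k b) \<le> \<epsilon> * e\<^sup>2" using p \<epsilon>0 by (intro mult_left_mono) auto
      moreover have "u \<le> 2 * B * d \<Longrightarrow> \<epsilon> * (y - z) \<le> \<epsilon> * d \<Longrightarrow> u \<le> \<epsilon> * (z - y) + (2 * B + \<epsilon>) * d" for u d y z
        by (simp add: algebra_simps)
      ultimately have "\<bar>f r - f a\<bar> * \<bar>P k b - P k a\<bar> \<le> \<epsilon> * (P k b - P k a) + (2 * B + \<epsilon>) * e\<^sup>2"
        by blast
      moreover have "enn2real (T k) = r" using 2 r by simp
      ultimately show ?thesis using 2 by (simp only: abs_mult if_True simp_thms)
    qed
  qed
  then have "(\<Sum>k<N. \<bar>(f (enn2real (T k)) - f a) * (P k b - P k a)\<bar>) \<le>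
     (\<Sum>k<N. \<epsilon> * (P k b - P k a) + (if k = i then (2 * B + \<epsilon>) * e\<^sup>2 else 0))" by (intro sum_mono)
  also have "\<dots> = \<epsilon> * (\<Sum>k<N. P k b - P k a) + (2 * B + \<epsilon>) * e\<^sup>2"
    using i(1) by (simp add: sum.distrib sum_distrib_left)
  finally show ?thesis by (rule order_trans[OF sum_abs])
qed

text \<open>The square in progress at a may shrink again when the path turns back, so sums of
  squares need not increase. This concerns a single step and at most e^2, which disappears in the
  limit.\<close>

lemma qsum_almost_mono:
  assumes ab: "0 \<le> a" "a \<le> b" "b \<le> t" and N: "ennreal b < T N"
  shows "qsum x T a - e\<^sup>2 \<le> qsum x T b"
proof -
  have b0: "0 \<le> b" using ab by simp
  have le_ab: "ennreal a \<le> ennreal b" using ab by (intro ennreal_leI)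
  have fin: "qsum x T b = (\<Sum>k<N. P k b)" "qsum x T a = (\<Sum>k<N. P k a)"
    using qsum_fin[OF b0 T(1), of N x] qsum_fin[OF ab(1) T(1), of N x] N le_ab
    by (auto simp: P_def)
  obtain i where i: "i < N" "T i \<le> ennreal a" "ennreal a < T (Suc i)"
    using ex_index[of T "ennreal a" N] T(2) le_less_trans[OF le_ab N] by auto
  have "P k a - (if k = i then e\<^sup>2 else 0) \<le> P k b" for k
  proof -
    consider "k < i" | "k = i" | "i < k" by linarith
    then show ?thesis
    proof cases
      case 1
      then have "T k \<le> T i" "T (Suc k) \<le> T i" using T(1) by (auto simp: mono_def)
      then have le: "T k \<le> ennreal a" "T (Suc k) \<le> ennreal a" using i(2) by (auto elim: order_trans)
      then have "T k \<le> ennreal b" "T (Suc k) \<le> ennreal b" using le_ab by (auto elim: order_trans)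
      with le have "P k b = P k a" by (simp add: P_def cut_eq')
      then show ?thesis using 1 by simp
    next
      case 2
      have "P k a \<le> e\<^sup>2" "0 \<le> P k b" using P_bounds ab by auto
      then show ?thesis using 2 by simp
    next
      case 3
      then have "T (Suc i) \<le> T k" "T (Suc i) \<le> T (Suc k)" using T(1) by (auto simp: mono_def)
      then have "ennreal a \<le> T k" "ennreal a \<le> T (Suc k)" using i(3) by (auto dest: less_imp_le elim: order_trans)
      then have "P k a = 0" using ab by (simp add: P_def cut_eq)
      then show ?thesis using 3 by (simp add: P_def)
    qed
  qed
  then have "(\<Sum>k<N. P k a - (if k = i then e\<^sup>2 else 0)) \<le> (\<Sum>k<N. P k b)" by (intro sum_mono)
  then show ?thesis using i(1) by (simp add: fin sum_subtractf)
qed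

definition weighted_qsum :: "(real \<Rightarrow> real) \<Rightarrow> real \<Rightarrow> real" where
  "weighted_qsum f s = (\<Sum>k. f (enn2real (T k)) * P k s)"

lemma weighted_qsum_fin:
  assumes "0 \<le> s" "ennreal s \<le> T N"
  shows "weighted_qsum f s = (\<Sum>k<N. f (enn2real (T k)) * P k s)"
  unfolding weighted_qsum_def
proof (rule suminf_finite)
  fix k assume "k \<notin> {..<N}"
  then have "T N \<le> T k" "T N \<le> T (Suc k)" using T(1) by (auto simp: mono_def)
  then have "cut (T k) s = s" "cut (T (Suc k)) s = s"
    using assms by (auto intro!: cut_eq intro: order_trans)
  then show "f (enn2real (T k)) * P k s = 0" by (simp add: P_def)
qed simp

lemma weighted_qsum_0 [simp]: "weighted_qsum f 0 = 0"
  by (simp add: weighted_qsum_def P_def)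

lemma weighted_qsum_increment:
  assumes ab: "0 \<le> a" "a \<le> b" "b \<le> t" and N: "ennreal b < T N"
    and B: "\<And>u. 0 \<le> u \<Longrightarrow> u \<le> t \<Longrightarrow> \<bar>f u\<bar> \<le> B" and \<epsilon>: "\<And>u. a \<le> u \<Longrightarrow> u \<le> b \<Longrightarrow> \<bar>f u - f a\<bar> \<le> \<epsilon>"
  shows "\<bar>weighted_qsum f b - weighted_qsum f a - f a * (qsum x T b - qsum x T a)\<bar>
    \<le> \<epsilon> * (qsum x T b - qsum x T a) + (2 * B + \<epsilon>) * e\<^sup>2"
proof -
  have b0: "0 \<le> b" using ab by simp
  have le: "ennreal b \<le> T N" "ennreal a \<le> T N"
    using N ennreal_leI[OF ab(2)] by (auto dest: less_imp_le elim: order_trans)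
  have q: "qsum x T b - qsum x T a = (\<Sum>k<N. P k b - P k a)"
    unfolding qsum_fin[OF b0 T(1) le(1)] qsum_fin[OF ab(1) T(1) le(2)] by (simp add: P_def sum_subtractf)
  have "weighted_qsum f b - weighted_qsum f a - f a * (qsum x T b - qsum x T a) =
      (\<Sum>k<N. (f (enn2real (T k)) - f a) * (P k b - P k a))"
    unfolding q weighted_qsum_fin[OF b0 le(1)] weighted_qsum_fin[OF ab(1) le(2)]
    by (simp add: sum_distrib_left algebra_simps flip: sum_subtractf sum.distrib)
  then show ?thesis
    unfolding q using weighted_increment[where f = f and B = B and \<epsilon> = \<epsilon>, OF ab N B \<epsilon>] by simp
qed

text \<open>The expansion of \<open>taylor2\<close> is summed over the steps. Fineness keeps
  intermediate points within e of the value at the start of the step, so F'' moves by at most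
  \<rho>.\<close>

lemma taylor_sum:
  fixes F F' F'' :: "real \<Rightarrow> real"
  assumes F: "\<And>x. (F has_real_derivative F' x) (at x)" and F': "\<And>x. (F' has_real_derivative F'' x) (at x)"
    and \<rho>: "\<And>u \<xi>. 0 \<le> u \<Longrightarrow> u \<le> t \<Longrightarrow> \<bar>\<xi> - x u\<bar> \<le> e \<Longrightarrow> \<bar>F'' \<xi> - F'' (x u)\<bar> \<le> \<rho>"
    and s: "0 \<le> s" "s \<le> t" and N: "ennreal s \<le> T N"
  shows "\<bar>F (x s) - F (x 0) - gsum (\<lambda>k. F' (x (enn2real (T k)))) x T s - weighted_qsum (\<lambda>u. F'' (x u)) s / 2\<bar>
    \<le> \<rho> / 2 * qsum x T s"
proof -
  let ?d = "\<lambda>k. x (cut (T (Suc k)) s) - x (cut (T k) s)"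
  have "\<bar>F (x (cut (T (Suc k)) s)) - F (x (cut (T k) s)) - F' (x (enn2real (T k))) * ?d k
      - F'' (x (enn2real (T k))) / 2 * (?d k)\<^sup>2\<bar> \<le> \<rho> / 2 * (?d k)\<^sup>2" for k
  proof (cases "T k \<le> ennreal s")
    case True
    have c: "cut (T k) s = enn2real (T k)" using True by (rule cut_eq')
    have u: "0 \<le> cut (T k) s" "cut (T k) s \<le> t" using s order_trans[OF cut_le[OF s(1)] s(2)] by auto
    show ?thesis
      unfolding c[symmetric] by (rule taylor2[OF F F']) (meson \<rho>[OF u] cut_increment_le[OF s] order_trans)
  next
    case False
    moreover have "T k \<le> T (Suc k)" using T(1) by (simp add: mono_def)
    ultimately have "cut (T k) s = s" "cut (T (Suc k)) s = s" using s by (auto intro!: cut_eq)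
    then show ?thesis by simp
  qed
  then have "(\<Sum>k<N. \<bar>F (x (cut (T (Suc k)) s)) - F (x (cut (T k) s)) - F' (x (enn2real (T k))) * ?d k
      - F'' (x (enn2real (T k))) / 2 * (?d k)\<^sup>2\<bar>) \<le> (\<Sum>k<N. \<rho> / 2 * (?d k)\<^sup>2)" by (intro sum_mono)
  then have "\<bar>\<Sum>k<N. F (x (cut (T (Suc k)) s)) - F (x (cut (T k) s)) - F' (x (enn2real (T k))) * ?d k
      - F'' (x (enn2real (T k))) / 2 * (?d k)\<^sup>2\<bar> \<le> (\<Sum>k<N. \<rho> / 2 * (?d k)\<^sup>2)"
    by (rule order_trans[OF sum_abs])
  moreover have "(\<Sum>k<N. F (x (cut (T (Suc k)) s)) - F (x (cut (T k) s)) - F' (x (enn2real (T k))) * ?d k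
      - F'' (x (enn2real (T k))) / 2 * (?d k)\<^sup>2) =
      F (x s) - F (x 0) - gsum (\<lambda>k. F' (x (enn2real (T k)))) x T s - weighted_qsum (\<lambda>u. F'' (x u)) s / 2"
    unfolding sum_subtractf telescope_cut[OF s(1) T(2) N, of "\<lambda>u. F (x u)", symmetric]
      gsum_fin[OF s(1) T(1) N] weighted_qsum_fin[OF s(1) N]
    by (simp add: P_def sum_divide_distrib)
  ultimately show ?thesis
    unfolding qsum_fin[OF s(1) T(1) N] by (simp add: sum_distrib_left)
qed

end

section \<open>Passage to the limit along a fine sequence of partitions\<close>

context
  fixes T :: "nat \<Rightarrow> nat \<Rightarrow> ennreal" and x q F F' F'' :: "real \<Rightarrow> real" and t :: real and e :: "nat \<Rightarrow> real"
  assumes t: "0 \<le> t" and cont: "continuous_on {0..t} x"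
    and T: "\<And>n. mono (T n)" "\<And>n. T n 0 = 0" and exN: "\<And>n. \<exists>N. ennreal t < T n N"
    and osc: "\<And>n k u v. 0 \<le> u \<Longrightarrow> u \<le> t \<Longrightarrow> 0 \<le> v \<Longrightarrow> v \<le> t \<Longrightarrow> T n k \<le> ennreal u \<Longrightarrow> ennreal u \<le> T n (Suc k) \<Longrightarrow>
      T n k \<le> ennreal v \<Longrightarrow> ennreal v \<le> T n (Suc k) \<Longrightarrow> \<bar>x u - x v\<bar> \<le> e n"
    and e: "\<And>n. 0 \<le> e n" "e \<longlonglongrightarrow> 0"
    and F: "\<And>x. (F has_real_derivative F' x) (at x)" and F': "\<And>x. (F' has_real_derivative F'' x) (at x)"
    and F'': "continuous_on UNIV F''"
    and lim: "uniform_limit {0..t} (\<lambda>n. qsum x (T n)) q sequentially"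
begin

private lemma exceeds:
  assumes "s \<le> t"
  shows "\<exists>N. ennreal s < T n N"
  using exN[of n] ennreal_leI[OF assms] le_less_trans by blast

private lemma q_0: "q 0 = 0"
proof -
  have "(\<lambda>n. qsum x (T n) 0) \<longlonglongrightarrow> q 0" by (rule tendsto_uniform_limitI[OF lim]) (use t in simp)
  then show ?thesis by (simp add: LIMSEQ_const_iff)
qed

private lemma q_mono:
  assumes ab: "0 \<le> a" "a \<le> b" "b \<le> t"
  shows "q a \<le> q b"
proof (rule LIMSEQ_le)
  have "(\<lambda>n. qsum x (T n) a - (e n)\<^sup>2) \<longlonglongrightarrow> q a - 0\<^sup>2"
    using ab by (intro tendsto_diff tendsto_power e tendsto_uniform_limitI[OF lim]) auto
  then show "(\<lambda>n. qsum x (T n) a - (e n)\<^sup>2) \<longlonglongrightarrow> q a" by simp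
  show "(\<lambda>n. qsum x (T n) b) \<longlonglongrightarrow> q b"
    using ab by (intro tendsto_uniform_limitI[OF lim]) auto
  have "qsum x (T n) a - (e n)\<^sup>2 \<le> qsum x (T n) b" for n
  proof -
    obtain N where N: "ennreal b < T n N" using exceeds[OF ab(3)] by blast
    show ?thesis by (rule qsum_almost_mono[where T = "T n" and t = t and e = "e n", OF T osc ab N])
  qed
  then show "\<exists>N. \<forall>n\<ge>N. qsum x (T n) a - (e n)\<^sup>2 \<le> qsum x (T n) b" by blast
qed

text \<open>Summation by parts expresses each sum of squares through x and a left-point sum, both
  continuous, and uniform limits preserve continuity.\<close>

private lemma q_continuous: "continuous_on {0..t} q"
proof (rule uniform_limit_theorem[OF always_eventually lim])
  show "\<forall>n. continuous_on {0..t} (qsum x (T n))"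
  proof
    fix n
    obtain N where "ennreal t < T n N" using exN by blast
    then have N: "ennreal t \<le> T n N" by simp
    have "continuous_on {0..t} (\<lambda>s. (x s)\<^sup>2 - (x 0)\<^sup>2 - 2 * gsum (\<lambda>k. x (enn2real (T n k))) x (T n) s)"
      by (intro continuous_intros cont continuous_on_gsum[OF cont T(1) N])
    then show "continuous_on {0..t} (qsum x (T n))"
    proof (rule continuous_on_eq)
      fix s assume s: "s \<in> {0..t}"
      then have "ennreal s \<le> ennreal t" by (intro ennreal_leI) simp
      then have "ennreal s \<le> T n N" using N by (rule order_trans)
      then show "(x s)\<^sup>2 - (x 0)\<^sup>2 - 2 * gsum (\<lambda>k. x (enn2real (T n k))) x (T n) s = qsum x (T n) s"
        using s by (intro qsum_gsum[symmetric] T) auto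
    qed
  qed
qed simp

private definition "f s = F'' (x s)"

private lemma f_continuous: "continuous_on {0..t} f"
  unfolding f_def[abs_def] by (rule continuous_on_compose2[OF F'' cont]) auto

text \<open>On short steps [a, b] f is almost constant, so the increments of both sides are nearly f
  a times those of their integrators, which are uniformly close. The order of choice matters:
  \<epsilon>, then \<delta> and m, and only then \<eta>, because the error from \<eta> is multiplied
  by the number m of steps.\<close>

private lemma weighted_qsum_limit:
  assumes r: "0 < r"
  shows "\<forall>\<^sub>F n in sequentially. \<forall>s\<in>{0..t}. \<bar>weighted_qsum (T n) x f s - LS_integral s q f\<bar> \<le> r"
proof -
  have "bounded (f ` {0..t})" by (intro compact_imp_bounded compact_continuous_image f_continuous) auto
  then obtain B0 where B0: "\<forall>u\<in>{0..t}. \<bar>f u\<bar> \<le> B0" by (auto simp: bounded_iff)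
  define B where "B = max 0 B0"
  have B: "0 \<le> B" and fB: "\<And>u. 0 \<le> u \<Longrightarrow> u \<le> t \<Longrightarrow> \<bar>f u\<bar> \<le> B"
    using B0 by (auto simp: B_def le_max_iff_disj)
  have qt: "0 \<le> q t" using q_mono[of 0 t] q_0 t by simp
  \<comment> \<open>Chosen so that the telescoped error 2 * \<epsilon> * q t is at most r/2; the
    added 1 covers q t = 0.\<close>
  define \<epsilon> where "\<epsilon> = r / (4 * (q t + 1))"
  have \<epsilon>: "0 < \<epsilon>" using r qt by (simp add: \<epsilon>_def)
  have "\<epsilon> * (4 * (q t + 1)) = r"
    using qt by (subst nonzero_eq_divide_eq[symmetric]) (auto simp: \<epsilon>_def)
  then have \<epsilon>q: "2 * \<epsilon> * q t \<le> r / 2" using \<epsilon> by (simp add: algebra_simps)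
  have "uniformly_continuous_on {0..t} f"
    by (intro compact_uniformly_continuous f_continuous) auto
  then obtain \<delta>' where \<delta>': "0 < \<delta>'"
    "\<And>u v. u \<in> {0..t} \<Longrightarrow> v \<in> {0..t} \<Longrightarrow> dist v u < \<delta>' \<Longrightarrow> dist (f v) (f u) < \<epsilon>"
    using \<epsilon> by (rule uniformly_continuous_onE) (rule that, assumption+)
  define \<delta> where "\<delta> = \<delta>' / 2"
  have \<delta>: "0 < \<delta>" using \<delta>'(1) by (simp add: \<delta>_def)
  have f\<delta>: "\<bar>f u - f a\<bar> \<le> \<epsilon>" if "0 \<le> a" "a \<le> u" "u \<le> t" "u - a \<le> \<delta>" for a u
  proof -
    have "dist u a < \<delta>'" using that \<delta>'(1) by (simp add: dist_real_def \<delta>_def)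
    then have "dist (f u) (f a) < \<epsilon>" using that by (intro \<delta>'(2)) auto
    then show ?thesis by (simp add: dist_real_def)
  qed
  obtain m :: nat where m: "t / \<delta> \<le> real m" using real_arch_simple by blast
  then have m: "t \<le> real m * \<delta>" using \<delta> by (simp add: divide_le_eq)
  \<comment> \<open>The coefficient of \<eta> after m steps. Each step contributes 2 * B from
    replacing Q by p in f a * Q, 2 * B + \<epsilon> from the squared fineness, and 2 * \<epsilon>
    from \<epsilon> * Q.\<close>
  define C where "C = real m * (4 * B + 3 * \<epsilon>)"
  have C: "0 \<le> C" using B \<epsilon> by (simp add: C_def)
  define \<eta> where "\<eta> = r / (2 * (C + 1))"
  have \<eta>: "0 < \<eta>" using r C by (simp add: \<eta>_def)
  have "\<eta> * (2 * (C + 1)) = r"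
    using C by (subst nonzero_eq_divide_eq[symmetric]) (auto simp: \<eta>_def)
  then have C\<eta>: "C * \<eta> \<le> r / 2" using \<eta> by (simp add: algebra_simps)
  have "\<forall>\<^sub>F n in sequentially. (e n)\<^sup>2 < \<eta>"
    using order_tendstoD(2)[OF tendsto_power[OF e(2), of 2], of \<eta>] \<eta> by simp
  with uniform_limitD[OF lim \<eta>] show ?thesis
  proof eventually_elim
    case (elim n)
    have near: "\<bar>qsum x (T n) s - q s\<bar> < \<eta>" if "0 \<le> s" "s \<le> t" for s
      using elim(1) that by (simp add: dist_real_def)
    define D where "D s = weighted_qsum (T n) x f s - LS_integral s q f" for s
    show ?case
    proof
      fix s assume s: "s \<in> {0..t}"
      have "\<bar>D s\<bar> \<le> 2 * \<epsilon> * (q s - q 0) + real m * ((4 * B + 3 * \<epsilon>) * \<eta>)"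
      proof (rule chain_bound[where \<delta> = \<delta> and t = t])
        show "D 0 = 0"
          using LS_integral_0[where t = t and q = q and f = f, OF q_mono q_continuous f_continuous t]
          by (simp add: D_def weighted_qsum_0[where T = "T n" and t = t and e = "e n", OF T osc])
        show "0 \<le> \<delta>" using \<delta> by simp
        show "0 \<le> (4 * B + 3 * \<epsilon>) * \<eta>" using B \<epsilon> \<eta> by simp
        show "0 \<le> s" "s \<le> t" "s \<le> real m * \<delta>" using s m by auto
        fix a b assume ab: "0 \<le> a" "a \<le> b" "b \<le> t" "b - a \<le> \<delta>"
        have osc_f: "\<bar>f u - f a\<bar> \<le> \<epsilon>" if "a \<le> u" "u \<le> b" for u
          using that ab by (intro f\<delta>) auto
        obtain N where N: "ennreal b < T n N" using exceeds[OF ab(3)] by blast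
        define Q where "Q = qsum x (T n) b - qsum x (T n) a"
        define p where "p = q b - q a"
        have p: "0 \<le> p" using q_mono[OF ab(1-3)] by (simp add: p_def)
        have W: "\<bar>weighted_qsum (T n) x f b - weighted_qsum (T n) x f a - f a * Q\<bar> \<le> \<epsilon> * Q + (2 * B + \<epsilon>) * (e n)\<^sup>2"
          unfolding Q_def
          by (rule weighted_qsum_increment[where T = "T n" and t = t and x = x and e = "e n" and a = a and b = b and N = N
                and f = f and B = B and \<epsilon> = \<epsilon>, OF T osc ab(1-3) N fB osc_f])
        have L: "\<bar>LS_integral b q f - LS_integral a q f - f a * p\<bar> \<le> \<epsilon> * p"
          unfolding p_def
          by (rule LS_integral_diff[where t = t and q = q and f = f and a = a and b = b and \<epsilon> = \<epsilon>, OF q_mono q_continuous f_continuous ab(1-3) osc_f])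
        have Qp: "\<bar>Q - p\<bar> \<le> 2 * \<eta>"
          using near[of a] near[of b] ab by (simp add: Q_def p_def abs_le_iff abs_less_iff)
        have "\<bar>f a * (Q - p)\<bar> \<le> B * (2 * \<eta>)"
          unfolding abs_mult using fB[of a] ab Qp B by (intro mult_mono) auto
        moreover have "\<epsilon> * Q \<le> \<epsilon> * (p + 2 * \<eta>)" using Qp \<epsilon> by (intro mult_left_mono) auto
        moreover have "(2 * B + \<epsilon>) * (e n)\<^sup>2 \<le> (2 * B + \<epsilon>) * \<eta>"
          using elim(2) B \<epsilon> by (intro mult_left_mono) auto
        moreover have "D b - D a = (weighted_qsum (T n) x f b - weighted_qsum (T n) x f a - f a * Q)
            - (LS_integral b q f - LS_integral a q f - f a * p) + f a * (Q - p)"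
          by (simp add: D_def algebra_simps)
        ultimately have "\<bar>D b - D a\<bar> \<le> \<epsilon> * (p + 2 * \<eta>) + (2 * B + \<epsilon>) * \<eta> + \<epsilon> * p + B * (2 * \<eta>)"
          using W L by linarith
        also have "\<dots> = 2 * \<epsilon> * p + (4 * B + 3 * \<epsilon>) * \<eta>" by (simp add: algebra_simps)
        finally show "\<bar>D b - D a\<bar> \<le> 2 * \<epsilon> * (q b - q a) + (4 * B + 3 * \<epsilon>) * \<eta>" by (simp add: p_def)
      qed
      also have "\<dots> \<le> 2 * \<epsilon> * q t + C * \<eta>"
        using q_mono[of s t] s q_0 \<epsilon> by (simp add: C_def mult.assoc)
      also have "\<dots> \<le> r" using \<epsilon>q C\<eta> by simp
      finally show "\<bar>weighted_qsum (T n) x f s - LS_integral s q f\<bar> \<le> r" by (simp add: D_def)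
    qed
  qed
qed

text \<open>The Taylor remainder is at most \<rho>/2 times a sum of squares that is eventually below
  q t + 1, hence at most r/2. Replacing half the weighted sum by half the integral costs r/4, and
  3r/4 < r.\<close>

lemma pathwise_Ito:
  "uniform_limit {0..t} (\<lambda>n s. gsum (\<lambda>k. F' (x (enn2real (T n k)))) x (T n) s)
    (\<lambda>s. F (x s) - F (x 0) - 1/2 * LS_integral s q (\<lambda>s. F'' (x s))) sequentially"
proof (rule uniform_limitI)
  fix r :: real assume r: "0 < r"
  have qt: "0 \<le> q t" using q_mono[of 0 t] q_0 t by simp
  have "bounded (x ` {0..t})" by (intro compact_imp_bounded compact_continuous_image cont) auto
  then obtain K where K: "\<forall>u\<in>{0..t}. \<bar>x u\<bar> \<le> K" by (auto simp: bounded_iff)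
  define \<rho> where "\<rho> = r / (q t + 1)"
  have \<rho>: "0 < \<rho>" using r qt by (simp add: \<rho>_def)
  have \<rho>q: "\<rho> * (q t + 1) = r" using qt by (subst nonzero_eq_divide_eq[symmetric]) (auto simp: \<rho>_def)
  have "uniformly_continuous_on {-(K+1)..K+1} F''"
    by (intro compact_uniformly_continuous continuous_on_subset[OF F'']) auto
  then obtain \<theta> where \<theta>: "0 < \<theta>"
    "\<And>u v. u \<in> {-(K+1)..K+1} \<Longrightarrow> v \<in> {-(K+1)..K+1} \<Longrightarrow> dist v u < \<theta> \<Longrightarrow> dist (F'' v) (F'' u) < \<rho>"
    using \<rho> by (rule uniformly_continuous_onE) (rule that, assumption+)
  \<comment> \<open>Below 1, so that \<xi> stays in [-(K + 1), K + 1], where F'' is uniformly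
    continuous.\<close>
  have "\<forall>\<^sub>F n in sequentially. e n < min 1 \<theta>" 
    using order_tendstoD(2)[OF e(2), of "min 1 \<theta>"] \<theta>(1) by simp
  moreover have "\<forall>\<^sub>F n in sequentially. \<forall>s\<in>{0..t}. dist (qsum x (T n) s) (q s) < 1"
    by (rule uniform_limitD[OF lim]) simp
  moreover have "\<forall>\<^sub>F n in sequentially. \<forall>s\<in>{0..t}. \<bar>weighted_qsum (T n) x f s - LS_integral s q f\<bar> \<le> r / 2"
    using r by (intro weighted_qsum_limit) simp
  ultimately show "\<forall>\<^sub>F n in sequentially. \<forall>s\<in>{0..t}.
    dist (gsum (\<lambda>k. F' (x (enn2real (T n k)))) x (T n) s)
      (F (x s) - F (x 0) - 1/2 * LS_integral s q (\<lambda>s. F'' (x s))) < r"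
  proof eventually_elim
    case (elim n)
    show ?case
    proof
      fix s assume s: "s \<in> {0..t}"
      obtain N where "ennreal s < T n N" using exceeds[of s n] s by auto
      then have N: "ennreal s \<le> T n N" by simp
      have \<rho>': "\<bar>F'' \<xi> - F'' (x u)\<bar> \<le> \<rho>" if "0 \<le> u" "u \<le> t" "\<bar>\<xi> - x u\<bar> \<le> e n" for u \<xi>
      proof -
        have "\<bar>x u\<bar> \<le> K" using K that by simp
        then have "dist (F'' \<xi>) (F'' (x u)) < \<rho>"
          using that(3) elim(1) by (intro \<theta>(2)) (auto simp: dist_real_def)
        then show ?thesis by (simp add: dist_real_def)
      qed
      define g where "g = gsum (\<lambda>k. F' (x (enn2real (T n k)))) x (T n) s"
      define w where "w = weighted_qsum (T n) x f s"
      define L where "L = LS_integral s q f"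
      have "\<bar>F (x s) - F (x 0) - g - w / 2\<bar> \<le> \<rho> / 2 * qsum x (T n) s"
        unfolding g_def w_def f_def[abs_def]
        by (rule taylor_sum[where T = "T n" and t = t and x = x and e = "e n" and F = F and F' = F' and F'' = F''
              and \<rho> = \<rho> and s = s and N = N, OF T osc F F' \<rho>' _ _ N]) (use s in auto)
      also have "\<dots> \<le> \<rho> / 2 * (q t + 1)"
      proof (rule mult_left_mono)
        have "q s \<le> q t" using s by (intro q_mono) auto
        moreover have "\<bar>qsum x (T n) s - q s\<bar> < 1" using elim(2) s by (simp add: dist_real_def)
        ultimately show "qsum x (T n) s \<le> q t + 1" by linarith
      qed (use \<rho> in simp)
      also have "\<dots> = r / 2" using \<rho>q by simp
      finally have 1: "\<bar>F (x s) - F (x 0) - g - w / 2\<bar> \<le> r / 2" .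
      have 2: "\<bar>w - L\<bar> \<le> r / 2" using elim(3) s by (simp add: w_def L_def)
      have "\<bar>g - (F (x s) - F (x 0) - 1/2 * L)\<bar> < r" using 1 2 r by linarith
      then show "dist (gsum (\<lambda>k. F' (x (enn2real (T n k)))) x (T n) s)
        (F (x s) - F (x 0) - 1/2 * LS_integral s q (\<lambda>s. F'' (x s))) < r"
        by (simp add: dist_real_def g_def L_def f_def[abs_def])
    qed
  qed
qed

end

section \<open>The change of variables formula\<close>

lemma fine_for_semimartD:
  assumes "fine_for_semimart J Js X T"
  shows "partition J Js (T n)" "osc_fine J X T"
  using assms fine_for_semimart_osc_fine[OF assms] unfolding fine_for_semimart_def by blast+

theorem theorem6:
  fixes J Js :: nat and F F' F'' :: "real \<Rightarrow> real" and X :: cprocess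
  assumes "1 \<le> Js" and "Js \<le> J"
    and "\<And>x. (F has_real_derivative F' x) (at x)"
    and "\<And>x. (F' has_real_derivative F'' x) (at x)"
    and "continuous_on UNIV F''"
    and "cont_semimartingale J Js X"
  shows "\<exists>I Q. is_ito_integral J Js (\<lambda>t \<omega>. map_option F' (X t \<omega>)) X I \<and>
           is_quadratic_variation J Js X Q \<and>
           quasi_always J Js (\<lambda>t \<omega>. X t \<omega> \<noteq> None \<and> I t \<omega> \<noteq> None \<and>
              (\<forall>s\<in>{0..t}. X s \<omega> \<noteq> None \<and> Q s \<omega> \<noteq> None) \<and>
              F (the (X t \<omega>)) = F (the (X 0 \<omega>)) + the (I t \<omega>)
                + 1/2 * LS_integral t (\<lambda>s. the (Q s \<omega>)) (\<lambda>s. F'' (the (X s \<omega>))))"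
proof -
  obtain Y A where d: "semimart_decomp J Js X Y A"
    using assms(6) by (auto simp: cont_semimartingale_def)
  have Y: "Y \<in> cont_martingale J Js" and cA: "cont_process J Js A"
    using d unfolding semimart_decomp_def fv_process_def by blast+
  have cY: "cont_process J Js Y" by (rule cont_martingale_cont_process[OF Y assms(2)])
  have dec: "X t \<omega> \<noteq> None \<longleftrightarrow> Y t \<omega> \<noteq> None" "X t \<omega> \<noteq> None \<longleftrightarrow> A t \<omega> \<noteq> None"
    "X t \<omega> \<noteq> None \<Longrightarrow> the (X t \<omega>) = the (Y t \<omega>) + the (A t \<omega>)" if "0 \<le> t" "\<omega> \<in> Omega J" for t \<omega>
    using d that unfolding semimart_decomp_def by blast+
  have dom: "X s \<omega> \<noteq> None" if "\<omega> \<in> Omega J" "0 \<le> t" "X t \<omega> \<noteq> None" "s \<in> {0..t}" for s t \<omega>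
  proof -
    have "A t \<omega> \<noteq> None" using dec(2)[OF that(2,1)] that(3) by blast
    from cont_process_dom[of J Js A, OF cA that(1) this that(4)]
    show ?thesis using dec(2)[of s \<omega>] that by auto
  qed
  have qX: "quasi_always J Js (\<lambda>t \<omega>. X t \<omega> \<noteq> None)"
  proof (rule quasi_always_mono)
    show "quasi_always J Js (\<lambda>t \<omega>. A t \<omega> \<noteq> None)" using cA unfolding cont_process_def by blast
  qed (use dec(2) in blast)
  define x where "x t \<omega> = the (X t \<omega>)" for t \<omega>
  have contX: "continuous_on {0..t} (\<lambda>s. x s \<omega>)" if \<omega>: "\<omega> \<in> Omega J" and t: "0 \<le> t" "X t \<omega> \<noteq> None" for t \<omega>
  proof -
    have "Y t \<omega> \<noteq> None" "A t \<omega> \<noteq> None" using dec(1,2)[OF t(1) \<omega>] t(2) by blast+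
    then have "continuous_on {0..t} (\<lambda>s. the (Y s \<omega>) + the (A s \<omega>))"
      by (intro continuous_on_add cont_process_continuous[of J Js Y, OF cY \<omega>]
          cont_process_continuous[of J Js A, OF cA \<omega>])
    then show ?thesis
    proof (rule continuous_on_eq)
      fix s assume s: "s \<in> {0..t}"
      then show "the (Y s \<omega>) + the (A s \<omega>) = x s \<omega>"
        using dec(3)[of s \<omega>] dom[OF \<omega> t s] \<omega> by (simp add: x_def)
    qed
  qed
  \<comment> \<open>One fixed fine sequence defines q, and \<open>qsum_same_limit\<close> carries
    the limit over to all others, including those that are fine for another decomposition of
    X.\<close>
  obtain q where q: "\<And>T. fine_for_semimart J Js X T \<Longrightarrow> quasi_always J Js (\<lambda>t \<omega>.
      uniform_limit {0..t} (\<lambda>n s. qsum (\<lambda>s. x s \<omega>) (\<lambda>k. T n k \<omega>) s) (\<lambda>s. q s \<omega>) sequentially)"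
  proof (cases "\<exists>T. fine_for_semimart J Js X T")
    case False
    then show ?thesis using that by blast
  next
    case True
    then obtain T where T: "fine_for_semimart J Js X T" by blast
    show ?thesis
    proof (rule that)
      fix S assume S: "fine_for_semimart J Js X S"
      show "quasi_always J Js (\<lambda>t \<omega>. uniform_limit {0..t} (\<lambda>n s. qsum (\<lambda>s. x s \<omega>) (\<lambda>k. S n k \<omega>) s)
        (\<lambda>s. lim (\<lambda>n. qsum (\<lambda>s. x s \<omega>) (\<lambda>k. T n k \<omega>) s)) sequentially)"
        unfolding x_def
        by (rule qsum_same_limit[OF assms(2) d fine_for_semimartD[OF T] fine_for_semimartD[OF S]])
    qed
  qed
  \<comment> \<open>The formula holds by the choice of \<open>I\<close>; the content is that \<open>I\<close> is the Ito integral. If there is no fine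
    sequence of partitions, then \<open>q\<close> and \<open>I\<close> are unconstrained.\<close>
  define L where "L t \<omega> = LS_integral t (\<lambda>s. q s \<omega>) (\<lambda>s. F'' (x s \<omega>))" for t \<omega>
  define I where "I t \<omega> = F (x t \<omega>) - F (x 0 \<omega>) - 1/2 * L t \<omega>" for t \<omega>
  have qv: "is_quadratic_variation J Js X (\<lambda>t \<omega>. Some (q t \<omega>))"
    unfolding is_quadratic_variation_def ucqa_def qv_sum_qsum
  proof (intro allI impI)
    fix T assume "fine_for_semimart J Js X T"
    from q[OF this]
    show "quasi_always J Js (\<lambda>t \<omega>. (\<forall>s\<in>{0..t}. Some (q s \<omega>) \<noteq> None) \<and>
      uniform_limit {0..t} (\<lambda>k s. qsum (\<lambda>s. the (X s \<omega>)) (\<lambda>ka. T k ka \<omega>) s) (\<lambda>s. the (Some (q s \<omega>))) sequentially)"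
      by (simp add: x_def)
  qed
  have ito: "is_ito_integral J Js (\<lambda>t \<omega>. map_option F' (X t \<omega>)) X (\<lambda>t \<omega>. Some (I t \<omega>))"
    unfolding is_ito_integral_def ucqa_def
  proof (intro allI impI, elim conjE)
    fix T assume T: "fine_for_semimart J Js X T"
    note part = fine_for_semimartD[OF T]
    have seq: "path_sequence J (T n)" for n by (rule partition_path_sequence[OF part(1)])
    \<comment> \<open>The pathwise argument takes all partitions of the sequence at once, so their
      exceptional sets are collected.\<close>
    have exN: "quasi_always J Js (\<lambda>t \<omega>. \<forall>n. \<exists>N. ennreal t < T n N \<omega>)"
      by (rule quasi_always_all[OF partition_exceeds[OF part(1)]])
    show "quasi_always J Js (\<lambda>t \<omega>. (\<forall>s\<in>{0..t}. Some (I s \<omega>) \<noteq> None) \<and>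
      uniform_limit {0..t} (\<lambda>k s. riemann_sum (\<lambda>t \<omega>. map_option F' (X t \<omega>)) X (T k) s \<omega>)
        (\<lambda>s. the (Some (I s \<omega>))) sequentially)"
    proof (rule quasi_always_mono[OF quasi_always_conj[OF quasi_always_conj[OF qX exN] q[OF T]]], elim conjE)
      fix t :: real and \<omega> assume t: "0 \<le> t" and \<omega>: "\<omega> \<in> Omega J" and Xt: "X t \<omega> \<noteq> None"
        and N: "\<forall>n. \<exists>N. ennreal t < T n N \<omega>"
        and lim: "uniform_limit {0..t} (\<lambda>n s. qsum (\<lambda>s. x s \<omega>) (\<lambda>k. T n k \<omega>) s) (\<lambda>s. q s \<omega>) sequentially"
      have m: "mono (\<lambda>k. T n k \<omega>)" for n by (rule path_sequenceD(3)[OF seq \<omega>])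
      have u: "uniform_limit {0..t} (\<lambda>n s. gsum (\<lambda>k. F' (x (enn2real (T n k \<omega>)) \<omega>)) (\<lambda>s. x s \<omega>) (\<lambda>k. T n k \<omega>) s)
        (\<lambda>s. F (x s \<omega>) - F (x 0 \<omega>) - 1/2 * LS_integral s (\<lambda>s. q s \<omega>) (\<lambda>s. F'' (x s \<omega>))) sequentially"
      proof (rule pathwise_Ito[where e = "\<lambda>n. 2 * (1/2)^n" and t = t and x = "\<lambda>s. x s \<omega>" and
            q = "\<lambda>s. q s \<omega>" and T = "\<lambda>n k. T n k \<omega>" and F = F and F' = F' and F'' = F''])
        show "T n 0 \<omega> = 0" for n by (rule path_sequenceD(2)[OF seq \<omega>])
        show "\<exists>N. ennreal t < T n N \<omega>" for n using N by blast
        show "(\<lambda>n. 2 * (1/2::real)^n) \<longlonglongrightarrow> 0"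
          by (intro tendsto_mult_right_zero LIMSEQ_realpow_zero) auto
        fix n k u v
        assume u: "0 \<le> u" "u \<le> t" and v: "0 \<le> v" "v \<le> t"
          and k: "T n k \<omega> \<le> ennreal u" "ennreal u \<le> T n (Suc k) \<omega>" "T n k \<omega> \<le> ennreal v" "ennreal v \<le> T n (Suc k) \<omega>"
        have "X u \<omega> \<noteq> None" "X v \<omega> \<noteq> None" by (rule dom[OF \<omega> t Xt], use u v in simp)+
        then show "\<bar>x u \<omega> - x v \<omega>\<bar> \<le> 2 * (1/2)^n"
          unfolding x_def
          using osc_fineD[where n = n and k = k and J = J and X = X and T = T and s = u and s' = v and \<omega> = \<omega>]
            part(2) \<omega> u v k by blast
      qed (simp_all add: t contX[OF \<omega> t Xt] m assms(3,4,5) lim)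
      \<comment> \<open>X is defined on [0, t], so \<open>map_option F'\<close> returns F' of its
        value at every sample time up to s; later sample times carry vanishing increments.\<close>
      have riem: "riemann_sum (\<lambda>t \<omega>. map_option F' (X t \<omega>)) X (T n) s \<omega> =
        gsum (\<lambda>k. F' (x (enn2real (T n k \<omega>)) \<omega>)) (\<lambda>s. x s \<omega>) (\<lambda>k. T n k \<omega>) s" if s: "s \<in> {0..t}" for n s
      proof -
        have s0: "0 \<le> s" using s by simp
        show ?thesis
          unfolding riemann_sum_gsum[where T = "T n" and \<omega> = \<omega>, OF s0 m]
        proof (rule gsum_cong[OF s0 m m refl])
          fix k assume k: "T n k \<omega> \<le> ennreal s"
          then have "enn2real (T n k \<omega>) \<le> s" using enn2real_mono[OF k] s0 by simp
          then have "X (enn2real (T n k \<omega>)) \<omega> \<noteq> None" using s by (intro dom[OF \<omega> t Xt]) auto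
          then show "the (map_option F' (X (enn2real (T n k \<omega>)) \<omega>)) = F' (x (enn2real (T n k \<omega>)) \<omega>)"
            by (simp add: x_def option.map_sel)
        qed (simp add: x_def)
      qed
      have "uniform_limit {0..t} (\<lambda>k s. riemann_sum (\<lambda>t \<omega>. map_option F' (X t \<omega>)) X (T k) s \<omega>)
          (\<lambda>s. F (x s \<omega>) - F (x 0 \<omega>) - 1/2 * LS_integral s (\<lambda>s. q s \<omega>) (\<lambda>s. F'' (x s \<omega>))) sequentially"
        by (rule iffD2[OF uniform_limit_cong' u]) (simp_all only: riem)
      then show "(\<forall>s\<in>{0..t}. Some (I s \<omega>) \<noteq> None) \<and>
        uniform_limit {0..t} (\<lambda>k s. riemann_sum (\<lambda>t \<omega>. map_option F' (X t \<omega>)) X (T k) s \<omega>)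
          (\<lambda>s. the (Some (I s \<omega>))) sequentially"
        by (simp add: I_def L_def)
    qed
  qed
  have "quasi_always J Js (\<lambda>t \<omega>. X t \<omega> \<noteq> None \<and> Some (I t \<omega>) \<noteq> None \<and>
              (\<forall>s\<in>{0..t}. X s \<omega> \<noteq> None \<and> Some (q s \<omega>) \<noteq> None) \<and>
              F (the (X t \<omega>)) = F (the (X 0 \<omega>)) + the (Some (I t \<omega>))
                + 1/2 * LS_integral t (\<lambda>s. the (Some (q s \<omega>))) (\<lambda>s. F'' (the (X s \<omega>))))"
  proof (rule quasi_always_mono[OF qX])
    fix t :: real and \<omega> assume *: "0 \<le> t" "\<omega> \<in> Omega J" "X t \<omega> \<noteq> None"
    have "\<forall>s\<in>{0..t}. X s \<omega> \<noteq> None" using dom[OF *(2,1,3)] by blast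
    then show "X t \<omega> \<noteq> None \<and> Some (I t \<omega>) \<noteq> None \<and>
              (\<forall>s\<in>{0..t}. X s \<omega> \<noteq> None \<and> Some (q s \<omega>) \<noteq> None) \<and>
              F (the (X t \<omega>)) = F (the (X 0 \<omega>)) + the (Some (I t \<omega>))
                + 1/2 * LS_integral t (\<lambda>s. the (Some (q s \<omega>))) (\<lambda>s. F'' (the (X s \<omega>)))"
      using *(3) by (simp add: I_def L_def x_def)
  qed
  with ito qv show ?thesis by blast
qed

end
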